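(* Let $\alpha>0$, and for each $N$ let $G$ be an $N\times N$ matrix from the complex induced Ginibre ensemble with rectangularity index $L=\alpha N$. Then the scaled spectral radius $\frac{r_{max}^{(N)}(G)}{\sqrt{L+N}}$ and the scaled minimum modulus $\frac{r_{min}^{(N)}(G)}{\sqrt{L+N}}$ are independent random variables in the limit as $N\to\infty$; that is, for all real $r>0$ and $R>0$, $$\lim_{N\to+\infty}P\left(\frac{r_{min}^{(N)}(G)}{\sqrt{L+N}}\ge r\ \text{and}\ \frac{r_{max}^{(N)}(G)}{\sqrt{L+N}}\le R\right)=\lim_{N\to+\infty}P\left(\frac{r_{min}^{(N)}(G)}{\sqrt{L+N}}\ge r\right)\lim_{N\to+\infty}P\left(\frac{r_{max}^{(N)}(G)}{\sqrt{L+N}}\le R\right).$$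
   Context: The complex induced Ginibre ensemble with rectangularity index $L\ge0$ is the set of $N\times N$ complex matrices $G$ with density (with respect to Lebesgue measure on the entries) proportional to $\left(\det G^\dagger G\right)^{L}\exp\left(-\mathrm{Tr}\,G^\dagger G\right)$. The joint density of its eigenvalues $\lambda_1,\dots,\lambda_N\in\mathbb C$ is $\frac{1}{Z_N}\prod_{j<k}|\lambda_k-\lambda_j|^2\prod_{j=1}^N|\lambda_j|^{2L}\exp\left(-\sum_{j=1}^N|\lambda_j|^2\right)$ with $Z_N=N!\,\pi^N\prod_{k=1}^N\Gamma(k+L)$. Here $r_{min}^{(N)}(G)=\min_j|\lambda_j|$ and $r_{max}^{(N)}(G)=\max_j|\lambda_j|$. *)

theory Defs
  imports
    "HOL-Probability.Probability"
    "Jordan_Normal_Form.Spectral_Radius"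
    "Jordan_Normal_Form.Schur_Decomposition"
begin

text \<open>
  Lebesgue measure on the \<open>N \<times> N\<close> complex matrices: the product, over the \<open>N\<^sup>2\<close> entries, of planar
  Lebesgue measure, transported along the bijection \<^term>\<open>mat N N\<close> from families of entries
  to \<open>carrier_mat N N\<close>.
\<close>

definition lborel_mat :: "nat \<Rightarrow> complex mat measure" where
  "lborel_mat N =
     embed_measure (PiM ({0..<N} \<times> {0..<N}) (\<lambda>_. lborel :: complex measure)) (mat N N)"

definition mat_trace :: "'a :: comm_monoid_add mat \<Rightarrow> 'a" where
  "mat_trace A = (\<Sum>i = 0..<dim_row A. A $$ (i, i))"

text \<open>
  The determinant and trace of \<open>G\<^sup>\<dagger>G\<close> are nonnegative reals, so \<^const>\<open>Re\<close> only changes the type.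
  Where \<open>det G = 0\<close>, a null set, \<^const>\<open>powr\<close> yields \<open>0\<close> even for \<open>L = 0\<close>.
\<close>

definition induced_ginibre_weight :: "real \<Rightarrow> complex mat \<Rightarrow> real" where
  "induced_ginibre_weight L G =
     Re (Determinant.det (mat_adjoint G * G)) powr L * exp (- Re (mat_trace (mat_adjoint G * G)))"

text \<open>
  Since \<open>M\<close> is a probability space, the constant \<open>c\<close> is the reciprocal of the integral of the weight.
\<close>

definition induced_ginibre :: "nat \<Rightarrow> real \<Rightarrow> 'w measure \<Rightarrow> ('w \<Rightarrow> complex mat) \<Rightarrow> bool" where
  "induced_ginibre N L M G \<longleftrightarrow>
     prob_space M \<and>
     (\<exists>c > 0. distributed M (lborel_mat N) G (\<lambda>A. ennreal (c * induced_ginibre_weight L A)))"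

text \<open>The largest modulus of an eigenvalue is \<^const>\<open>spectral_radius\<close>; this is the smallest one.\<close>

definition min_modulus :: "complex mat \<Rightarrow> real" where
  "min_modulus A = Min (norm ` spectrum A)"

end

theory Submission
  imports
    Defs
    "HOL-Complex_Analysis.Complex_Analysis"
    "HOL-Real_Asymp.Real_Asymp"
begin

text \<open>
  Everything rests on Kostlan's theorem: the squared moduli of the eigenvalues behave like independent
  gamma variables with shapes \<open>L + 1, \<dots>, L + N\<close>. Since the ensemble is given by its matrix density, the
  eigenvalue density has to be derived first. Instead of a Schur decomposition, eigenvalues are split
  off one at a time: a matrix with corner \<open>D\<close>, last column \<open>u\<close> and an eigenvalue \<open>z\<close> with eigenvector
  \<open>(v, 1)\<close> has \<open>u = (z - D) v\<close>, and its last diagonal entry is a rational function of \<open>z\<close> of degree \<open>n + 1\<close>,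
  which is a covering of the plane with \<open>n + 1\<close> sheets. Changing variables from the entries to
  \<open>(z, v, w, g)\<close>, where \<open>g\<close> is the quotient by the eigenline, and then applying a unitary that maps the
  eigenvector to a multiple of the last basis vector, yields the Gaussian weight of \<open>g\<close> times
  \<open>\<bar>det (z - g)\<bar>\<^sup>2\<close>. Iterating gives the Vandermonde density, and orthogonality of the monomials for
  radial weights factors the probability that all squared moduli lie in a given set.

  A gamma law concentrates at its shape up to exponentially small mass, so the product of the \<open>N\<close>
  factors tends to 1 away from the edge. At the edge itself, and beyond it, an unbounded number of factors
  stay below a fixed constant less than 1, so the product tends to 0. Hence the limiting probabilities are
  all 0 or 1, and independence is automatic.
\<close>

section \<open>Change of variables under rational functions\<close>

text \<open>A Schur decomposition would call for an invariant volume on a flag manifold and for a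
  measurable ordering of the eigenvalues. Splitting off one eigenvalue avoids both: all coordinates
  range over flat spaces with Lebesgue measure, and the sheets are summed, so that a matrix is
  counted once for each eigenvalue and none has to be selected. The covering has its full number of
  sheets only if the matrix and its corner share no eigenvalue, which holds almost everywhere by a
  resultant argument. The Jacobian is \<open>|det (z - D)|^2\<close> for the column times
  \<open>|da/dz|^2\<close> for the last diagonal entry a, and the two combine to the squared modulus
  at z of the characteristic polynomial of the quotient. The Jacobian of the unitary change of basis
  depends on the eigenvector alone and integrates to a constant, which is never evaluated: total
  mass 1 fixes it at the end. The induction on the size carries an arbitrary weight that is
  multiplicative over the roots, because the factor left by one step has to be absorbed into the
  weight of the next.\<close>

definition cvec :: "complex \<Rightarrow> real^2" where
  "cvec z = vector [Re z, Im z]"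

definition vecc :: "real^2 \<Rightarrow> complex" where
  "vecc x = Complex (x $ 1) (x $ 2)"

lemma vecc_cvec [simp]: "vecc (cvec z) = z"
  by (simp add: cvec_def vecc_def)

lemma cvec_vecc [simp]: "cvec (vecc x) = x"
  by (simp add: cvec_def vecc_def Finite_Cartesian_Product.vec_eq_iff forall_2)

lemma linear_cvec: "linear cvec"
  by (auto intro!: linearI simp: cvec_def Finite_Cartesian_Product.vec_eq_iff forall_2)

lemma linear_vecc: "linear vecc"
  by (auto intro!: linearI simp: vecc_def complex_eq_iff)

lemma measurable_cvec [measurable]: "cvec \<in> borel \<rightarrow>\<^sub>M borel"
  using linear_cvec by (intro borel_measurable_continuous_onI linear_continuous_on linear_conv_bounded_linear[THEN iffD1])

lemma measurable_vecc [measurable]: "vecc \<in> borel \<rightarrow>\<^sub>M borel"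
  using linear_vecc by (intro borel_measurable_continuous_onI linear_continuous_on linear_conv_bounded_linear[THEN iffD1])

lemma Basis_real2: "(Basis :: (real^2) set) = {axis 1 1, axis 2 1}"
  by (auto simp: Basis_vec_def UNIV_2)

text \<open>The Jacobian formula used below lives on \<open>real^2\<close>, so planar measure is
  carried there by coordinates. These map boxes to boxes of the same volume, and boxes determine the
  measure.\<close>

lemma lborel_cvec: "(lborel :: (real^2) measure) = distr lborel borel cvec"
proof (rule lborel_eqI)
  fix l u :: "real^2" assume le: "\<And>b. b \<in> Basis \<Longrightarrow> l \<bullet> b \<le> u \<bullet> b"
  have ne: "axis 1 (1::real) \<noteq> (axis 2 1 :: real^2)"
    by (simp add: axis_eq_axis)
  have "cvec -` box l u = box (vecc l) (vecc u)"
    by (auto simp: box_def Basis_real2 Basis_complex_def cvec_def vecc_def inner_axis)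
  moreover have "l $ 1 \<le> u $ 1" "l $ 2 \<le> u $ 2"
    using le[of "axis 1 1"] le[of "axis 2 1"] by (auto simp: Basis_real2 inner_axis)
  ultimately show "emeasure (distr lborel borel cvec) (box l u) = ennreal (\<Prod>b\<in>Basis. (u - l) \<bullet> b)"
    using ne by (simp add: emeasure_distr emeasure_lborel_box_eq Basis_complex_def Basis_real2 vecc_def inner_axis
         ennreal_mult)
qed simp

text \<open>Over the reals, multiplication by \<open>g' z\<close> is a rotation with scaling, of
  determinant \<open>(cmod (g' z))\<^sup>2\<close>; this is the Jacobian. Boundedness makes the
  measure of the image a real number, as the integral form of the change of variables
  requires.\<close>

lemma emeasure_complex_image:
  fixes g g' :: "complex \<Rightarrow> complex"
  assumes [measurable]: "g' \<in> borel_measurable borel" and S: "S \<in> sets borel" and gS: "g ` S \<in> sets borel" and bdd: "bounded (g ` S)"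
    and inj: "inj_on g S" and der: "\<And>z. z \<in> S \<Longrightarrow> (g has_field_derivative g' z) (at z)"
  shows "(\<integral>\<^sup>+z. ennreal ((cmod (g' z))\<^sup>2) * indicator S z \<partial>lborel) = emeasure lborel (g ` S)"
proof -
  define h where "h = (\<lambda>x. cvec (g (vecc x)))"
  define h' where "h' = (\<lambda>x y. cvec (g' (vecc x) * vecc y))"
  define T where "T = vecc -` S"
  have T: "T \<in> sets borel"
    using measurable_sets[OF measurable_vecc S] by (simp add: T_def)
  have hT: "h ` T = vecc -` (g ` S)"
  proof (intro equalityI subsetI)
    fix x assume "x \<in> vecc -` (g ` S)"
    then obtain z where z: "z \<in> S" "vecc x = g z" by auto
    then have "h (cvec z) = x" "cvec z \<in> T"
      by (simp_all add: h_def T_def flip: z(2))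
    then show "x \<in> h ` T" by force
  qed (auto simp: h_def T_def)
  then have hTb: "h ` T \<in> sets borel"
    using measurable_sets[OF measurable_vecc gS] by simp
  have "h ` T = cvec ` (g ` S)"
    unfolding hT
  proof (intro equalityI subsetI)
    fix x assume "x \<in> vecc -` (g ` S)"
    then show "x \<in> cvec ` (g ` S)"
      using image_eqI[of x cvec "vecc x" "g ` S"] by simp
  qed auto
  then have "bounded (h ` T)"
    using bdd linear_cvec bounded_linear_image linear_conv_bounded_linear by metis
  then have lm: "h ` T \<in> lmeasurable"
    using hTb by (intro bounded_set_imp_lmeasurable) auto
  have em: "emeasure lborel (h ` T) = emeasure lborel (g ` S)"
    using gS unfolding hT by (subst lborel_cvec)
      (simp add: emeasure_distr measurable_sets[OF measurable_vecc gS, simplified] vimage_def)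
  have hd: "(h has_derivative h' x) (at x within T)" if "x \<in> T" for x
  proof -
    have 1: "(g has_derivative (*) (g' (vecc x))) (at (vecc x))"
      using der[of "vecc x"] that by (simp add: T_def has_field_derivative_def)
    have 2: "(vecc has_derivative vecc) (at x)"
      using linear_vecc by (simp add: linear_imp_has_derivative)
    have 3: "(cvec has_derivative cvec) (at (g (vecc x)))"
      using linear_cvec by (simp add: linear_imp_has_derivative)
    have "(h has_derivative h' x) (at x)"
      using diff_chain_at[OF diff_chain_at[OF 2 1] , of cvec cvec] 3
      by (simp add: h_def h'_def o_def)
    then show ?thesis
      by (rule has_derivative_at_withinI)
  qed
  have injh: "inj_on h T"
    using inj unfolding inj_on_def h_def T_def by (metis vecc_cvec cvec_vecc vimageD)
  have det: "Determinants.det (matrix (h' x)) = (cmod (g' (vecc x)))\<^sup>2" for x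
    by (simp add: det_2 matrix_def h'_def cvec_def vecc_def axis_def cmod_power2) (simp add: power2_eq_square)
  have "((\<lambda>x. (cmod (g' (vecc x)))\<^sup>2) has_integral measure lebesgue (h ` T)) T"
    using has_measure_differentiable_image[OF _ hd injh, of "measure lebesgue (h ` T)"] lm T
    by (simp add: det)
  from nn_integral_has_integral_lebesgue'[OF _ this]
  have "(\<integral>\<^sup>+x. ennreal ((cmod (g' (vecc x)))\<^sup>2) * indicator T x \<partial>lborel) = ennreal (measure lebesgue (h ` T))"
    by simp
  also have "\<dots> = emeasure lborel (h ` T)"
  proof -
    have "emeasure lborel (h ` T) = emeasure lebesgue (h ` T)"
      using hTb by (simp add: main_part_sets)
    also have "\<dots> = ennreal (measure lebesgue (h ` T))"
      using fmeasurableD2[OF lm] by (intro emeasure_eq_ennreal_measure) (simp add: less_top)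
    finally show ?thesis by simp
  qed
  also have "\<dots> = emeasure lborel (g ` S)" by (rule em)
  also have "(\<integral>\<^sup>+x. ennreal ((cmod (g' (vecc x)))\<^sup>2) * indicator T x \<partial>lborel) =
     (\<integral>\<^sup>+z. ennreal ((cmod (g' z))\<^sup>2) * indicator S z \<partial>lborel)"
  proof -
    have eq: "lborel = distr lborel borel vecc"
    proof -
      have "distr (lborel::(real^2) measure) borel vecc = distr lborel borel (vecc \<circ> cvec)"
        by (subst lborel_cvec) (simp add: distr_distr)
      also have "vecc \<circ> cvec = (\<lambda>x. x)" by (simp add: fun_eq_iff)
      finally show ?thesis by (simp add: distr_id2)
    qed
    have [measurable]: "S \<in> sets borel" by fact
    show ?thesis
      by (subst eq, subst nn_integral_distr) (auto simp: T_def indicator_def)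
  qed
  finally show ?thesis .
qed

lemma card_roots_rsquarefree:
  fixes p :: "complex poly"
  assumes "rsquarefree p"
  shows "card {z. poly p z = 0} = degree p"
proof -
  from assms have p: "p \<noteq> 0" and o: "order a p = 0 \<or> order a p = 1" for a
    by (auto simp: rsquarefree_def)
  have "degree p = size (proots p)"
    by (simp add: size_proots_complex)
  also have "\<dots> = (\<Sum>x\<in>{z. poly p z = 0}. order x p)"
    using p by (simp add: size_multiset_overloaded_eq)
  also have "\<dots> = (\<Sum>x\<in>{z. poly p z = 0}. 1)"
  proof (intro sum.cong refl)
    fix x assume "x \<in> {z. poly p z = 0}"
    then show "order x p = 1" using o[of x] p by (auto simp: order_root)
  qed
  finally show ?thesis by simp
qed

text \<open>Each piece \<open>A i\<close> holds at most one solution of \<open>g z = a\<close>, so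
  counting the images that contain \<open>a\<close> counts the solutions: this is the number of
  sheets over \<open>a\<close>.\<close>

lemma suminf_indicator_image:
  assumes disj: "disjoint_family A" and inj: "\<And>i. inj_on g (A i)"
    and fin: "finite {z \<in> (\<Union>i. A i). g z = a}"
  shows "(\<Sum>i. indicator (g ` A i) a :: ennreal) = of_nat (card {z \<in> (\<Union>i. A i). g z = a})"
proof -
  define R where "R = {z \<in> (\<Union>i. A i). g z = a}"
  have fin: "finite R" using fin by (simp add: R_def)
  have "(indicator (g ` A i) a :: ennreal) = (\<Sum>z\<in>R. indicator (A i) z)" for i
  proof (cases "a \<in> g ` A i")
    case True
    then obtain z where z: "z \<in> A i" "g z = a" by auto
    then have "R \<inter> A i = {z}"
      using inj[of i] by (auto simp: R_def inj_on_def)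
    then show ?thesis
      using True fin by (simp add: sum_indicator_eq_card flip: sum_indicator_eq_card)
         (simp add: indicator_def if_distrib sum.If_cases)
  next
    case False
    then have "R \<inter> A i = {}" by (auto simp: R_def)
    then have "(\<Sum>z\<in>R. indicator (A i) z) = (0::ennreal)"
      by (intro sum.neutral) (auto simp: indicator_def)
    with False show ?thesis by simp
  qed
  then have "(\<Sum>i. indicator (g ` A i) a :: ennreal) = (\<Sum>z\<in>R. \<Sum>i. indicator (A i) z)"
    by (simp add: suminf_sum)
  also have "\<dots> = (\<Sum>z\<in>R. 1)"
    using suminf_indicator[OF disj] by (intro sum.cong) (auto simp: R_def)
  finally show ?thesis by (simp add: R_def)
qed

text \<open>The image is the preimage of \<open>S\<close> under the holomorphic inverse of
  \<open>g\<close> on the open set of its values; direct images of Borel sets carry no measurability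
  by themselves.\<close>

lemma borel_image_holomorphic:
  assumes hol: "g holomorphic_on U" and U: "open U" and inj: "inj_on g U"
    and S: "S \<in> sets borel" "S \<subseteq> U"
  shows "g ` S \<in> sets borel"
proof -
  obtain h where h: "h holomorphic_on (g ` U)" "\<And>z. z \<in> U \<Longrightarrow> h (g z) = z"
    using holomorphic_has_inverse[OF hol U inj] by metis
  have V: "open (g ` U)"
    using open_mapping_thm3[OF hol U inj] .
  have "h \<in> measurable (restrict_space borel (g ` U)) borel"
    using h(1) by (intro borel_measurable_continuous_on_restrict holomorphic_on_imp_continuous_on)
  from measurable_sets[OF this S(1)] have "h -` S \<inter> g ` U \<in> sets borel"
    using V by (simp add: space_restrict_space sets_restrict_space_iff)
  also have "h -` S \<inter> g ` U = g ` S"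
    using h(2) S(2) by auto
  finally show ?thesis .
qed

text \<open>
  A coprime quotient \<open>g = P/Q\<close> takes every noncritical value exactly \<open>degree P\<close> times.
\<close>

lemma nn_integral_rational_pushforward:
  fixes P Q :: "complex poly" and F :: "complex \<Rightarrow> ennreal"
  assumes P: "lead_coeff P = 1" "degree P = Suc n" and Q: "lead_coeff Q = 1" "degree Q = n"
    and cop: "\<And>z. poly Q z = 0 \<Longrightarrow> poly P z \<noteq> 0"
    and F: "F \<in> borel_measurable borel"
  shows "(\<integral>\<^sup>+z. ennreal ((cmod (poly (pderiv P * Q - P * pderiv Q) z / (poly Q z)\<^sup>2))\<^sup>2) *
            F (poly P z / poly Q z) \<partial>lborel) = of_nat (Suc n) * (\<integral>\<^sup>+a. F a \<partial>lborel)"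
proof -
  define W where "W = pderiv P * Q - P * pderiv Q"
  define g where "g = (\<lambda>z. poly P z / poly Q z)"
  define g' where "g' = (\<lambda>z. poly W z / (poly Q z)\<^sup>2)"
  define G where "G = {z. poly Q z \<noteq> 0 \<and> poly W z \<noteq> 0}"
  have Q0: "Q \<noteq> 0" using Q by auto
  \<comment> \<open>The leading terms n + 1 and n of the two products do not cancel. So
    \<open>W\<close>, the numerator of the derivative, is a nonzero polynomial and the critical
    points are finite in number.\<close>
  have "coeff W (2 * n) = 1"
  proof -
    have 1: "coeff (pderiv P * Q) (n + n) = of_nat (Suc n)"
      using coeff_mult_degree_sum[of "pderiv P" Q] P Q by (simp add: degree_pderiv coeff_pderiv)
    have 2: "coeff (P * pderiv Q) (n + n) = of_nat n"
    proof (cases n)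
      case 0
      then have "pderiv Q = 0" using Q by (simp add: pderiv_eq_0_iff)
      then show ?thesis using 0 by simp
    next
      case (Suc m)
      then show ?thesis
        using coeff_mult_degree_sum[of P "pderiv Q"] P Q by (simp add: degree_pderiv coeff_pderiv)
    qed
    show ?thesis using 1 2 by (simp add: W_def mult_2)
  qed
  then have W0: "W \<noteq> 0" by auto
  have [measurable]: "g \<in> borel_measurable borel" "g' \<in> borel_measurable borel"
    unfolding g_def g'_def by (intro borel_measurable_divide borel_measurable_power
       borel_measurable_continuous_onI continuous_intros)+
  have openG: "open G"
  proof -
    have "open {z. poly Q z \<noteq> 0}" "open {z. poly W z \<noteq> 0}"
      by (intro open_Collect_neq continuous_intros)+
    then show ?thesis unfolding G_def by (rule open_Collect_conj)
  qed
  have der: "(g has_field_derivative g' z) (at z)" if "poly Q z \<noteq> 0" for z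
    unfolding g_def g'_def W_def using that
    by (auto intro!: derivative_eq_intros poly_DERIV simp: power2_eq_square)
  have hol: "g holomorphic_on G"
    unfolding g_def G_def by (intro holomorphic_intros) auto
  have finB: "finite (- G)"
  proof -
    have "- G = {z. poly Q z = 0} \<union> {z. poly W z = 0}" by (auto simp: G_def)
    then show ?thesis using poly_roots_finite[OF Q0] poly_roots_finite[OF W0] by simp
  qed
  \<comment> \<open>Balls on which \<open>g\<close> is injective cover the noncritical points.
    Countably many suffice, and making them disjoint yields pieces to which the area formula
    applies.\<close>
  define BB where "BB = {ball z r | z r. ball z r \<subseteq> G \<and> inj_on g (ball z r)}"
  have BBG: "\<Union>BB = G"
  proof (intro equalityI subsetI)
    fix z assume z: "z \<in> G"
    have "deriv g z \<noteq> 0"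
      using der[of z] z by (auto simp: DERIV_imp_deriv G_def g'_def)
    then obtain r where r: "r > 0" "ball z r \<subseteq> G" "inj_on g (ball z r)"
      using has_complex_derivative_locally_injective[OF hol z openG] by metis
    then have "ball z r \<in> BB" "z \<in> ball z r" by (auto simp: BB_def)
    then show "z \<in> \<Union>BB" by (rule UnionI)
  qed (auto simp: BB_def)
  obtain BB' where BB': "BB' \<subseteq> BB" "countable BB'" "\<Union>BB' = \<Union>BB"
    using Lindelof[of BB] by (auto simp: BB_def)
  have "\<Union>BB' \<noteq> {}"
    using BB'(3) BBG finB by (metis Compl_empty_eq infinite_UNIV_char_0)
  then have ne: "BB' \<noteq> {}" by auto
  define U where "U = from_nat_into BB'"
  have U: "U i \<in> BB'" for i
    using from_nat_into[OF ne] by (simp add: U_def)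
  have UG: "(\<Union>i. U i) = G"
    using range_from_nat_into[OF ne BB'(2)] BB'(3) BBG by (simp add: U_def)
  have U': "open (U i)" "U i \<subseteq> G" "inj_on g (U i)" for i
    using U[of i] BB'(1) by (auto simp: BB_def)
  define A where "A = disjointed U"
  have AU: "A i \<subseteq> U i" for i by (simp add: A_def disjointed_subset)
  have disj: "disjoint_family A" by (simp add: A_def disjoint_family_disjointed)
  have AG: "(\<Union>i. A i) = G" using UG by (simp add: A_def UN_disjointed_eq)
  have Ab [measurable]: "A i \<in> sets borel" for i
  proof -
    have "range U \<subseteq> sets borel" using U'(1) by auto
    then show ?thesis using sets.range_disjointed_sets[of U borel] unfolding A_def by blast
  qed
  have injA: "inj_on g (A i)" for i
    using inj_on_subset[OF U'(3) AU] .
  have img: "g ` S \<in> sets borel" if "S \<in> sets borel" "S \<subseteq> A i" for S i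
    using borel_image_holomorphic[OF holomorphic_on_subset[OF hol U'(2)] U'(1) U'(3)] that AU by blast
  have [measurable]: "g ` A i \<in> sets borel" for i using img Ab by blast
  define Crit where "Crit = g ` {z. poly W z = 0}"
  have "finite Crit" unfolding Crit_def using poly_roots_finite[OF W0] by simp
  \<comment> \<open>The fibre over \<open>a\<close> is the root set of \<open>P - a Q\<close>, of
    degree n + 1. A double root would be a zero of \<open>W\<close>, hence a critical point, which
    \<open>a \<notin> Crit\<close> excludes.\<close>
  have count: "(\<Sum>i. indicator (g ` A i) a :: ennreal) = of_nat (Suc n)" if a: "a \<notin> Crit" for a
  proof -
    define p where "p = P - Polynomial.smult a Q"
    have dp: "degree p = Suc n"
    proof -
      have "degree (Polynomial.smult a Q) < degree P" using P Q by (metis degree_smult_le le_imp_less_Suc)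
      then show ?thesis using P degree_add_eq_left[of "- Polynomial.smult a Q" P] by (simp add: p_def)
    qed
    have root: "poly p z = 0 \<longleftrightarrow> poly Q z \<noteq> 0 \<and> g z = a" for z
      using cop[of z] by (auto simp: p_def g_def field_simps)
    have G: "z \<in> G" if "poly p z = 0" for z
      using that a unfolding root by (auto simp: G_def Crit_def)
    have eq: "{z \<in> (\<Union>i. A i). g z = a} = {z. poly p z = 0}"
      unfolding AG using root G by (auto simp: G_def)
    have "rsquarefree p"
      unfolding rsquarefree_roots
    proof (intro allI notI, elim conjE)
      fix z assume 1: "poly p z = 0" and 2: "poly (pderiv p) z = 0"
      have "poly W z = poly (pderiv P) z * poly Q z - poly P z * poly (pderiv Q) z"
        by (simp add: W_def)
      also have "poly P z = a * poly Q z" using 1 by (simp add: p_def)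
      also have "poly (pderiv P) z = a * poly (pderiv Q) z"
        using 2 by (simp add: p_def pderiv_diff pderiv_smult)
      finally have "poly W z = 0" by simp
      with G[OF 1] show False by (simp add: G_def)
    qed
    from card_roots_rsquarefree[OF this] have c: "card {z. poly p z = 0} = Suc n" by (simp add: dp)
    then have "finite {z. poly p z = 0}" by (metis card.infinite nat.distinct(1))
    then show ?thesis
      using suminf_indicator_image[OF disj injA, of a] c unfolding eq by simp
  qed
  \<comment> \<open>The pushforward of the density, divided by the number of sheets, is identified
    with Lebesgue measure on boxes. The box also bounds the images of the pieces, as the area
    formula demands.\<close>
  define M where "M = density (distr (density lborel (\<lambda>z. ennreal ((cmod (g' z))\<^sup>2))) borel g) (\<lambda>_. ennreal (1 / real (Suc n)))"
  have "lborel = M"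
  proof (rule lborel_eqI)
    show "sets M = sets borel" by (simp add: M_def)
    fix l u :: complex assume lu: "\<And>b. b \<in> Basis \<Longrightarrow> l \<bullet> b \<le> u \<bullet> b"
    let ?B = "box l u"
    have [measurable]: "g -` ?B \<in> sets borel"
      using measurable_sets[of g borel borel ?B] by simp
    have "emeasure M ?B = ennreal (1 / real (Suc n)) * emeasure (distr (density lborel (\<lambda>z. ennreal ((cmod (g' z))\<^sup>2))) borel g) ?B"
      unfolding M_def by (simp add: emeasure_density nn_integral_cmult_indicator)
    also have "emeasure (distr (density lborel (\<lambda>z. ennreal ((cmod (g' z))\<^sup>2))) borel g) ?B
        = (\<integral>\<^sup>+z. ennreal ((cmod (g' z))\<^sup>2) * indicator (g -` ?B) z \<partial>lborel)"
      by (simp add: emeasure_distr emeasure_density)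
    also have "\<dots> = (\<integral>\<^sup>+z\<in>(\<Union>i. A i). ennreal ((cmod (g' z))\<^sup>2) * indicator (g -` ?B) z \<partial>lborel)"
    proof (intro nn_integral_cong_AE)
      have "AE z in lborel. z \<notin> - G"
        using finite_imp_null_set_lborel[OF finB] by (rule AE_not_in)
      then show "AE z in lborel. ennreal ((cmod (g' z))\<^sup>2) * indicator (g -` ?B) z =
         ennreal ((cmod (g' z))\<^sup>2) * indicator (g -` ?B) z * indicator (\<Union>i. A i) z"
        by eventually_elim (simp add: AG)
    qed
    also have "\<dots> = (\<Sum>i. \<integral>\<^sup>+z\<in>A i. ennreal ((cmod (g' z))\<^sup>2) * indicator (g -` ?B) z \<partial>lborel)"
      by (intro nn_integral_disjoint_family disj) auto
    also have "\<dots> = (\<Sum>i. \<integral>\<^sup>+a. indicator (g ` A i) a * indicator ?B a \<partial>lborel)"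
    proof (intro suminf_cong)
      fix i
      let ?S = "A i \<inter> g -` ?B"
      have "(\<integral>\<^sup>+z\<in>A i. ennreal ((cmod (g' z))\<^sup>2) * indicator (g -` ?B) z \<partial>lborel) =
        (\<integral>\<^sup>+z. ennreal ((cmod (g' z))\<^sup>2) * indicator ?S z \<partial>lborel)"
        by (intro nn_integral_cong) (auto simp: indicator_def)
      also have "\<dots> = emeasure lborel (g ` ?S)"
      proof (rule emeasure_complex_image)
        show "?S \<in> sets borel" by simp
        then show "g ` ?S \<in> sets borel" using img by blast
        show "bounded (g ` ?S)" by (rule bounded_subset[of ?B]) auto
        show "inj_on g ?S" using injA by (rule inj_on_subset) auto
        show "(g has_field_derivative g' z) (at z)" if "z \<in> ?S" for z
          using that AG by (intro der) (auto simp: G_def)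
      qed simp
      also have "g ` ?S = g ` A i \<inter> ?B" by auto
      also have "emeasure lborel (g ` A i \<inter> ?B) = (\<integral>\<^sup>+a. indicator (g ` A i \<inter> ?B) a \<partial>lborel)"
        by simp
      also have "\<dots> = (\<integral>\<^sup>+a. indicator (g ` A i) a * indicator ?B a \<partial>lborel)"
        by (intro nn_integral_cong) (auto simp: indicator_def)
      finally show "(\<integral>\<^sup>+z\<in>A i. ennreal ((cmod (g' z))\<^sup>2) * indicator (g -` ?B) z \<partial>lborel) = \<dots>" .
    qed
    also have "\<dots> = (\<integral>\<^sup>+a. (\<Sum>i. indicator (g ` A i) a * indicator ?B a) \<partial>lborel)"
      by (intro nn_integral_suminf[symmetric]) auto
    also have "\<dots> = (\<integral>\<^sup>+a. of_nat (Suc n) * indicator ?B a \<partial>lborel)"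
    proof (intro nn_integral_cong_AE)
      have "AE a in lborel. a \<notin> Crit"
        using finite_imp_null_set_lborel[OF \<open>finite Crit\<close>] by (rule AE_not_in)
      then show "AE a in lborel. (\<Sum>i. indicator (g ` A i) a * indicator ?B a) = of_nat (Suc n) * (indicator ?B a :: ennreal)"
        by eventually_elim (simp only: ennreal_suminf_multc count not_False_eq_True)
    qed
    also have "\<dots> = of_nat (Suc n) * emeasure lborel ?B"
      by (simp add: nn_integral_cmult_indicator)
    also have "ennreal (1 / real (Suc n)) * (of_nat (Suc n) * emeasure lborel ?B) = emeasure lborel ?B"
      by (simp add: ennreal_of_nat_eq_real_of_nat flip: ennreal_mult mult.assoc del: of_nat_Suc)
    finally show "emeasure M ?B = ennreal (\<Prod>b\<in>Basis. (u - l) \<bullet> b)"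
      using lu by (simp add: emeasure_lborel_box)
  qed
  then have "(\<integral>\<^sup>+a. F a \<partial>lborel) = (\<integral>\<^sup>+a. F a \<partial>M)" by simp
  also have "\<dots> = ennreal (1 / real (Suc n)) * (\<integral>\<^sup>+z. ennreal ((cmod (g' z))\<^sup>2) * F (g z) \<partial>lborel)"
    using F unfolding M_def
    by (simp add: nn_integral_density nn_integral_distr nn_integral_cmult)
  finally have "of_nat (Suc n) * (\<integral>\<^sup>+a. F a \<partial>lborel) = (\<integral>\<^sup>+z. ennreal ((cmod (g' z))\<^sup>2) * F (g z) \<partial>lborel)"
    by (simp add: ennreal_of_nat_eq_real_of_nat flip: ennreal_mult mult.assoc del: of_nat_Suc)
  then show ?thesis by (simp add: g_def g'_def W_def)
qed

section \<open>Linear changes of variables\<close>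

lemma nn_integral_complex_translate:
  fixes F :: "complex \<Rightarrow> ennreal"
  assumes [measurable]: "F \<in> borel_measurable borel"
  shows "(\<integral>\<^sup>+z. F (c + z) \<partial>lborel) = (\<integral>\<^sup>+z. F z \<partial>lborel)"
  by (subst (2) lborel_distr_plus[of c, symmetric]) (simp add: nn_integral_distr)

lemma nn_integral_complex_cmult:
  fixes F :: "complex \<Rightarrow> ennreal"
  assumes c: "c \<noteq> 0" and [measurable]: "F \<in> borel_measurable borel"
  shows "(\<integral>\<^sup>+z. ennreal ((cmod c)\<^sup>2) * F (c * z) \<partial>lborel) = (\<integral>\<^sup>+z. F z \<partial>lborel)"
proof -
  have "lborel = density (distr lborel borel ((*) c)) (\<lambda>_. ennreal ((cmod c)\<^sup>2))"
  proof (rule lborel_eqI)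
    fix l u :: complex assume lu: "\<And>b. b \<in> Basis \<Longrightarrow> l \<bullet> b \<le> u \<bullet> b"
    let ?S = "(*) c -` box l u"
    have S [measurable]: "?S \<in> sets borel"
      using measurable_sets[of "(*) c" borel borel "box l u"] by simp
    have im: "(*) c ` ?S = box l u"
    proof (intro equalityI subsetI)
      fix x assume "x \<in> box l u"
      then show "x \<in> (*) c ` ?S"
        using c image_eqI[of x "(*) c" "x / c" ?S] by simp
    qed auto
    have "(\<integral>\<^sup>+z. ennreal ((cmod c)\<^sup>2) * indicator ?S z \<partial>lborel) = emeasure lborel ((*) c ` ?S)"
    proof (rule emeasure_complex_image[OF _ S])
      show "(*) c ` ?S \<in> sets borel" "bounded ((*) c ` ?S)" by (simp_all only: im) simp_all
      show "inj_on ((*) c) ?S" using c by (simp add: inj_on_def)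
      show "((*) c has_field_derivative c) (at z)" for z by (auto intro!: derivative_eq_intros)
    qed simp
    then have "ennreal ((cmod c)\<^sup>2) * emeasure lborel ?S = emeasure lborel (box l u)"
      unfolding im by (subst (asm) nn_integral_cmult_indicator) simp_all
    moreover have "emeasure (density (distr lborel borel ((*) c)) (\<lambda>_. ennreal ((cmod c)\<^sup>2))) (box l u)
        = ennreal ((cmod c)\<^sup>2) * emeasure lborel ?S"
      by (subst emeasure_density) (simp_all add: nn_integral_cmult_indicator emeasure_distr)
    ultimately show "emeasure (density (distr lborel borel ((*) c)) (\<lambda>_. ennreal ((cmod c)\<^sup>2))) (box l u)
        = ennreal (\<Prod>b\<in>Basis. (u - l) \<bullet> b)"
      using lu by (simp only: emeasure_lborel_box)
  qed simp
  then have "(\<integral>\<^sup>+z. F z \<partial>lborel) = (\<integral>\<^sup>+z. F z \<partial>density (distr lborel borel ((*) c)) (\<lambda>_. ennreal ((cmod c)\<^sup>2)))"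
    by simp
  also have "\<dots> = (\<integral>\<^sup>+z. ennreal ((cmod c)\<^sup>2) * F (c * z) \<partial>lborel)"
    by (simp add: nn_integral_density nn_integral_distr)
  finally show ?thesis ..
qed

section \<open>Integrals over finite products of planar Lebesgue measure\<close>

abbreviation lb :: "'i set \<Rightarrow> ('i \<Rightarrow> complex) measure" where
  "lb I \<equiv> PiM I (\<lambda>_. lborel)"

interpretation lb: product_sigma_finite "\<lambda>_::'i. lborel :: complex measure"
  by standard

lemma sigma_finite_lb: "finite I \<Longrightarrow> sigma_finite_measure (lb I)"
  by (rule lb.sigma_finite)

text \<open>A product measure is determined by its values on boxes, and maps that preserve each
  factor preserve these values.\<close>

lemma nn_integral_lb_componentwise:
  fixes F :: "('i \<Rightarrow> complex) \<Rightarrow> ennreal"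
  assumes I: "finite I" and T: "\<And>i. i \<in> I \<Longrightarrow> distr lborel borel (T i) = (lborel :: complex measure)"
      "\<And>i. i \<in> I \<Longrightarrow> T i \<in> borel_measurable borel"
    and [measurable]: "F \<in> borel_measurable (lb I)"
  shows "(\<integral>\<^sup>+x. F (\<lambda>i\<in>I. T i (x i)) \<partial>lb I) = (\<integral>\<^sup>+x. F x \<partial>lb I)"
proof -
  have [measurable]: "(\<lambda>x. \<lambda>i\<in>I. T i (x i)) \<in> measurable (lb I) (lb I)"
    using T(2) by (intro measurable_restrict) simp
  have "distr (lb I) (lb I) (\<lambda>x. \<lambda>i\<in>I. T i (x i)) = lb I"
  proof (rule lb.PiM_eqI)
    fix A :: "'i \<Rightarrow> complex set" assume A: "\<And>i. i \<in> I \<Longrightarrow> A i \<in> sets lborel"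
    have "(\<lambda>x. \<lambda>i\<in>I. T i (x i)) -` (Pi\<^sub>E I A) \<inter> space (lb I) = (\<Pi>\<^sub>E i\<in>I. T i -` A i)"
      by (auto simp: space_PiM PiE_iff extensional_def)
    moreover have "T i -` A i \<in> sets borel" if "i \<in> I" for i
      using measurable_sets[OF T(2)[OF that], of "A i"] A that by simp
    moreover have "emeasure lborel (T i -` A i) = emeasure lborel (A i)" if "i \<in> I" for i
    proof -
      have "emeasure lborel (A i) = emeasure (distr lborel borel (T i)) (A i)" using T(1)[OF that] by simp
      also have "\<dots> = emeasure lborel (T i -` A i)"
        using T(2)[OF that] A[OF that] by (simp add: emeasure_distr)
      finally show ?thesis ..
    qed
    ultimately show "emeasure (distr (lb I) (lb I) (\<lambda>x. \<lambda>i\<in>I. T i (x i))) (Pi\<^sub>E I A) = (\<Prod>i\<in>I. emeasure lborel (A i))"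
      using A I by (simp add: emeasure_distr lb.emeasure_PiM)
  qed (use I in simp_all)
  then have "(\<integral>\<^sup>+x. F x \<partial>lb I) = (\<integral>\<^sup>+x. F x \<partial>distr (lb I) (lb I) (\<lambda>x. \<lambda>i\<in>I. T i (x i)))"
    by simp
  then show ?thesis by (simp add: nn_integral_distr)
qed

lemma nn_integral_lb_translate:
  fixes F :: "('i \<Rightarrow> complex) \<Rightarrow> ennreal"
  assumes I: "finite I" and F: "F \<in> borel_measurable (lb I)"
  shows "(\<integral>\<^sup>+x. F (\<lambda>i\<in>I. c i + x i) \<partial>lb I) = (\<integral>\<^sup>+x. F x \<partial>lb I)"
  using nn_integral_lb_componentwise[OF I _ _ F, of "\<lambda>i. (+) (c i)"] by (simp add: lborel_distr_plus)

lemma nn_integral_lb_reindex: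
  fixes F :: "('j \<Rightarrow> complex) \<Rightarrow> ennreal"
  assumes I: "finite I" and p: "bij_betw p J I"
    and [measurable]: "F \<in> borel_measurable (lb J)"
  shows "(\<integral>\<^sup>+x. F (\<lambda>j\<in>J. x (p j)) \<partial>lb I) = (\<integral>\<^sup>+x. F x \<partial>lb J)"
proof -
  have J: "finite J" using p I by (simp add: bij_betw_finite)
  have pJ: "p j \<in> I" if "j \<in> J" for j using p that by (auto simp: bij_betw_def)
  have [measurable]: "(\<lambda>x. \<lambda>j\<in>J. x (p j)) \<in> measurable (lb I) (lb J)"
    using pJ by (intro measurable_restrict) simp
  have "distr (lb I) (lb J) (\<lambda>x. \<lambda>j\<in>J. x (p j)) = lb J"
  proof (rule lb.PiM_eqI)
    fix A :: "'j \<Rightarrow> complex set" assume A: "\<And>i. i \<in> J \<Longrightarrow> A i \<in> sets lborel"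
    define q where "q = the_inv_into J p"
    have q: "q (p j) = j" if "j \<in> J" for j
      using p that by (simp add: q_def bij_betw_def the_inv_into_f_f)
    have pq: "p (q i) = i \<and> q i \<in> J" if "i \<in> I" for i
      using p that unfolding q_def bij_betw_def by (auto simp: f_the_inv_into_f the_inv_into_into)
    have "(\<lambda>x. \<lambda>j\<in>J. x (p j)) -` (Pi\<^sub>E J A) \<inter> space (lb I) = (\<Pi>\<^sub>E i\<in>I. A (q i))"
    proof (intro equalityI subsetI)
      fix x assume "x \<in> (\<lambda>x. \<lambda>j\<in>J. x (p j)) -` (Pi\<^sub>E J A) \<inter> space (lb I)"
      then have *: "x (p j) \<in> A j" if "j \<in> J" for j using that by (auto simp: PiE_iff)
      have "x i \<in> A (q i)" if "i \<in> I" for i using pq[OF that] *[of "q i"] by simp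
      then show "x \<in> (\<Pi>\<^sub>E i\<in>I. A (q i))"
        using \<open>x \<in> _\<close> by (auto simp: PiE_iff space_PiM)
    next
      fix x assume "x \<in> (\<Pi>\<^sub>E i\<in>I. A (q i))"
      then show "x \<in> (\<lambda>x. \<lambda>j\<in>J. x (p j)) -` (Pi\<^sub>E J A) \<inter> space (lb I)"
        using q pJ by (fastforce simp: PiE_iff space_PiM)
    qed
    moreover have "A (q i) \<in> sets borel" if "i \<in> I" for i using A[of "q i"] pq that by simp
    ultimately have "emeasure (distr (lb I) (lb J) (\<lambda>x. \<lambda>j\<in>J. x (p j))) (Pi\<^sub>E J A) = (\<Prod>i\<in>I. emeasure lborel (A (q i)))"
      using A I J by (simp add: emeasure_distr lb.emeasure_PiM)
    also have "\<dots> = (\<Prod>j\<in>J. emeasure lborel (A j))"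
      unfolding prod.reindex_bij_betw[OF p, symmetric] by (intro prod.cong) (simp_all add: q)
    finally show "emeasure (distr (lb I) (lb J) (\<lambda>x. \<lambda>j\<in>J. x (p j))) (Pi\<^sub>E J A) = (\<Prod>j\<in>J. emeasure lborel (A j))" .
  qed (use J in simp_all)
  then have "(\<integral>\<^sup>+x. F x \<partial>lb J) = (\<integral>\<^sup>+x. F x \<partial>distr (lb I) (lb J) (\<lambda>x. \<lambda>j\<in>J. x (p j)))"
    by simp
  then show ?thesis by (simp add: nn_integral_distr)
qed

section \<open>Linear substitutions and their determinants\<close>

lemma nn_integral_lb_Suc:
  fixes F :: "(nat \<Rightarrow> complex) \<Rightarrow> ennreal"
  assumes "F \<in> borel_measurable (lb {0..<Suc n})"
  shows "(\<integral>\<^sup>+x. F x \<partial>lb {0..<Suc n}) = (\<integral>\<^sup>+x. \<integral>\<^sup>+t. F (x(n := t)) \<partial>lborel \<partial>lb {0..<n})"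
    and "(\<integral>\<^sup>+x. F x \<partial>lb {0..<Suc n}) = (\<integral>\<^sup>+t. \<integral>\<^sup>+x. F (x(n := t)) \<partial>lb {0..<n} \<partial>lborel)"
  using assms lb.product_nn_integral_insert[of "{0..<n}" n F] lb.product_nn_integral_insert_rev[of "{0..<n}" n F]
  by (simp_all add: atLeast0_lessThan_Suc)

text \<open>The restriction keeps values in the extensional function space that carries
  \<open>lb\<close>, so that a matrix acts directly on families of coordinates.\<close>

definition mvf :: "nat \<Rightarrow> complex mat \<Rightarrow> (nat \<Rightarrow> complex) \<Rightarrow> nat \<Rightarrow> complex" where
  "mvf n A x = (\<lambda>i\<in>{0..<n}. \<Sum>j\<in>{0..<n}. A $$ (i, j) * x j)"

lemma measurable_mvf [measurable]: "mvf n A \<in> measurable (lb {0..<n}) (lb {0..<n})"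
  unfolding mvf_def by measurable

lemma measurable_upd_lb [measurable]:
  "(\<lambda>(x, t). x(n := t)) \<in> measurable (lb {0..<n} \<Otimes>\<^sub>M lborel) (lb {0..<Suc n})"
  using measurable_add_dim[of n "{0..<n}" "\<lambda>_. lborel :: complex measure"] by (simp add: atLeast0_lessThan_Suc)

lemma measurable_upd_lb' [measurable (raw)]:
  assumes "f \<in> measurable M (lb {0..<n})" "g \<in> borel_measurable M"
  shows "(\<lambda>x. (f x)(n := g x)) \<in> measurable M (lb {0..<Suc n})"
  using measurable_compose[OF measurable_Pair[OF assms(1)], OF _ measurable_upd_lb, of g] assms(2) by simp

text \<open>Gaussian elimination with pivot \<open>d\<close> and Schur complement \<open>B\<close>.
  Integrating over the last coordinate first makes the last component of the image a new variable,
  at the cost of \<open>|d|^2\<close>. After the exchange of integrals the other components are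
  \<open>B x\<close> plus a shift by a multiple of that variable, so the smaller case and
  translation invariance apply.\<close>

lemma nn_integral_linear_pivot:
  fixes F :: "(nat \<Rightarrow> complex) \<Rightarrow> ennreal"
  assumes IH: "\<And>B F. B \<in> carrier_mat n n \<Longrightarrow> Determinant.det B \<noteq> 0 \<Longrightarrow> F \<in> borel_measurable (lb {0..<n}) \<Longrightarrow>
      (\<integral>\<^sup>+x. ennreal ((cmod (Determinant.det B))\<^sup>2) * F (mvf n B x) \<partial>lb {0..<n}) = (\<integral>\<^sup>+x. F x \<partial>lb {0..<n})"
    and A: "A \<in> carrier_mat (Suc n) (Suc n)" and det: "Determinant.det A \<noteq> 0" and d: "A $$ (n, n) \<noteq> 0"
    and F [measurable]: "F \<in> borel_measurable (lb {0..<Suc n})"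
  shows "(\<integral>\<^sup>+x. ennreal ((cmod (Determinant.det A))\<^sup>2) * F (mvf (Suc n) A x) \<partial>lb {0..<Suc n}) = (\<integral>\<^sup>+x. F x \<partial>lb {0..<Suc n})"
proof -
  define d where "d = A $$ (n, n)"
  define B where "B = mat n n (\<lambda>(i, j). A $$ (i, j) - A $$ (i, n) * A $$ (n, j) / d)"
  have d0: "d \<noteq> 0" using assms by (simp add: d_def)
  have detA: "Determinant.det A = Determinant.det B * d"
  proof -
    \<comment> \<open>\<open>U\<close> clears the last row of \<open>A\<close> to the left of the
      pivot, so \<open>A * U\<close> is block upper triangular with diagonal blocks \<open>B\<close>
      and \<open>d\<close>.\<close>
    define U where "U = four_block_mat (1\<^sub>m n) (0\<^sub>m n 1) (mat 1 n (\<lambda>(i, j). - A $$ (n, j) / d)) (1\<^sub>m 1)"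
    have U: "U \<in> carrier_mat (Suc n) (Suc n)"
      unfolding U_def by (rule four_block_carrier_mat[of _ n n _ 1 1, simplified]) auto
    have detU: "Determinant.det U = 1"
      unfolding U_def by (subst det_four_block_mat_upper_right_zero[of _ n _ 1]) auto
    have "A * U = four_block_mat B (mat n 1 (\<lambda>(i, j). A $$ (i, n))) (0\<^sub>m 1 n) (mat 1 1 (\<lambda>_. d))"
    proof (rule eq_matI)
      fix i j assume ij: "i < dim_row (four_block_mat B (mat n 1 (\<lambda>(i, j). A $$ (i, n))) (0\<^sub>m 1 n) (mat 1 1 (\<lambda>_. d)))"
         "j < dim_col (four_block_mat B (mat n 1 (\<lambda>(i, j). A $$ (i, n))) (0\<^sub>m 1 n) (mat 1 1 (\<lambda>_. d)))"
      then have ij': "i < Suc n" "j < Suc n" by (auto simp: B_def)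
      have "(A * U) $$ (i, j) = (\<Sum>k\<in>{0..<Suc n}. A $$ (i, k) * U $$ (k, j))"
        using ij' A U by (simp add: scalar_prod_def)
      also have "\<dots> = (\<Sum>k\<in>{0..<n}. A $$ (i, k) * U $$ (k, j)) + A $$ (i, n) * U $$ (n, j)"
        by simp
      also have "(\<Sum>k\<in>{0..<n}. A $$ (i, k) * U $$ (k, j)) = (\<Sum>k\<in>{0..<n}. if k = j then A $$ (i, k) else 0)"
        using ij' by (intro sum.cong) (auto simp: U_def)
      also have "\<dots> = (if j < n then A $$ (i, j) else 0)" by simp
      also have "A $$ (i, n) * U $$ (n, j) = (if j < n then - A $$ (i, n) * A $$ (n, j) / d else A $$ (i, n))"
        using ij' by (auto simp: U_def)
      finally show "(A * U) $$ (i, j) = four_block_mat B (mat n 1 (\<lambda>(i, j). A $$ (i, n))) (0\<^sub>m 1 n) (mat 1 1 (\<lambda>_. d)) $$ (i, j)"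
        using ij' d0 by (auto simp: B_def less_Suc_eq) (auto simp: d_def)
    qed (use A U in \<open>auto simp: B_def\<close>)
    then have "Determinant.det A * Determinant.det U = Determinant.det B * Determinant.det (mat 1 1 (\<lambda>_. d))"
      using A U by (simp flip: det_mult[of _ "Suc n"])
         (intro det_four_block_mat_lower_left_zero[of _ n _ 1], auto simp: B_def)
    then show ?thesis by (simp add: detU det_single)
  qed
  then have detB: "Determinant.det B \<noteq> 0" using det by auto
  define c where "c = (\<lambda>x. \<Sum>j\<in>{0..<n}. A $$ (n, j) * x j)"
  have [measurable]: "c \<in> borel_measurable (lb {0..<n})" unfolding c_def by measurable
  define H where "H = (\<lambda>x t. F ((\<lambda>i\<in>{0..<n}. A $$ (i, n) / d * t + mvf n B x i)(n := t)))"
  have [measurable]: "(\<lambda>(x, t). H x t) \<in> borel_measurable (lb {0..<n} \<Otimes>\<^sub>M lborel)"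
  proof -
    have "(\<lambda>p. (\<lambda>i\<in>{0..<n}. A $$ (i, n) / d * snd p + mvf n B (fst p) i)(n := snd p))
       \<in> measurable (lb {0..<n} \<Otimes>\<^sub>M lborel) (lb {0..<Suc n})"
    proof (intro measurable_upd_lb' measurable_restrict)
      fix i assume i: "i \<in> {0..<n}"
      have [measurable]: "(\<lambda>x. mvf n B x i) \<in> borel_measurable (lb {0..<n})"
        using measurable_compose[OF measurable_mvf measurable_component_singleton[OF i]] by simp
      show "(\<lambda>p. A $$ (i, n) / d * snd p + mvf n B (fst p) i) \<in> measurable (lb {0..<n} \<Otimes>\<^sub>M lborel) lborel"
        by simp
    qed simp
    from measurable_compose[OF this F] show ?thesis
      by (simp only: H_def case_prod_beta')
  qed
  have H_m [measurable]: "H x \<in> borel_measurable borel" if "x \<in> space (lb {0..<n})" for x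
    using measurable_Pair2[OF \<open>(\<lambda>(x, t). H x t) \<in> _\<close> that] by simp
  have eq: "F (mvf (Suc n) A (x(n := t))) = H x (c x + d * t)" if "x \<in> space (lb {0..<n})" for x t
  proof -
    have "mvf (Suc n) A (x(n := t)) = (\<lambda>i\<in>{0..<n}. A $$ (i, n) / d * (c x + d * t) + mvf n B x i)(n := c x + d * t)"
    proof
      fix i
      have 1: "(\<Sum>j\<in>{0..<Suc n}. A $$ (i, j) * (x(n := t)) j) = (\<Sum>j\<in>{0..<n}. A $$ (i, j) * x j) + A $$ (i, n) * t"
        by simp
      have 2: "(\<Sum>j\<in>{0..<n}. (A $$ (i, j) - A $$ (i, n) * A $$ (n, j) / d) * x j) =
          (\<Sum>j\<in>{0..<n}. A $$ (i, j) * x j) - A $$ (i, n) / d * c x"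
        by (simp add: c_def algebra_simps sum_subtractf sum_distrib_left)
      consider "i < n" | "i = n" | "i > n" by linarith
      then show "mvf (Suc n) A (x(n := t)) i = ((\<lambda>i\<in>{0..<n}. A $$ (i, n) / d * (c x + d * t) + mvf n B x i)(n := c x + d * t)) i"
      proof cases
        case 1
        then have "mvf n B x i = (\<Sum>j\<in>{0..<n}. (A $$ (i, j) - A $$ (i, n) * A $$ (n, j) / d) * x j)"
          by (auto simp: mvf_def B_def)
        then show ?thesis
          using 1 d0 unfolding 2 by (simp add: mvf_def field_simps del: sum.op_ivl_Suc) (simp add: algebra_simps)
      next
        case 2
        then show ?thesis by (simp add: mvf_def c_def d_def)
      next
        case 3
        then show ?thesis by (simp add: mvf_def)
      qed
    qed
    then show ?thesis by (simp add: H_def)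
  qed
  have "(\<integral>\<^sup>+x. ennreal ((cmod (Determinant.det A))\<^sup>2) * F (mvf (Suc n) A x) \<partial>lb {0..<Suc n}) =
     (\<integral>\<^sup>+x. \<integral>\<^sup>+t. ennreal ((cmod (Determinant.det A))\<^sup>2) * F (mvf (Suc n) A (x(n := t))) \<partial>lborel \<partial>lb {0..<n})"
    by (rule nn_integral_lb_Suc) measurable
  also have "\<dots> = (\<integral>\<^sup>+x. ennreal ((cmod (Determinant.det B))\<^sup>2) * (\<integral>\<^sup>+t. H x t \<partial>lborel) \<partial>lb {0..<n})"
  proof (intro nn_integral_cong)
    fix x assume x: "x \<in> space (lb {0..<n})"
    note [measurable] = H_m[OF x]
    have "(\<integral>\<^sup>+t. ennreal ((cmod (Determinant.det A))\<^sup>2) * F (mvf (Suc n) A (x(n := t))) \<partial>lborel) =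
       (\<integral>\<^sup>+t. ennreal ((cmod (Determinant.det B))\<^sup>2) * (ennreal ((cmod d)\<^sup>2) * H x (c x + d * t)) \<partial>lborel)"
      by (simp add: eq[OF x] detA norm_mult power_mult_distrib ennreal_mult mult.assoc)
    also have "\<dots> = ennreal ((cmod (Determinant.det B))\<^sup>2) * (\<integral>\<^sup>+t. ennreal ((cmod d)\<^sup>2) * H x (c x + d * t) \<partial>lborel)"
      by (intro nn_integral_cmult) measurable
    also have "(\<integral>\<^sup>+t. ennreal ((cmod d)\<^sup>2) * H x (c x + d * t) \<partial>lborel) = (\<integral>\<^sup>+t. H x t \<partial>lborel)"
      using nn_integral_complex_cmult[OF d0, of "\<lambda>t. H x (c x + t)"] nn_integral_complex_translate[of "H x" "c x"]
      by simp
    finally show "(\<integral>\<^sup>+t. ennreal ((cmod (Determinant.det A))\<^sup>2) * F (mvf (Suc n) A (x(n := t))) \<partial>lborel) =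
      ennreal ((cmod (Determinant.det B))\<^sup>2) * (\<integral>\<^sup>+t. H x t \<partial>lborel)" .
  qed
  also have "\<dots> = (\<integral>\<^sup>+x. \<integral>\<^sup>+t. ennreal ((cmod (Determinant.det B))\<^sup>2) * H x t \<partial>lborel \<partial>lb {0..<n})"
    by (intro nn_integral_cong nn_integral_cmult[symmetric]) simp
  also have "\<dots> = (\<integral>\<^sup>+t. \<integral>\<^sup>+x. ennreal ((cmod (Determinant.det B))\<^sup>2) * H x t \<partial>lb {0..<n} \<partial>lborel)"
    by (rule pair_sigma_finite.Fubini'[symmetric])
       (auto intro!: pair_sigma_finite.intro sigma_finite_lb lborel.sigma_finite_measure_axioms)
  also have "\<dots> = (\<integral>\<^sup>+t. \<integral>\<^sup>+x. F (x(n := t)) \<partial>lb {0..<n} \<partial>lborel)"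
  proof (rule nn_integral_cong)
    fix t :: complex
    have "(\<integral>\<^sup>+x. ennreal ((cmod (Determinant.det B))\<^sup>2) * H x t \<partial>lb {0..<n}) =
        (\<integral>\<^sup>+x. F ((\<lambda>i\<in>{0..<n}. A $$ (i, n) / d * t + x i)(n := t)) \<partial>lb {0..<n})"
    proof -
      have m: "(\<lambda>x. F ((\<lambda>i\<in>{0..<n}. A $$ (i, n) / d * t + x i)(n := t))) \<in> borel_measurable (lb {0..<n})"
      proof (rule measurable_compose[OF _ F], intro measurable_upd_lb' measurable_restrict)
        fix i assume "i \<in> {0..<n}"
        then show "(\<lambda>x. A $$ (i, n) / d * t + x i) \<in> measurable (lb {0..<n}) lborel" by simp
      qed simp
      show ?thesis
        unfolding H_def by (rule IH[OF _ detB m]) (simp add: B_def)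
    qed
    also have "\<dots> = (\<integral>\<^sup>+x. F (x(n := t)) \<partial>lb {0..<n})"
    proof -
      have m: "(\<lambda>x. F (x(n := t))) \<in> borel_measurable (lb {0..<n})" by measurable
      show ?thesis by (rule nn_integral_lb_translate[OF _ m]) simp
    qed
    finally show "(\<integral>\<^sup>+x. ennreal ((cmod (Determinant.det B))\<^sup>2) * H x t \<partial>lb {0..<n}) =
        (\<integral>\<^sup>+x. F (x(n := t)) \<partial>lb {0..<n})" .
  qed
  also have "\<dots> = (\<integral>\<^sup>+x. F x \<partial>lb {0..<Suc n})"
    by (rule nn_integral_lb_Suc(2)[symmetric]) measurable
  finally show ?thesis .
qed

text \<open>Serves to create a nonzero pivot. Once the last coordinate is fixed, adding it to
  another one is a translation.\<close>

lemma nn_integral_shear: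
  fixes F :: "(nat \<Rightarrow> complex) \<Rightarrow> ennreal"
  assumes j: "j < n" and [measurable]: "F \<in> borel_measurable (lb {0..<Suc n})"
  shows "(\<integral>\<^sup>+x. F (x(j := x n + x j)) \<partial>lb {0..<Suc n}) = (\<integral>\<^sup>+x. F x \<partial>lb {0..<Suc n})"
proof -
  have [measurable]: "(\<lambda>x. x(j := x n + x j)) \<in> measurable (lb {0..<Suc n}) (lb {0..<Suc n})"
  proof (rule measurable_PiM_single')
    show "(\<lambda>x. (x(j := x n + x j)) i) \<in> measurable (lb {0..<Suc n}) lborel" if "i \<in> {0..<Suc n}" for i
      using that j by (cases "i = j") auto
  qed (use j in \<open>auto simp: space_PiM PiE_iff extensional_def\<close>)
  have "(\<integral>\<^sup>+x. F (x(j := x n + x j)) \<partial>lb {0..<Suc n}) =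
     (\<integral>\<^sup>+t. \<integral>\<^sup>+x. F ((\<lambda>i\<in>{0..<n}. (if i = j then t else 0) + x i)(n := t)) \<partial>lb {0..<n} \<partial>lborel)"
    using j by (subst nn_integral_lb_Suc(2)) (auto intro!: nn_integral_cong arg_cong[of _ _ F] simp: fun_eq_iff space_PiM PiE_iff extensional_def)
  also have "\<dots> = (\<integral>\<^sup>+t. \<integral>\<^sup>+x. F (x(n := t)) \<partial>lb {0..<n} \<partial>lborel)"
    by (intro nn_integral_cong nn_integral_lb_translate[where F = "\<lambda>x. F (x(n := _))"]) auto
  also have "\<dots> = (\<integral>\<^sup>+x. F x \<partial>lb {0..<Suc n})"
    by (rule nn_integral_lb_Suc(2)[symmetric]) measurable
  finally show ?thesis .
qed

theorem nn_integral_linear: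
  fixes F :: "(nat \<Rightarrow> complex) \<Rightarrow> ennreal"
  assumes "A \<in> carrier_mat n n" "Determinant.det A \<noteq> 0" "F \<in> borel_measurable (lb {0..<n})"
  shows "(\<integral>\<^sup>+x. ennreal ((cmod (Determinant.det A))\<^sup>2) * F (mvf n A x) \<partial>lb {0..<n}) = (\<integral>\<^sup>+x. F x \<partial>lb {0..<n})"
  using assms
proof (induction n arbitrary: A F)
  case 0
  then show ?case
    by (simp add: lb.nn_integral_empty mvf_def restrict_def space_PiM)
next
  case (Suc n)
  note [measurable] = Suc.prems(3)
  note A = Suc.prems(1)
  show ?case
  proof (cases "A $$ (n, n) = 0")
    case False
    then show ?thesis
      using nn_integral_linear_pivot[OF Suc.IH Suc.prems(1,2) False Suc.prems(3)] by blast
  next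
    case True
    have "\<exists>j<n. A $$ (n, j) \<noteq> 0"
    proof (rule ccontr)
      assume "\<not> (\<exists>j<n. A $$ (n, j) \<noteq> 0)"
      with True have "A $$ (n, j) = 0" if "j < Suc n" for j
        using that by (auto simp: less_Suc_eq)
      then have "Determinant.det A = 0"
        using laplace_expansion_row[OF A, of n] by simp
      with Suc.prems show False by simp
    qed
    then obtain j where j: "j < n" "A $$ (n, j) \<noteq> 0" by auto
    \<comment> \<open>Adding column j to column n makes the pivot nonzero; on the side of the
      argument this replaces \<open>x j\<close> by \<open>x n + x j\<close>, a shear.\<close>
    define A2 where "A2 = addcol 1 n j A"
    have A2: "A2 \<in> carrier_mat (Suc n) (Suc n)" "A2 $$ (n, n) \<noteq> 0"
      using A j True by (auto simp: A2_def)
    have det: "Determinant.det A2 = Determinant.det A"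
      unfolding A2_def using j A by (intro det_addcol[of _ "Suc n"]) auto
    have mvf2: "mvf (Suc n) A (x(j := x n + x j)) = mvf (Suc n) A2 x" for x
    proof (rule ext)
      fix i
      show "mvf (Suc n) A (x(j := x n + x j)) i = mvf (Suc n) A2 x i"
      proof (cases "i < Suc n")
        case True
        have "(\<Sum>k\<in>{0..<Suc n}. A $$ (i, k) * (x(j := x n + x j)) k) = (\<Sum>k\<in>{0..<Suc n}. A $$ (i, k) * x k + (if k = j then A $$ (i, j) * x n else 0))"
          by (intro sum.cong) (auto simp: algebra_simps)
        also have "\<dots> = (\<Sum>k\<in>{0..<Suc n}. A $$ (i, k) * x k) + A $$ (i, j) * x n"
          using j by (simp add: sum.distrib)
        also have "\<dots> = (\<Sum>k\<in>{0..<Suc n}. A $$ (i, k) * x k + (if k = n then A $$ (i, j) * x n else 0))"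
          by (simp add: sum.distrib)
        also have "\<dots> = (\<Sum>k\<in>{0..<Suc n}. A2 $$ (i, k) * x k)"
          using A True by (intro sum.cong) (auto simp: A2_def algebra_simps)
        finally show ?thesis using True by (simp add: mvf_def)
      qed (simp add: mvf_def)
    qed
    have "(\<integral>\<^sup>+x. ennreal ((cmod (Determinant.det A))\<^sup>2) * F (mvf (Suc n) A x) \<partial>lb {0..<Suc n}) =
       (\<integral>\<^sup>+x. ennreal ((cmod (Determinant.det A2))\<^sup>2) * F (mvf (Suc n) A2 x) \<partial>lb {0..<Suc n})"
      using nn_integral_shear[OF j(1), of "\<lambda>x. ennreal ((cmod (Determinant.det A))\<^sup>2) * F (mvf (Suc n) A x)"]
      by (simp add: mvf2 det)
    also have "\<dots> = (\<integral>\<^sup>+x. F x \<partial>lb {0..<Suc n})"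
      by (rule nn_integral_linear_pivot[OF Suc.IH A2(1) _ A2(2) Suc.prems(3)]) (use Suc.prems(2) det in simp_all)
    finally show ?thesis .
  qed
qed

text \<open>The renaming \<open>p\<close> makes the last column and the last row of a matrix
  families over the same index set, although they occupy different positions.\<close>

lemma nn_integral_lb_split:
  fixes F :: "('i \<Rightarrow> complex) \<Rightarrow> ennreal" and p :: "'i \<Rightarrow> 'k"
  assumes fin: "finite I" "finite J" and disj: "I \<inter> J = {}" and p: "bij_betw p J K"
    and F [measurable]: "F \<in> borel_measurable (lb (I \<union> J))"
  shows "(\<integral>\<^sup>+x. F x \<partial>lb (I \<union> J)) = (\<integral>\<^sup>+x. \<integral>\<^sup>+y. F (\<lambda>i\<in>I \<union> J. if i \<in> I then x i else y (p i)) \<partial>lb K \<partial>lb I)"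
proof -
  have K: "finite K" using p fin by (simp add: bij_betw_finite)
  have "(\<integral>\<^sup>+x. F x \<partial>lb (I \<union> J)) = (\<integral>\<^sup>+x. \<integral>\<^sup>+y. F (merge I J (x, y)) \<partial>lb J \<partial>lb I)"
    using lb.product_nn_integral_fold[OF disj fin F] .
  also have "\<dots> = (\<integral>\<^sup>+x. \<integral>\<^sup>+y. F (\<lambda>i\<in>I \<union> J. if i \<in> I then x i else y (p i)) \<partial>lb K \<partial>lb I)"
  proof (rule nn_integral_cong)
    fix x assume x: "x \<in> space (lb I)"
    have m: "(\<lambda>y. F (merge I J (x, y))) \<in> borel_measurable (lb J)"
      by (rule measurable_compose[OF _ F], rule measurable_compose[OF measurable_Pair1'[OF x] measurable_merge])
    have "(\<integral>\<^sup>+y. F (merge I J (x, y)) \<partial>lb J) = (\<integral>\<^sup>+y. F (merge I J (x, \<lambda>j\<in>J. y (p j))) \<partial>lb K)"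
      by (rule nn_integral_lb_reindex[OF K p m, symmetric])
    also have "\<dots> = (\<integral>\<^sup>+y. F (\<lambda>i\<in>I \<union> J. if i \<in> I then x i else y (p i)) \<partial>lb K)"
      by (intro nn_integral_cong arg_cong[of _ _ F]) (auto simp: merge_def fun_eq_iff)
    finally show "(\<integral>\<^sup>+y. F (merge I J (x, y)) \<partial>lb J) = (\<integral>\<^sup>+y. F (\<lambda>i\<in>I \<union> J. if i \<in> I then x i else y (p i)) \<partial>lb K)" .
  qed
  finally show ?thesis .
qed

section \<open>Bordered matrices, and matrix multiplication as a substitution of entries\<close>

definition blk :: "nat \<Rightarrow> (nat \<times> nat \<Rightarrow> complex) \<Rightarrow> (nat \<Rightarrow> complex) \<Rightarrow> (nat \<Rightarrow> complex) \<Rightarrow> complex \<Rightarrow> nat \<times> nat \<Rightarrow> complex" where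
  "blk n D u w a = (\<lambda>(i, j)\<in>{0..<Suc n} \<times> {0..<Suc n}.
     if i < n then (if j < n then D (i, j) else u i) else (if j < n then w j else a))"

lemma measurable_blk [measurable (raw)]:
  assumes D: "D \<in> measurable M (lb ({0..<n} \<times> {0..<n}))" and u: "u \<in> measurable M (lb {0..<n})"
    and w: "w \<in> measurable M (lb {0..<n})" and a: "a \<in> borel_measurable M"
  shows "(\<lambda>x. blk n (D x) (u x) (w x) (a x)) \<in> measurable M (lb ({0..<Suc n} \<times> {0..<Suc n}))"
  unfolding blk_def
proof (rule measurable_restrict)
  fix ij assume "ij \<in> {0..<Suc n} \<times> {0..<Suc n}"
  then obtain i j where ij: "ij = (i, j)" "i < Suc n" "j < Suc n" by auto
  have 1: "(\<lambda>x. D x (i, j)) \<in> borel_measurable M" if "i < n" "j < n"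
    using measurable_compose[OF D measurable_component_singleton[of "(i, j)"]] that by simp
  have 2: "(\<lambda>x. u x i) \<in> borel_measurable M" if "i < n"
    using measurable_compose[OF u measurable_component_singleton[of i]] that by simp
  have 3: "(\<lambda>x. w x j) \<in> borel_measurable M" if "j < n"
    using measurable_compose[OF w measurable_component_singleton[of j]] that by simp
  show "(\<lambda>x. case ij of (i, j) \<Rightarrow> if i < n then (if j < n then D x (i, j) else u x i)
      else (if j < n then w x j else a x)) \<in> measurable M lborel"
    using 1 2 3 a ij by (cases "i < n"; cases "j < n") simp_all
qed

lemma nn_integral_blk:
  fixes F :: "(nat \<times> nat \<Rightarrow> complex) \<Rightarrow> ennreal"
  assumes F: "F \<in> borel_measurable (lb ({0..<Suc n} \<times> {0..<Suc n}))"
  shows "(\<integral>\<^sup>+x. F x \<partial>lb ({0..<Suc n} \<times> {0..<Suc n})) =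
    (\<integral>\<^sup>+D. \<integral>\<^sup>+u. \<integral>\<^sup>+w. \<integral>\<^sup>+a. F (blk n D u w a) \<partial>lborel \<partial>lb {0..<n} \<partial>lb {0..<n} \<partial>lb ({0..<n} \<times> {0..<n}))"
proof -
  let ?D = "{0..<n} \<times> {0..<n}" and ?U = "{0..<n} \<times> {n}" and ?W = "{n} \<times> {0..<n}"
  let ?I = "?D \<union> ?U \<union> ?W"
  have S: "{0..<Suc n} \<times> {0..<Suc n} = insert (n, n) ?I" by auto
  have bu: "bij_betw fst ?U {0..<n}" by (auto simp: bij_betw_def inj_on_def image_iff)
  have bw: "bij_betw snd ?W {0..<n}" by (auto simp: bij_betw_def inj_on_def image_iff)
  have F' [measurable]: "F \<in> borel_measurable (lb (insert (n, n) ?I))" using F by (simp only: S)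
  have "(\<lambda>x. \<integral>\<^sup>+a. F (x((n, n) := a)) \<partial>lborel) \<in> borel_measurable (lb ?I)"
    by measurable
  define F1 where "F1 = (\<lambda>x. \<integral>\<^sup>+a. F (x((n, n) := a)) \<partial>lborel)"
  have F1: "F1 \<in> borel_measurable (lb ((?D \<union> ?U) \<union> ?W))" unfolding F1_def by measurable
  define F2 where "F2 = (\<lambda>x. \<integral>\<^sup>+w. F1 (\<lambda>i\<in>?I. if i \<in> ?D \<union> ?U then x i else w (snd i)) \<partial>lb {0..<n})"
  interpret w: sigma_finite_measure "lb {0..<n}" by (rule sigma_finite_lb) simp
  have F2: "F2 \<in> borel_measurable (lb (?D \<union> ?U))"
    unfolding F2_def
  proof (rule w.borel_measurable_nn_integral)
    have "(\<lambda>p. \<lambda>i\<in>?I. if i \<in> ?D \<union> ?U then fst p i else snd p (snd i)) \<in> measurable (lb (?D \<union> ?U) \<Otimes>\<^sub>M lb {0..<n}) (lb ?I)"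
    proof (rule measurable_restrict)
      fix i assume i: "i \<in> ?I"
      show "(\<lambda>p. if i \<in> ?D \<union> ?U then fst p i else snd p (snd i)) \<in> measurable (lb (?D \<union> ?U) \<Otimes>\<^sub>M lb {0..<n}) lborel"
      proof (cases "i \<in> ?D \<union> ?U")
        case True
        then show ?thesis
          using measurable_compose[OF measurable_fst measurable_component_singleton[OF True, of "\<lambda>_. lborel"]] by simp
      next
        case False
        with i have s: "snd i \<in> {0..<n}" by auto
        from False show ?thesis
          using measurable_compose[OF measurable_snd measurable_component_singleton[OF s, of "\<lambda>_. lborel"]] by simp
      qed
    qed
    from measurable_compose[OF this F1]
    show "(\<lambda>(x, w). F1 (\<lambda>i\<in>?I. if i \<in> ?D \<union> ?U then x i else w (snd i))) \<in> borel_measurable (lb (?D \<union> ?U) \<Otimes>\<^sub>M lb {0..<n})"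
      by (simp only: case_prod_beta')
  qed
  have "(\<integral>\<^sup>+x. F x \<partial>lb ({0..<Suc n} \<times> {0..<Suc n})) = (\<integral>\<^sup>+x. F1 x \<partial>lb ?I)"
    unfolding S F1_def by (rule lb.product_nn_integral_insert[OF _ _ F']) auto
  also have "\<dots> = (\<integral>\<^sup>+x. F2 x \<partial>lb (?D \<union> ?U))"
    unfolding F2_def by (rule nn_integral_lb_split[OF _ _ _ bw F1]) auto
  also have "\<dots> = (\<integral>\<^sup>+D. \<integral>\<^sup>+u. F2 (\<lambda>i\<in>?D \<union> ?U. if i \<in> ?D then D i else u (fst i)) \<partial>lb {0..<n} \<partial>lb ?D)"
    by (rule nn_integral_lb_split[OF _ _ _ bu F2]) auto
  also have "\<dots> = (\<integral>\<^sup>+D. \<integral>\<^sup>+u. \<integral>\<^sup>+w. \<integral>\<^sup>+a. F (blk n D u w a) \<partial>lborel \<partial>lb {0..<n} \<partial>lb {0..<n} \<partial>lb ?D)"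
    unfolding F2_def F1_def
    by (intro nn_integral_cong arg_cong[of _ _ F]) (auto simp: blk_def fun_eq_iff less_Suc_eq)
  finally show ?thesis .
qed

definition mmf :: "nat \<Rightarrow> nat set \<Rightarrow> complex mat \<Rightarrow> (nat \<times> nat \<Rightarrow> complex) \<Rightarrow> nat \<times> nat \<Rightarrow> complex" where
  "mmf n J A x = (\<lambda>(i, j)\<in>{0..<n} \<times> J. \<Sum>k\<in>{0..<n}. A $$ (i, k) * x (k, j))"

lemma measurable_mmf [measurable]: "mmf n J A \<in> measurable (lb ({0..<n} \<times> J)) (lb ({0..<n} \<times> J))"
  unfolding mmf_def
proof (rule measurable_restrict)
  fix ij assume "ij \<in> {0..<n} \<times> J"
  then show "(\<lambda>x. case ij of (i, j) \<Rightarrow> \<Sum>k\<in>{0..<n}. A $$ (i, k) * x (k, j)) \<in> measurable (lb ({0..<n} \<times> J)) lborel"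
    by (auto intro!: borel_measurable_sum borel_measurable_times)
qed

text \<open>\<open>A\<close> acts on every column separately, so the Jacobian of one column occurs
  once for each index in \<open>J\<close>.\<close>

lemma nn_integral_mmf:
  fixes F :: "(nat \<times> nat \<Rightarrow> complex) \<Rightarrow> ennreal"
  assumes J: "finite J" and A: "A \<in> carrier_mat n n" "Determinant.det A \<noteq> 0"
    and F: "F \<in> borel_measurable (lb ({0..<n} \<times> J))"
  shows "(\<integral>\<^sup>+x. ennreal ((cmod (Determinant.det A))\<^sup>2) ^ card J * F (mmf n J A x) \<partial>lb ({0..<n} \<times> J)) = (\<integral>\<^sup>+x. F x \<partial>lb ({0..<n} \<times> J))"
  using J F
proof (induction J arbitrary: F rule: finite_induct)
  case empty
  have "mmf n {} A x = x" if "x \<in> space (lb ({0..<n} \<times> {}))" for x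
    using that by (auto simp: mmf_def space_PiM)
  then show ?case by (auto intro!: nn_integral_cong)
next
  case (insert j J)
  let ?I = "{0..<n}" and ?c = "ennreal ((cmod (Determinant.det A))\<^sup>2)"
  let ?K = "?I \<times> J \<union> ?I \<times> {j}"
  have S: "?I \<times> insert j J = ?K" by auto
  have b: "bij_betw fst (?I \<times> {j}) ?I" by (auto simp: bij_betw_def inj_on_def image_iff)
  have disj: "?I \<times> J \<inter> ?I \<times> {j} = {}" using insert by auto
  have F: "F \<in> borel_measurable (lb ?K)" using insert.prems by (simp only: S)
  define cmb where "cmb = (\<lambda>x y. \<lambda>i\<in>?K. if i \<in> ?I \<times> J then x i else y (fst i) :: complex)"
  have cmb [measurable]: "(\<lambda>(x, y). cmb x y) \<in> measurable (lb (?I \<times> J) \<Otimes>\<^sub>M lb ?I) (lb ?K)"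
    unfolding cmb_def case_prod_beta'
  proof (rule measurable_restrict)
    fix i assume i: "i \<in> ?K"
    show "(\<lambda>p. if i \<in> ?I \<times> J then fst p i else snd p (fst i)) \<in> measurable (lb (?I \<times> J) \<Otimes>\<^sub>M lb ?I) lborel"
    proof (cases "i \<in> ?I \<times> J")
      case True
      then show ?thesis
        using measurable_compose[OF measurable_fst measurable_component_singleton[OF True, of "\<lambda>_. lborel"]] by simp
    next
      case False
      with i have s: "fst i \<in> ?I" by auto
      from False show ?thesis
        using measurable_compose[OF measurable_snd measurable_component_singleton[OF s, of "\<lambda>_. lborel"]] by simp
    qed
  qed
  have [measurable (raw)]: "(\<lambda>p. cmb (f p) (g p)) \<in> measurable M (lb ?K)"
    if "f \<in> measurable M (lb (?I \<times> J))" "g \<in> measurable M (lb ?I)" for f g and M :: "'z measure"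
    using measurable_compose[OF measurable_Pair[OF that] cmb] by simp
  have split: "(\<integral>\<^sup>+x. G x \<partial>lb ?K) = (\<integral>\<^sup>+x. \<integral>\<^sup>+y. G (cmb x y) \<partial>lb ?I \<partial>lb (?I \<times> J))"
    if "G \<in> borel_measurable (lb ?K)" for G :: "_ \<Rightarrow> ennreal"
    unfolding cmb_def using insert by (intro nn_integral_lb_split[OF _ _ disj b that]) auto
  have mm: "mmf n (insert j J) A (cmb x y) = cmb (mmf n J A x) (mvf n A y)" for x y
    unfolding mmf_def cmb_def mvf_def S using insert by (auto simp: fun_eq_iff intro!: sum.cong)
  have [measurable]: "mmf n (insert j J) A \<in> measurable (lb ?K) (lb ?K)"
    using measurable_mmf[of n "insert j J" A] by (simp only: S)
  note [measurable] = F
  have "(\<integral>\<^sup>+x. ?c ^ card (insert j J) * F (mmf n (insert j J) A x) \<partial>lb ?K) =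
     (\<integral>\<^sup>+x. \<integral>\<^sup>+y. ?c ^ card (insert j J) * F (cmb (mmf n J A x) (mvf n A y)) \<partial>lb ?I \<partial>lb (?I \<times> J))"
    by (subst split) (simp_all add: mm)
  also have "\<dots> = (\<integral>\<^sup>+x. ?c ^ card J * (\<integral>\<^sup>+y. F (cmb (mmf n J A x) y) \<partial>lb ?I) \<partial>lb (?I \<times> J))"
  proof (rule nn_integral_cong)
    fix x assume x: "x \<in> space (lb (?I \<times> J))"
    have x': "mmf n J A x \<in> space (lb (?I \<times> J))" using measurable_space[OF measurable_mmf x] .
    have m: "(\<lambda>y. F (cmb (mmf n J A x) y)) \<in> borel_measurable (lb ?I)"
      using measurable_compose[OF measurable_compose[OF measurable_Pair1'[OF x'] cmb] F] by simp
    have "(\<integral>\<^sup>+y. ?c ^ card (insert j J) * F (cmb (mmf n J A x) (mvf n A y)) \<partial>lb ?I) =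
       (\<integral>\<^sup>+y. ?c ^ card J * (?c * F (cmb (mmf n J A x) (mvf n A y))) \<partial>lb ?I)"
      using insert by (simp add: mult_ac)
    also have "\<dots> = ?c ^ card J * (\<integral>\<^sup>+y. ?c * F (cmb (mmf n J A x) (mvf n A y)) \<partial>lb ?I)"
      using measurable_compose[OF measurable_mvf m] by (intro nn_integral_cmult borel_measurable_times_ennreal) simp_all
    also have "(\<integral>\<^sup>+y. ?c * F (cmb (mmf n J A x) (mvf n A y)) \<partial>lb ?I) = (\<integral>\<^sup>+y. F (cmb (mmf n J A x) y) \<partial>lb ?I)"
      by (rule nn_integral_linear[OF A m])
    finally show "(\<integral>\<^sup>+y. ?c ^ card (insert j J) * F (cmb (mmf n J A x) (mvf n A y)) \<partial>lb ?I) =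
      ?c ^ card J * (\<integral>\<^sup>+y. F (cmb (mmf n J A x) y) \<partial>lb ?I)" .
  qed
  also have "\<dots> = (\<integral>\<^sup>+x. \<integral>\<^sup>+y. F (cmb x y) \<partial>lb ?I \<partial>lb (?I \<times> J))"
  proof (rule insert.IH)
    interpret sigma_finite_measure "lb ?I" by (rule sigma_finite_lb) simp
    show "(\<lambda>x. \<integral>\<^sup>+y. F (cmb x y) \<partial>lb ?I) \<in> borel_measurable (lb (?I \<times> J))"
      by (intro borel_measurable_nn_integral) measurable
  qed
  also have "\<dots> = (\<integral>\<^sup>+x. F x \<partial>lb ?K)" by (rule split[OF F, symmetric])
  finally show ?case by (simp only: S)
qed

definition trf :: "nat \<Rightarrow> (nat \<times> nat \<Rightarrow> complex) \<Rightarrow> nat \<times> nat \<Rightarrow> complex" where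
  "trf n x = (\<lambda>(i, j)\<in>{0..<n} \<times> {0..<n}. x (j, i))"

lemma measurable_trf [measurable]: "trf n \<in> measurable (lb ({0..<n} \<times> {0..<n})) (lb ({0..<n} \<times> {0..<n}))"
  unfolding trf_def by (rule measurable_restrict) auto

lemma nn_integral_trf:
  fixes F :: "(nat \<times> nat \<Rightarrow> complex) \<Rightarrow> ennreal"
  assumes "F \<in> borel_measurable (lb ({0..<n} \<times> {0..<n}))"
  shows "(\<integral>\<^sup>+x. F (trf n x) \<partial>lb ({0..<n} \<times> {0..<n})) = (\<integral>\<^sup>+x. F x \<partial>lb ({0..<n} \<times> {0..<n}))"
proof -
  have b: "bij_betw prod.swap ({0..<n} \<times> {0..<n}) ({0..<n} \<times> {0..<n})"
    by (auto simp: bij_betw_def inj_on_def image_iff)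
  show ?thesis
    using nn_integral_lb_reindex[OF _ b assms] by (simp add: trf_def case_prod_beta' prod.swap_def)
qed

text \<open>Right multiplication by \<open>C\<close> is left multiplication by its transpose between
  two transpositions. The Jacobians \<open>|det B|^(2n)\<close> and \<open>|det C|^(2n)\<close> are
  reciprocal because \<open>B\<close> and \<open>C\<close> are inverse to each other.\<close>

lemma nn_integral_conjugate:
  fixes F :: "(nat \<times> nat \<Rightarrow> complex) \<Rightarrow> ennreal"
  assumes B: "B \<in> carrier_mat n n" and C: "C \<in> carrier_mat n n" and BC: "B * C = 1\<^sub>m n"
    and F [measurable]: "F \<in> borel_measurable (lb ({0..<n} \<times> {0..<n}))"
  shows "(\<integral>\<^sup>+x. F (\<lambda>ij\<in>{0..<n} \<times> {0..<n}. (B * mat n n x * C) $$ ij) \<partial>lb ({0..<n} \<times> {0..<n})) =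
     (\<integral>\<^sup>+x. F x \<partial>lb ({0..<n} \<times> {0..<n}))"
proof -
  let ?I = "{0..<n}" and ?L = "lb ({0..<n} \<times> {0..<n})"
  let ?b = "ennreal ((cmod (Determinant.det B))\<^sup>2)" and ?c = "ennreal ((cmod (Determinant.det C))\<^sup>2)"
  have "Determinant.det B * Determinant.det C = 1"
    using det_mult[OF B C] BC by simp
  then have d: "Determinant.det B \<noteq> 0" "Determinant.det C \<noteq> 0"
    and "(cmod (Determinant.det B))\<^sup>2 * (cmod (Determinant.det C))\<^sup>2 = 1"
    by (auto simp flip: norm_mult power_mult_distrib)
  then have bc: "?b ^ n * ?c ^ n = 1"
    by (simp flip: power_mult_distrib ennreal_mult)
  have dt: "Determinant.det (transpose_mat C) = Determinant.det C" using C by (rule det_transpose)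
  have tC: "transpose_mat C \<in> carrier_mat n n" using C by simp
  have eq: "(\<lambda>ij\<in>?I \<times> ?I. (B * mat n n x * C) $$ ij) = mmf n ?I B (trf n (mmf n ?I (transpose_mat C) (trf n x)))" for x
  proof
    fix ij
    show "(\<lambda>ij\<in>?I \<times> ?I. (B * mat n n x * C) $$ ij) ij = mmf n ?I B (trf n (mmf n ?I (transpose_mat C) (trf n x))) ij"
    proof (cases "ij \<in> ?I \<times> ?I")
      case True
      then obtain i j where ij: "ij = (i, j)" "i < n" "j < n" by auto
      have "(B * mat n n x * C) $$ (i, j) = (B * (mat n n x * C)) $$ (i, j)"
        using B C by (subst assoc_mult_mat[of _ n n _ n _ n]) auto
      also have "\<dots> = (\<Sum>k\<in>?I. B $$ (i, k) * (\<Sum>l\<in>?I. x (k, l) * C $$ (l, j)))"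
        using ij B C by (simp add: scalar_prod_def)
      also have "\<dots> = (\<Sum>k\<in>?I. B $$ (i, k) * (\<Sum>l\<in>?I. transpose_mat C $$ (j, l) * trf n x (l, k)))"
        using ij C by (intro sum.cong refl, intro arg_cong[of _ _ "(*) _"], intro sum.cong) (auto simp: trf_def mult.commute)
      also have "\<dots> = mmf n ?I B (trf n (mmf n ?I (transpose_mat C) (trf n x))) (i, j)"
        using ij by (simp add: mmf_def) (intro sum.cong refl, simp add: trf_def mmf_def)
      finally show ?thesis using True ij by simp
    qed (auto simp: mmf_def)
  qed
  have "(\<integral>\<^sup>+x. F x \<partial>?L) = (\<integral>\<^sup>+x. ?b ^ n * F (mmf n ?I B x) \<partial>?L)"
    using nn_integral_mmf[OF _ B d(1) F] by simp
  also have "\<dots> = (\<integral>\<^sup>+x. ?b ^ n * F (mmf n ?I B (trf n x)) \<partial>?L)"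
    by (rule nn_integral_trf[symmetric]) measurable
  also have "\<dots> = (\<integral>\<^sup>+x. ?c ^ n * (?b ^ n * F (mmf n ?I B (trf n (mmf n ?I (transpose_mat C) x)))) \<partial>?L)"
    using nn_integral_mmf[OF _ tC, of ?I "\<lambda>x. ?b ^ n * F (mmf n ?I B (trf n x))"] d dt by simp
  also have "\<dots> = (\<integral>\<^sup>+x. ?c ^ n * (?b ^ n * F (mmf n ?I B (trf n (mmf n ?I (transpose_mat C) (trf n x))))) \<partial>?L)"
    by (rule nn_integral_trf[symmetric]) measurable
  also have "\<dots> = (\<integral>\<^sup>+x. F (\<lambda>ij\<in>?I \<times> ?I. (B * mat n n x * C) $$ ij) \<partial>?L)"
    using bc by (simp only: eq mult.assoc[symmetric] mult.commute[of "?c ^ n"] mult_1)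
  finally show ?thesis ..
qed

section \<open>Eigenvalues of a matrix and of its corner\<close>

text \<open>Polynomial functions of the coordinates, as a closure under sums and products:
  measurability, polynomial dependence on one coordinate and stability under freezing a coordinate
  all follow by rule induction.\<close>

inductive_set polyfun :: "'i set \<Rightarrow> (('i \<Rightarrow> complex) \<Rightarrow> complex) set" for I where
  const: "(\<lambda>_. c) \<in> polyfun I"
| var: "i \<in> I \<Longrightarrow> (\<lambda>x. x i) \<in> polyfun I"
| add: "f \<in> polyfun I \<Longrightarrow> g \<in> polyfun I \<Longrightarrow> (\<lambda>x. f x + g x) \<in> polyfun I"
| mult: "f \<in> polyfun I \<Longrightarrow> g \<in> polyfun I \<Longrightarrow> (\<lambda>x. f x * g x) \<in> polyfun I"

lemma polyfun_sum: "(\<And>a. a \<in> A \<Longrightarrow> f a \<in> polyfun I) \<Longrightarrow> (\<lambda>x. \<Sum>a\<in>A. f a x) \<in> polyfun I"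
  by (induction A rule: infinite_finite_induct) (auto intro: polyfun.intros)

lemma polyfun_prod: "(\<And>a. a \<in> A \<Longrightarrow> f a \<in> polyfun I) \<Longrightarrow> (\<lambda>x. \<Prod>a\<in>A. f a x) \<in> polyfun I"
  by (induction A rule: infinite_finite_induct) (auto intro: polyfun.intros)

lemma polyfun_uminus: "f \<in> polyfun I \<Longrightarrow> (\<lambda>x. - f x) \<in> polyfun I"
  using polyfun.mult[OF polyfun.const[of "-1"], of f] by simp

lemma polyfun_det:
  assumes "\<And>x. A x \<in> carrier_mat n n" and "\<And>i j. i < n \<Longrightarrow> j < n \<Longrightarrow> (\<lambda>x. A x $$ (i, j)) \<in> polyfun I"
  shows "(\<lambda>x. Determinant.det (A x)) \<in> polyfun I"
  unfolding det_def'[OF assms(1)]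
proof (intro polyfun_sum polyfun.mult polyfun.const polyfun_prod)
  fix p i assume "p \<in> {p. p permutes {0..<n}}" "i \<in> {0..<n}"
  then show "(\<lambda>x. A x $$ (i, p i)) \<in> polyfun I"
    using assms(2)[of i "p i"] permutes_in_image[of p "{0..<n}" i] by auto
qed

text \<open>Allows the Leibniz expansion of a determinant of polynomials to be read coefficient by
  coefficient. It is also the source of measurability for everything taken from a characteristic
  polynomial.\<close>

definition polycoeff :: "'i set \<Rightarrow> (('i \<Rightarrow> complex) \<Rightarrow> complex poly) \<Rightarrow> bool" where
  "polycoeff I P \<longleftrightarrow> (\<forall>k. (\<lambda>x. coeff (P x) k) \<in> polyfun I)"

lemma polycoeff_const: "polycoeff I (\<lambda>_. p)"
  by (simp add: polycoeff_def polyfun.const)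

lemma polycoeff_add: "polycoeff I P \<Longrightarrow> polycoeff I Q \<Longrightarrow> polycoeff I (\<lambda>x. P x + Q x)"
  by (simp add: polycoeff_def polyfun.add)

lemma polycoeff_mult: "polycoeff I P \<Longrightarrow> polycoeff I Q \<Longrightarrow> polycoeff I (\<lambda>x. P x * Q x)"
  by (simp add: polycoeff_def coeff_mult polyfun.mult polyfun_sum)

lemma polycoeff_sum: "(\<And>a. a \<in> A \<Longrightarrow> polycoeff I (P a)) \<Longrightarrow> polycoeff I (\<lambda>x. \<Sum>a\<in>A. P a x)"
  by (induction A rule: infinite_finite_induct) (auto intro: polycoeff_add polycoeff_const)

lemma polycoeff_prod: "(\<And>a. a \<in> A \<Longrightarrow> polycoeff I (P a)) \<Longrightarrow> polycoeff I (\<lambda>x. \<Prod>a\<in>A. P a x)"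
  by (induction A rule: infinite_finite_induct) (auto intro: polycoeff_mult polycoeff_const)

lemma polycoeff_char_poly:
  assumes "{0..<n} \<times> {0..<n} \<subseteq> I"
  shows "polycoeff I (\<lambda>x. char_poly (mat n n x))"
proof -
  have "polycoeff I (\<lambda>x. char_poly_matrix (mat n n x) $$ (i, j))" if ij: "i < n" "j < n" for i j
  proof -
    have "polycoeff I (\<lambda>x. [:- x (i, j):])"
      unfolding polycoeff_def
    proof
      fix k
      have "(i, j) \<in> I" using assms ij by auto
      then have "(\<lambda>x. - x (i, j)) \<in> polyfun I" by (intro polyfun_uminus polyfun.var)
      then show "(\<lambda>x. coeff [:- x (i, j):] k) \<in> polyfun I"
        by (cases k) (auto intro: polyfun.const)
    qed
    then have "polycoeff I (\<lambda>x. (if i = j then [:0, 1:] else 0) + [:- x (i, j):])"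
      by (intro polycoeff_add polycoeff_const)
    moreover have "char_poly_matrix (mat n n x) $$ (i, j) = (if i = j then [:0, 1:] else 0) + [:- x (i, j):]"
      for x :: "nat \<times> nat \<Rightarrow> complex"
      using ij by (simp add: char_poly_matrix_def)
    ultimately show ?thesis by (simp only:)
  qed
  note entry = this
  have c: "char_poly_matrix (mat n n x) \<in> carrier_mat n n" for x :: "nat \<times> nat \<Rightarrow> complex" by simp
  show ?thesis
    unfolding char_poly_def det_def'[OF c]
  proof (intro polycoeff_sum polycoeff_mult polycoeff_const polycoeff_prod)
    fix p i assume "p \<in> {p. p permutes {0..<n}}" "i \<in> {0..<n}"
    then show "polycoeff I (\<lambda>x. char_poly_matrix (mat n n x) $$ (i, p i))"
      using entry[of i "p i"] permutes_in_image[of p "{0..<n}" i] by auto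
  qed
qed

lemma polyfun_measurable: "q \<in> polyfun I \<Longrightarrow> q \<in> borel_measurable (lb I)"
  by (induction rule: polyfun.induct) auto

lemma polyfun_update: "q \<in> polyfun (insert i I) \<Longrightarrow> (\<lambda>x. q (x(i := t))) \<in> polyfun I"
proof (induction rule: polyfun.induct)
  case (var j)
  then show ?case by (cases "j = i") (auto intro: polyfun.intros)
qed (auto intro: polyfun.intros)

lemma polyfun_poly: "q \<in> polyfun I \<Longrightarrow> \<exists>p. \<forall>t. q (x(i := t)) = poly p t"
proof (induction rule: polyfun.induct)
  case (const c)
  show ?case by (rule exI[of _ "[:c:]"]) simp
next
  case (var j)
  show ?case
    by (cases "j = i") (auto intro: exI[of _ "[:0, 1:]"] exI[of _ "[:x j:]"])
next
  case (add f g)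
  from add obtain p where "\<forall>t. f (x(i := t)) = poly p t" by blast
  moreover from add obtain r where "\<forall>t. g (x(i := t)) = poly r t" by blast
  ultimately have "\<forall>t. f (x(i := t)) + g (x(i := t)) = poly (p + r) t" by simp
  then show ?case by (rule exI)
next
  case (mult f g)
  from mult obtain p where "\<forall>t. f (x(i := t)) = poly p t" by blast
  moreover from mult obtain r where "\<forall>t. g (x(i := t)) = poly r t" by blast
  ultimately have "\<forall>t. f (x(i := t)) * g (x(i := t)) = poly (p * r) t" by simp
  then show ?case by (rule exI)
qed

text \<open>On the line through \<open>x0\<close> in direction i the function is a nonzero
  polynomial of one variable. Apart from its finitely many roots t, the slice at t is nonzero at the
  remaining coordinates of \<open>x0\<close>, and the induction hypothesis makes the zeros of the
  slice null.\<close>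

lemma nn_integral_polyfun_zeros:
  assumes "finite I" "q \<in> polyfun I" "x0 \<in> extensional I" "q x0 \<noteq> 0"
  shows "(\<integral>\<^sup>+x. indicator {0} (q x) \<partial>lb I) = 0"
  using assms
proof (induction I arbitrary: q x0 rule: finite_induct)
  case empty
  then have "x0 = (\<lambda>_. undefined)" by auto
  with empty show ?case by (simp add: lb.nn_integral_empty)
next
  case (insert i I)
  note [measurable] = polyfun_measurable[OF insert.prems(1)]
  obtain p where p: "\<And>t. q (x0(i := t)) = poly p t"
    using polyfun_poly[OF insert.prems(1)] by metis
  have "p \<noteq> 0" using p[of "x0 i"] insert.prems(3) by auto
  then have fin: "finite {t. poly p t = 0}" by (rule poly_roots_finite)
  have "(\<integral>\<^sup>+x. indicator {0} (q x) \<partial>lb (insert i I)) = (\<integral>\<^sup>+t. \<integral>\<^sup>+x. indicator {0} (q (x(i := t))) \<partial>lb I \<partial>lborel)"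
    using insert.hyps by (intro lb.product_nn_integral_insert_rev) auto
  also have "\<dots> = (\<integral>\<^sup>+t. 0 \<partial>(lborel :: complex measure))"
  proof (rule nn_integral_cong_AE)
    have "AE t in lborel. t \<notin> {t. poly p t = 0}"
      using finite_imp_null_set_lborel[OF fin] by (rule AE_not_in)
    then show "AE t in lborel. (\<integral>\<^sup>+x. indicator {0} (q (x(i := t))) \<partial>lb I) = 0"
    proof eventually_elim
      case (elim t)
      show ?case
      proof (rule insert.IH[OF polyfun_update[OF insert.prems(1)], of "restrict x0 I"])
        have "(restrict x0 I)(i := t) = x0(i := t)"
          using insert.prems(2) by (auto simp: fun_eq_iff extensional_def)
        then show "q ((restrict x0 I)(i := t)) \<noteq> 0" using elim p by simp
      next
        show "restrict x0 I \<in> extensional I" by simp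
      qed
    qed
  qed
  finally show ?case by simp
qed

section \<open>Genericity: almost no matrix shares an eigenvalue with its corner\<close>

abbreviation cpf :: "nat \<Rightarrow> (nat \<times> nat \<Rightarrow> complex) \<Rightarrow> complex poly" where
  "cpf n x \<equiv> char_poly (mat n n x)"

lemma degree_cpf: "degree (cpf n x) = n" and lead_coeff_cpf: "lead_coeff (cpf n x) = 1"
  and cpf_ne_0 [simp]: "cpf n x \<noteq> 0"
  using degree_monic_char_poly[of "mat n n x" n] by auto

text \<open>
  The characteristic polynomial of \<open>x\<close> evaluated at its corner; a common eigenvalue of the two
  makes this matrix singular.
\<close>

definition char_poly_corner :: "nat \<Rightarrow> (nat \<times> nat \<Rightarrow> complex) \<Rightarrow> complex mat" where
  "char_poly_corner n x = mat n n (\<lambda>(i, j). \<Sum>k\<le>Suc n. coeff (cpf (Suc n) x) k * (mat n n x ^\<^sub>m k) $$ (i, j))"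

lemma char_poly_corner_carrier [simp]: "char_poly_corner n x \<in> carrier_mat n n"
  by (simp add: char_poly_corner_def)

lemma polyfun_pow_mat:
  assumes "{0..<n} \<times> {0..<n} \<subseteq> I" "i < n" "j < n"
  shows "(\<lambda>x. (mat n n x ^\<^sub>m k) $$ (i, j)) \<in> polyfun I"
  using assms(2,3)
proof (induction k arbitrary: j)
  case 0
  then show ?case by (simp add: polyfun.const)
next
  case (Suc k)
  have "(\<lambda>x. \<Sum>l\<in>{0..<n}. (mat n n x ^\<^sub>m k) $$ (i, l) * x (l, j)) \<in> polyfun I"
    using Suc assms(1) by (intro polyfun_sum polyfun.mult polyfun.var) auto
  moreover have "(mat n n x ^\<^sub>m Suc k) $$ (i, j) = (\<Sum>l\<in>{0..<n}. (mat n n x ^\<^sub>m k) $$ (i, l) * x (l, j))"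
    for x :: "nat \<times> nat \<Rightarrow> complex"
  proof -
    have c: "mat n n x ^\<^sub>m k \<in> carrier_mat n n" by (rule pow_carrier_mat) simp
    show ?thesis using Suc.prems carrier_matD[OF c] by (simp add: scalar_prod_def)
  qed
  ultimately show ?case by (simp only:)
qed

lemma polyfun_char_poly_corner:
  "(\<lambda>x. Determinant.det (char_poly_corner n x)) \<in> polyfun ({0..<Suc n} \<times> {0..<Suc n})"
proof (rule polyfun_det[OF char_poly_corner_carrier])
  let ?I = "{0..<Suc n} \<times> {0..<Suc n}"
  fix i j assume ij: "i < n" "j < n"
  have "(\<lambda>x. coeff (cpf (Suc n) x) k) \<in> polyfun ?I" for k
    using polycoeff_char_poly[of "Suc n" ?I] unfolding polycoeff_def by blast
  moreover have "(\<lambda>x. (mat n n x ^\<^sub>m k) $$ (i, j)) \<in> polyfun ?I" for k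
    using ij by (intro polyfun_pow_mat) auto
  ultimately have "(\<lambda>x. \<Sum>k\<le>Suc n. coeff (cpf (Suc n) x) k * (mat n n x ^\<^sub>m k) $$ (i, j)) \<in> polyfun ?I"
    by (intro polyfun_sum polyfun.mult)
  then show "(\<lambda>x. char_poly_corner n x $$ (i, j)) \<in> polyfun ?I"
    using ij by (simp add: char_poly_corner_def del: sum.atMost_Suc)
qed

text \<open>The matrix is p(D), with p the characteristic polynomial of the whole matrix and D the
  corner. On an eigenvector of D for \<open>z\<close> it acts as the scalar p(z) = 0. Its
  determinant is in effect the resultant of the two characteristic polynomials.\<close>

lemma common_root_det_corner:
  assumes "poly (cpf (Suc n) x) z = 0" "poly (cpf n x) z = 0"
  shows "Determinant.det (char_poly_corner n x) = 0"
proof -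
  let ?D = "mat n n x" and ?p = "cpf (Suc n) x"
  have D: "?D \<in> carrier_mat n n" by simp
  obtain v where ev: "eigenvector ?D v z"
    using assms(2) eigenvalue_root_char_poly[OF D, of z] unfolding eigenvalue_def by blast
  then have v: "v \<in> carrier_vec n" "v \<noteq> 0\<^sub>v n" by (simp_all add: eigenvector_def)
  have pow: "(\<Sum>j\<in>{0..<n}. (?D ^\<^sub>m k) $$ (i, j) * v $ j) = z ^ k * v $ i" if i: "i < n" for i k
  proof -
    have c: "?D ^\<^sub>m k \<in> carrier_mat n n" by (rule pow_carrier_mat[OF D])
    have "(?D ^\<^sub>m k *\<^sub>v v) $ i = (z ^ k \<cdot>\<^sub>v v) $ i"
      using eigenvector_pow[OF D ev, of k] by simp
    then show ?thesis using i v(1) carrier_matD[OF c] by (simp add: scalar_prod_def)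
  qed
  have "char_poly_corner n x *\<^sub>v v = 0\<^sub>v n"
  proof (rule eq_vecI)
    fix i assume "i < dim_vec (0\<^sub>v n)"
    then have i: "i < n" by simp
    have "(char_poly_corner n x *\<^sub>v v) $ i =
        (\<Sum>j\<in>{0..<n}. \<Sum>k\<le>Suc n. coeff ?p k * ((?D ^\<^sub>m k) $$ (i, j) * v $ j))"
      using i v(1)
      by (simp add: char_poly_corner_def scalar_prod_def sum_distrib_right mult.assoc distrib_right sum.distrib
          del: pow_mat.simps)
    also have "\<dots> = (\<Sum>k\<le>Suc n. coeff ?p k * (\<Sum>j\<in>{0..<n}. (?D ^\<^sub>m k) $$ (i, j) * v $ j))"
      unfolding sum_distrib_left by (rule sum.swap)
    also have "\<dots> = (\<Sum>k\<le>Suc n. coeff ?p k * z ^ k) * v $ i"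
      unfolding sum_distrib_right by (intro sum.cong) (simp_all add: pow[OF i])
    also have "(\<Sum>k\<le>Suc n. coeff ?p k * z ^ k) = poly ?p z"
      by (simp only: poly_altdef degree_cpf)
    finally show "(char_poly_corner n x *\<^sub>v v) $ i = 0\<^sub>v n $ i" using assms(1) i by simp
  qed (simp add: char_poly_corner_def)
  with v show ?thesis by (subst det_0_iff_vec_prod_zero[OF char_poly_corner_carrier]) blast
qed

text \<open>The witness is the cyclic shift, whose corner is nilpotent.\<close>

lemma ex_det_corner_ne_0:
  "\<exists>x \<in> extensional ({0..<Suc n} \<times> {0..<Suc n}). Determinant.det (char_poly_corner n x) \<noteq> 0"
proof -
  define \<sigma> where "\<sigma> = (\<lambda>i. if i = n then 0 else Suc i)"
  define x :: "nat \<times> nat \<Rightarrow> complex" where "x = (\<lambda>(i, j)\<in>{0..<Suc n} \<times> {0..<Suc n}. if j = \<sigma> i then 1 else 0)"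
  have \<sigma>: "\<sigma> i < Suc n" if "i < Suc n" for i using that by (auto simp: \<sigma>_def)
  have inj: "\<sigma> i = \<sigma> j \<longleftrightarrow> i = j" for i j by (auto simp: \<sigma>_def)
  have x: "x (i, j) = (if j = \<sigma> i then 1 else 0)" if "i < Suc n" "j < Suc n" for i j
    using that by (simp add: x_def)
  let ?A = "mat (Suc n) (Suc n) x" and ?D = "mat n n x"
  have "?A * transpose_mat ?A = 1\<^sub>m (Suc n)"
  proof (rule eq_matI)
    fix i j assume ij: "i < dim_row (1\<^sub>m (Suc n))" "j < dim_col (1\<^sub>m (Suc n))"
    then have ij: "i < Suc n" "j < Suc n" by auto
    have "(?A * transpose_mat ?A) $$ (i, j) = (\<Sum>k\<in>{0..<Suc n}. x (i, k) * x (j, k))"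
      using ij by (simp add: scalar_prod_def del: sum.op_ivl_Suc)
    also have "\<dots> = (\<Sum>k\<in>{0..<Suc n}. if k = \<sigma> i then (if i = j then 1 else 0) else 0)"
      using ij by (intro sum.cong) (auto simp: x inj)
    also have "\<dots> = (if i = j then 1 else 0)"
      using \<sigma>[OF ij(1)] by (subst sum.delta) auto
    finally show "(?A * transpose_mat ?A) $$ (i, j) = 1\<^sub>m (Suc n) $$ (i, j)"
      using ij by simp
  qed auto
  then have "Determinant.det ?A * Determinant.det (transpose_mat ?A) = 1"
    by (metis det_mult det_one mat_carrier transpose_carrier_mat)
  then have detA: "Determinant.det ?A \<noteq> 0" by auto
  \<comment> \<open>The value at 0 is, up to sign, the determinant, and a permutation matrix is
    invertible.\<close>
  have "poly (cpf (Suc n) x) 0 \<noteq> 0"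
  proof
    assume "poly (cpf (Suc n) x) 0 = 0"
    then have "eigenvalue ?A 0"
      using eigenvalue_root_char_poly[of ?A "Suc n" 0] by simp
    then obtain v where v: "v \<in> carrier_vec (Suc n)" "v \<noteq> 0\<^sub>v (Suc n)" "?A *\<^sub>v v = 0 \<cdot>\<^sub>v v"
      unfolding eigenvalue_def eigenvector_def by auto
    have "0 \<cdot>\<^sub>v v = 0\<^sub>v (Suc n)" using v(1) by auto
    with v have "Determinant.det ?A = 0"
      using det_0_iff_vec_prod_zero[of ?A "Suc n"] by auto
    with detA show False by simp
  qed
  then have c0: "coeff (cpf (Suc n) x) 0 \<noteq> 0" by (simp add: poly_0_coeff_0)
  have pow: "(?D ^\<^sub>m k) $$ (i, j) = (if j = i + k then 1 else 0)" if "i < n" "j < n" for i j k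
    using that
  proof (induction k arbitrary: j)
    case (Suc k)
    have c: "?D ^\<^sub>m k \<in> carrier_mat n n" by (rule pow_carrier_mat) simp
    have "(?D ^\<^sub>m Suc k) $$ (i, j) = (\<Sum>l\<in>{0..<n}. (?D ^\<^sub>m k) $$ (i, l) * x (l, j))"
      using Suc.prems carrier_matD[OF c] by (simp add: scalar_prod_def)
    also have "\<dots> = (\<Sum>l\<in>{0..<n}. if l = i + k then (if j = Suc l then 1 else 0) else 0)"
      using Suc by (intro sum.cong) (auto simp: x \<sigma>_def)
    also have "\<dots> = (if j = i + Suc k then 1 else 0)"
      using Suc.prems by (subst sum.delta) auto
    finally show ?case .
  qed auto
  have entry: "char_poly_corner n x $$ (i, j) = (\<Sum>k\<le>Suc n. if k = j - i \<and> i \<le> j then coeff (cpf (Suc n) x) k else 0)"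
    if "i < n" "j < n" for i j
  proof -
    have "char_poly_corner n x $$ (i, j) = (\<Sum>k\<le>Suc n. coeff (cpf (Suc n) x) k * (?D ^\<^sub>m k) $$ (i, j))"
      using that by (simp add: char_poly_corner_def del: sum.atMost_Suc pow_mat.simps)
    also have "\<dots> = (\<Sum>k\<le>Suc n. if k = j - i \<and> i \<le> j then coeff (cpf (Suc n) x) k else 0)"
      by (intro sum.cong) (auto simp: pow[OF that] simp del: pow_mat.simps)
    finally show ?thesis .
  qed
  \<comment> \<open>The powers of the nilpotent corner are its higher superdiagonals, so p(D) is
    upper triangular with p(0) all along the diagonal.\<close>
  have "upper_triangular (char_poly_corner n x)"
    unfolding upper_triangular_def by (auto simp: entry char_poly_corner_def[THEN arg_cong, of dim_row] simp del: sum.atMost_Suc)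
  then have "Determinant.det (char_poly_corner n x) = prod_list (diag_mat (char_poly_corner n x))"
    by (rule det_upper_triangular[OF _ char_poly_corner_carrier])
  also have "diag_mat (char_poly_corner n x) = map (\<lambda>_. coeff (cpf (Suc n) x) 0) [0..<n]"
    using carrier_matD[OF char_poly_corner_carrier[of n x]]
    by (auto simp: diag_mat_def entry simp del: sum.atMost_Suc)
  also have "prod_list \<dots> \<noteq> 0" using c0 by (auto simp: prod_list_zero_iff)
  finally have "Determinant.det (char_poly_corner n x) \<noteq> 0" .
  moreover have "x \<in> extensional ({0..<Suc n} \<times> {0..<Suc n})" by (simp add: x_def)
  ultimately show ?thesis by blast
qed

lemma mat_blk:
  "mat (Suc n) (Suc n) (blk n D u w a) =
   four_block_mat (mat n n D) (mat n 1 (\<lambda>(i, j). u i)) (mat 1 n (\<lambda>(i, j). w j)) (mat 1 1 (\<lambda>_. a))"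
  by (rule eq_matI) (auto simp: blk_def less_Suc_eq)

lemma cpf_blk_corner: "cpf n (blk n D u w a) = cpf n D"
  by (rule arg_cong[of _ _ char_poly], rule eq_matI) (auto simp: blk_def)

text \<open>Laplace expansion along the last row: \<open>a\<close> enters only through the last
  entry, whose cofactor is the characteristic polynomial of the corner. Hence \<open>z\<close> is an
  eigenvalue exactly when \<open>a\<close> is the quotient of the two polynomials at
  \<open>z\<close>, wherever the denominator is nonzero.\<close>

lemma cpf_blk: "cpf (Suc n) (blk n D u w a) = cpf (Suc n) (blk n D u w 0) - Polynomial.smult a (cpf n D)"
proof -
  define M where "M = (\<lambda>a. char_poly_matrix (mat (Suc n) (Suc n) (blk n D u w a)))"
  have M: "M a \<in> carrier_mat (Suc n) (Suc n)" for a by (simp add: M_def)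
  have del: "mat_delete (M a) n j = mat_delete (M 0) n j" if "j < Suc n" for j
    by (rule eq_matI) (auto simp: mat_delete_def M_def char_poly_matrix_def blk_def)
  have deln: "mat_delete (M 0) n n = char_poly_matrix (mat n n D)"
    by (rule eq_matI) (auto simp: mat_delete_def M_def char_poly_matrix_def blk_def)
  have cof: "cofactor (M a) n j = cofactor (M 0) n j" if "j < Suc n" for j
    using del[OF that] by (simp add: cofactor_def)
  have cofn: "cofactor (M 0) n n = cpf n D"
    by (simp add: cofactor_def deln char_poly_def flip: mult_2)
  have en: "M a $$ (n, j) = M 0 $$ (n, j)" if "j < n" for j
    using that by (auto simp: M_def char_poly_matrix_def blk_def)
  have nn: "M a $$ (n, n) = M 0 $$ (n, n) - [:a:]"
    by (auto simp: M_def char_poly_matrix_def blk_def)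
  have "cpf (Suc n) (blk n D u w a) = (\<Sum>j<Suc n. M a $$ (n, j) * cofactor (M a) n j)"
    using laplace_expansion_row[OF M, of n a] by (simp only: char_poly_def M_def lessI simp_thms)
  also have "\<dots> = (\<Sum>j<Suc n. M a $$ (n, j) * cofactor (M 0) n j)"
    by (intro sum.cong) (auto simp: cof)
  also have "\<dots> = (\<Sum>j<Suc n. M 0 $$ (n, j) * cofactor (M 0) n j) - [:a:] * cofactor (M 0) n n"
    by (simp add: en nn algebra_simps)
  also have "(\<Sum>j<Suc n. M 0 $$ (n, j) * cofactor (M 0) n j) = cpf (Suc n) (blk n D u w 0)"
    using laplace_expansion_row[OF M, of n 0] by (simp only: char_poly_def M_def lessI simp_thms)
  finally show ?thesis by (simp add: cofn)
qed

text \<open>The zeros of \<open>q\<close> are null with respect to all entries, while the claim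
  leaves out the last one. It does not depend on that entry: at a root of the polynomial of the
  corner the term with \<open>a\<close> in \<open>cpf_blk\<close> vanishes. So one \<open>a\<close>
  with \<open>q \<noteq> 0\<close> is enough.\<close>

lemma AE_coprime_corner:
  "AE D in lb ({0..<n} \<times> {0..<n}). AE u in lb {0..<n}. AE w in lb {0..<n}.
     \<forall>z. poly (cpf n D) z = 0 \<longrightarrow> poly (cpf (Suc n) (blk n D u w 0)) z \<noteq> 0"
proof -
  define q where "q = (\<lambda>x. Determinant.det (char_poly_corner n x))"
  let ?I = "{0..<Suc n} \<times> {0..<Suc n}"
  have q: "q \<in> polyfun ?I" unfolding q_def by (rule polyfun_char_poly_corner)
  note [measurable] = polyfun_measurable[OF q]
  have m: "(\<lambda>x. indicator {0} (q x) :: ennreal) \<in> borel_measurable (lb ?I)" by measurable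
  note [measurable] = m
  have "(\<integral>\<^sup>+x. indicator {0} (q x) \<partial>lb ?I) = 0"
    using ex_det_corner_ne_0[of n] q by (auto intro!: nn_integral_polyfun_zeros simp: q_def)
  then have z: "(\<integral>\<^sup>+D. \<integral>\<^sup>+u. \<integral>\<^sup>+w. \<integral>\<^sup>+a. indicator {0} (q (blk n D u w a)) \<partial>lborel \<partial>lb {0..<n} \<partial>lb {0..<n} \<partial>lb ({0..<n} \<times> {0..<n})) = 0"
    by (subst (asm) nn_integral_blk[OF m])
  interpret V: sigma_finite_measure "lb {0..<n}" by (rule sigma_finite_lb) simp
  have 1: "(\<lambda>((D, u), w). \<integral>\<^sup>+a. indicator {0} (q (blk n D u w a)) \<partial>lborel)
      \<in> borel_measurable ((lb ({0..<n} \<times> {0..<n}) \<Otimes>\<^sub>M lb {0..<n}) \<Otimes>\<^sub>M lb {0..<n})"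
    unfolding case_prod_beta' by measurable
  have 2: "(\<lambda>(D, u). \<integral>\<^sup>+w. \<integral>\<^sup>+a. indicator {0} (q (blk n D u w a)) \<partial>lborel \<partial>lb {0..<n})
      \<in> borel_measurable (lb ({0..<n} \<times> {0..<n}) \<Otimes>\<^sub>M lb {0..<n})"
    using V.borel_measurable_nn_integral[OF 1] by (simp add: case_prod_beta')
  have 3: "(\<lambda>D. \<integral>\<^sup>+u. \<integral>\<^sup>+w. \<integral>\<^sup>+a. indicator {0} (q (blk n D u w a)) \<partial>lborel \<partial>lb {0..<n} \<partial>lb {0..<n})
      \<in> borel_measurable (lb ({0..<n} \<times> {0..<n}))"
    using V.borel_measurable_nn_integral[OF 2] by simp
  have "AE D in lb ({0..<n} \<times> {0..<n}). (\<integral>\<^sup>+u. \<integral>\<^sup>+w. \<integral>\<^sup>+a. indicator {0} (q (blk n D u w a)) \<partial>lborel \<partial>lb {0..<n} \<partial>lb {0..<n}) = 0"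
    using z by (subst (asm) nn_integral_0_iff_AE[OF 3])
  then show ?thesis
  proof (rule AE_mp[OF _ AE_I2], intro impI)
    fix D assume D: "D \<in> space (lb ({0..<n} \<times> {0..<n}))"
      and zD: "(\<integral>\<^sup>+u. \<integral>\<^sup>+w. \<integral>\<^sup>+a. indicator {0} (q (blk n D u w a)) \<partial>lborel \<partial>lb {0..<n} \<partial>lb {0..<n}) = 0"
    have 4: "(\<lambda>u. \<integral>\<^sup>+w. \<integral>\<^sup>+a. indicator {0} (q (blk n D u w a)) \<partial>lborel \<partial>lb {0..<n}) \<in> borel_measurable (lb {0..<n})"
      using measurable_Pair2[OF 2 D] by simp
    have "AE u in lb {0..<n}. (\<integral>\<^sup>+w. \<integral>\<^sup>+a. indicator {0} (q (blk n D u w a)) \<partial>lborel \<partial>lb {0..<n}) = 0"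
      using zD by (subst (asm) nn_integral_0_iff_AE[OF 4])
    then show "AE u in lb {0..<n}. AE w in lb {0..<n}.
       \<forall>z. poly (cpf n D) z = 0 \<longrightarrow> poly (cpf (Suc n) (blk n D u w 0)) z \<noteq> 0"
    proof (rule AE_mp[OF _ AE_I2], intro impI)
      fix u assume u: "u \<in> space (lb {0..<n})"
        and zu: "(\<integral>\<^sup>+w. \<integral>\<^sup>+a. indicator {0} (q (blk n D u w a)) \<partial>lborel \<partial>lb {0..<n}) = 0"
      have Du: "(D, u) \<in> space (lb ({0..<n} \<times> {0..<n}) \<Otimes>\<^sub>M lb {0..<n})"
        using D u by (simp add: space_pair_measure)
      have 5: "(\<lambda>w. \<integral>\<^sup>+a. indicator {0} (q (blk n D u w a)) \<partial>lborel) \<in> borel_measurable (lb {0..<n})"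
        using measurable_Pair2[OF 1 Du] by simp
      have "AE w in lb {0..<n}. (\<integral>\<^sup>+a. indicator {0} (q (blk n D u w a)) \<partial>lborel) = 0"
        using zu by (subst (asm) nn_integral_0_iff_AE[OF 5])
      then show "AE w in lb {0..<n}. \<forall>z. poly (cpf n D) z = 0 \<longrightarrow> poly (cpf (Suc n) (blk n D u w 0)) z \<noteq> 0"
      proof (eventually_elim)
        case (elim w)
        have "\<exists>a. q (blk n D u w a) \<noteq> 0"
        proof (rule ccontr)
          assume "\<not> ?thesis"
          \<comment> \<open>Were \<open>q\<close> zero for every \<open>a\<close>, the inner
            integral would be the infinite area of the plane and not 0.\<close>
          then have "(\<integral>\<^sup>+a. indicator {0} (q (blk n D u w a)) \<partial>lborel) = (\<integral>\<^sup>+a. 1 \<partial>(lborel :: complex measure))"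
            by simp
          with elim show False by simp
        qed
        then obtain a where "q (blk n D u w a) \<noteq> 0" by blast
        then have "\<nexists>z. poly (cpf (Suc n) (blk n D u w a)) z = 0 \<and> poly (cpf n D) z = 0"
          using common_root_det_corner[of n "blk n D u w a"] unfolding q_def cpf_blk_corner by blast
        moreover have "poly (cpf (Suc n) (blk n D u w a)) z = poly (cpf (Suc n) (blk n D u w 0)) z - a * poly (cpf n D) z" for z
          by (subst cpf_blk) simp
        ultimately show ?case by (metis diff_zero mult_zero_right)
      qed
    qed
  qed
qed

section \<open>Splitting off an eigenvalue\<close>

lemma mat_adjoint_carrier [simp]: "A \<in> carrier_mat n m \<Longrightarrow> mat_adjoint A \<in> carrier_mat m n"
  unfolding mat_adjoint_def by auto

lemma index_mat_adjoint [simp]: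
  "i < dim_col A \<Longrightarrow> j < dim_row A \<Longrightarrow> mat_adjoint A $$ (i, j) = conjugate (A $$ (j, i))"
  unfolding mat_adjoint_def by (simp add: mat_of_rows_def)

lemma dim_mat_adjoint [simp]: "dim_row (mat_adjoint A) = dim_col A" "dim_col (mat_adjoint A) = dim_row A"
  unfolding mat_adjoint_def by auto

lemma mat_adjoint_mult:
  fixes A B :: "complex mat"
  assumes A: "A \<in> carrier_mat n m" and B: "B \<in> carrier_mat m k"
  shows "mat_adjoint (A * B) = mat_adjoint B * mat_adjoint A"
  using assms by (intro eq_matI) (auto simp: scalar_prod_def mult.commute intro!: sum.cong)

lemma mat_adjoint_adjoint: "mat_adjoint (mat_adjoint (A :: complex mat)) = A"
  by (intro eq_matI) auto

text \<open>The squared Frobenius norm, whose negative is the exponent of the Gaussian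
  weight.\<close>

definition fro :: "complex mat \<Rightarrow> real" where
  "fro A = (\<Sum>i\<in>{0..<dim_row A}. \<Sum>j\<in>{0..<dim_col A}. (cmod (A $$ (i, j)))\<^sup>2)"

lemma trace_adjoint_mult:
  "mat_trace (mat_adjoint A * A) = of_real (fro A)"
proof -
  have "mat_trace (mat_adjoint A * A) = (\<Sum>j\<in>{0..<dim_col A}. \<Sum>i\<in>{0..<dim_row A}. cnj (A $$ (i, j)) * A $$ (i, j))"
    unfolding mat_trace_def by (intro sum.cong) (auto simp: scalar_prod_def)
  also have "\<dots> = (\<Sum>j\<in>{0..<dim_col A}. \<Sum>i\<in>{0..<dim_row A}. of_real ((cmod (A $$ (i, j)))\<^sup>2))"
    by (intro sum.cong refl) (simp add: complex_norm_square mult.commute del: of_real_power)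
  also have "\<dots> = of_real (fro A)"
    unfolding fro_def by (subst sum.swap) simp
  finally show ?thesis .
qed

lemma fro_adjoint: "fro (mat_adjoint A) = fro A"
  unfolding fro_def by (subst sum.swap) (auto intro!: sum.cong)

lemma fro_unitary_left:
  assumes Q: "Q \<in> carrier_mat n n" "mat_adjoint Q * Q = 1\<^sub>m n" and A: "A \<in> carrier_mat n m"
  shows "fro (Q * A) = fro A"
proof -
  let ?Q = "mat_adjoint Q" and ?A = "mat_adjoint A"
  have c: "?Q \<in> carrier_mat n n" "?A \<in> carrier_mat m n" using Q A by simp_all
  have "mat_adjoint (Q * A) * (Q * A) = ?A * ?Q * (Q * A)"
    by (simp only: mat_adjoint_mult[OF Q(1) A])
  also have "\<dots> = ?A * (?Q * (Q * A))"
    by (rule assoc_mult_mat[OF c(2,1) mult_carrier_mat[OF Q(1) A]])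
  also have "?Q * (Q * A) = ?Q * Q * A"
    by (rule assoc_mult_mat[OF c(1) Q(1) A, symmetric])
  also have "\<dots> = A" using A Q by simp
  finally have "of_real (fro (Q * A)) = (of_real (fro A) :: complex)"
    by (simp flip: trace_adjoint_mult)
  then show ?thesis by simp
qed

lemma fro_unitary_conj:
  assumes Q: "Q \<in> carrier_mat n n" "mat_adjoint Q * Q = 1\<^sub>m n" and A: "A \<in> carrier_mat n n"
  shows "fro (Q * A * mat_adjoint Q) = fro A"
proof -
  have QA: "Q * A \<in> carrier_mat n n" using Q A by simp
  have aQ: "mat_adjoint Q \<in> carrier_mat n n" using Q by simp
  have "fro (Q * A * mat_adjoint Q) = fro (mat_adjoint (Q * A * mat_adjoint Q))"
    by (simp only: fro_adjoint)
  also have "mat_adjoint (Q * A * mat_adjoint Q) = Q * mat_adjoint (Q * A)"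
    by (simp add: mat_adjoint_mult[OF QA aQ] mat_adjoint_adjoint)
  also have "fro \<dots> = fro (Q * A)"
    using fro_unitary_left[OF Q, of "mat_adjoint (Q * A)" n] QA by (simp add: fro_adjoint)
  also have "\<dots> = fro A" by (rule fro_unitary_left[OF Q A])
  finally show ?thesis .
qed

section \<open>Block triangular form at an eigenvector, and the unitary matrix that realizes
  it\<close>

abbreviation colm :: "nat \<Rightarrow> (nat \<Rightarrow> complex) \<Rightarrow> complex mat" where
  "colm n v \<equiv> mat n 1 (\<lambda>(i, j). v i)"

abbreviation rowm :: "nat \<Rightarrow> (nat \<Rightarrow> complex) \<Rightarrow> complex mat" where
  "rowm n w \<equiv> mat 1 n (\<lambda>(i, j). w j)"

abbreviation scm :: "complex \<Rightarrow> complex mat" where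
  "scm a \<equiv> mat 1 1 (\<lambda>_. a)"

text \<open>
  The matrix with eigenvalue \<open>z\<close>, right eigenvector \<open>(v, 1)\<close> and last row \<open>(w, _)\<close> whose
  quotient by the eigenline is \<open>g\<close>.
\<close>

definition dfl :: "nat \<Rightarrow> complex \<Rightarrow> (nat \<Rightarrow> complex) \<Rightarrow> (nat \<Rightarrow> complex) \<Rightarrow> (nat \<times> nat \<Rightarrow> complex) \<Rightarrow> nat \<times> nat \<Rightarrow> complex" where
  "dfl n z v w g = blk n (\<lambda>(i, j). g (i, j) + v i * w j)
     (\<lambda>i. z * v i - (\<Sum>j\<in>{0..<n}. (g (i, j) + v i * w j) * v j)) w (z - (\<Sum>j\<in>{0..<n}. w j * v j))"

text \<open>The shear takes the last basis vector to the eigenvector \<open>(v, 1)\<close>. In the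
  new basis the matrix is block triangular, with the quotient \<open>g\<close> and the eigenvalue
  \<open>z\<close> on the diagonal.\<close>

lemma dfl_mult_shear:
  "mat (Suc n) (Suc n) (dfl n z v w g) * four_block_mat (1\<^sub>m n) (colm n v) (0\<^sub>m 1 n) (1\<^sub>m 1) =
   four_block_mat (1\<^sub>m n) (colm n v) (0\<^sub>m 1 n) (1\<^sub>m 1) * four_block_mat (mat n n g) (0\<^sub>m n 1) (rowm n w) (scm z)"
proof -
  let ?D = "\<lambda>(i, j). g (i, j) + v i * w j"
  let ?u = "\<lambda>i. z * v i - (\<Sum>j\<in>{0..<n}. (g (i, j) + v i * w j) * v j)"
  let ?a = "z - (\<Sum>j\<in>{0..<n}. w j * v j)"
  have "mat (Suc n) (Suc n) (dfl n z v w g) * four_block_mat (1\<^sub>m n) (colm n v) (0\<^sub>m 1 n) (1\<^sub>m 1) =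
    four_block_mat (mat n n ?D * 1\<^sub>m n + colm n ?u * 0\<^sub>m 1 n) (mat n n ?D * colm n v + colm n ?u * 1\<^sub>m 1)
      (rowm n w * 1\<^sub>m n + scm ?a * 0\<^sub>m 1 n) (rowm n w * colm n v + scm ?a * 1\<^sub>m 1)"
    unfolding dfl_def mat_blk by (rule mult_four_block_mat[of _ n n _ 1 _ 1]) auto
  also have "mat n n ?D * 1\<^sub>m n + colm n ?u * 0\<^sub>m 1 n = 1\<^sub>m n * mat n n g + colm n v * rowm n w"
    by (rule eq_matI) (auto simp: scalar_prod_def)
  also have "mat n n ?D * colm n v + colm n ?u * 1\<^sub>m 1 = 1\<^sub>m n * 0\<^sub>m n 1 + colm n v * scm z"
    by (rule eq_matI) (auto simp: scalar_prod_def mult.commute)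
  also have "rowm n w * 1\<^sub>m n + scm ?a * 0\<^sub>m 1 n = 0\<^sub>m 1 n * mat n n g + 1\<^sub>m 1 * rowm n w"
    by (rule eq_matI) (auto simp: scalar_prod_def)
  also have "rowm n w * colm n v + scm ?a * 1\<^sub>m 1 = 0\<^sub>m 1 n * 0\<^sub>m n 1 + 1\<^sub>m 1 * scm z"
    by (rule eq_matI) (auto simp: scalar_prod_def)
  also have "four_block_mat (1\<^sub>m n * mat n n g + colm n v * rowm n w) (1\<^sub>m n * 0\<^sub>m n 1 + colm n v * scm z)
     (0\<^sub>m 1 n * mat n n g + 1\<^sub>m 1 * rowm n w) (0\<^sub>m 1 n * 0\<^sub>m n 1 + 1\<^sub>m 1 * scm z) =
    four_block_mat (1\<^sub>m n) (colm n v) (0\<^sub>m 1 n) (1\<^sub>m 1) * four_block_mat (mat n n g) (0\<^sub>m n 1) (rowm n w) (scm z)"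
    by (rule mult_four_block_mat[of _ n n _ 1 _ 1, symmetric]) auto
  finally show ?thesis .
qed

lemma four_block_carrier_Suc:
  assumes "A \<in> carrier_mat n n" "D \<in> carrier_mat 1 1"
  shows "four_block_mat A B C D \<in> carrier_mat (Suc n) (Suc n)"
  using four_block_carrier_mat[OF assms, of B C] by simp

lemma char_poly_eigencol:
  assumes g: "A \<in> carrier_mat n n" and w: "W \<in> carrier_mat 1 n"
  shows "char_poly (four_block_mat A (0\<^sub>m n 1) W (scm z)) = [:- z, 1:] * char_poly A"
proof -
  let ?T = "four_block_mat A (0\<^sub>m n 1) W (scm z)"
  have "char_poly_matrix ?T = four_block_mat (char_poly_matrix A) (0\<^sub>m n 1) (map_mat (\<lambda>a. [:- a:]) W) (mat 1 1 (\<lambda>_. [:- z, 1:]))"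
    using assms by (intro eq_matI) (auto simp: char_poly_matrix_def)
  then have "char_poly ?T = Determinant.det (char_poly_matrix A) * Determinant.det (mat 1 1 (\<lambda>_. [:- z, 1:]))"
    unfolding char_poly_def using assms by (simp add: det_four_block_mat_upper_right_zero[of _ n _ 1])
  then show ?thesis by (simp add: char_poly_def det_single mult.commute)
qed

lemma cpf_dfl: "cpf (Suc n) (dfl n z v w g) = [:- z, 1:] * cpf n g"
proof -
  let ?G = "mat (Suc n) (Suc n) (dfl n z v w g)"
  let ?P = "four_block_mat (1\<^sub>m n) (colm n v) (0\<^sub>m 1 n) (1\<^sub>m 1)"
  let ?P' = "four_block_mat (1\<^sub>m n) (colm n (\<lambda>i. - v i)) (0\<^sub>m 1 n) (1\<^sub>m 1)"
  let ?T = "four_block_mat (mat n n g) (0\<^sub>m n 1) (rowm n w) (scm z)"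
  have c: "?P \<in> carrier_mat (Suc n) (Suc n)" "?P' \<in> carrier_mat (Suc n) (Suc n)" "?T \<in> carrier_mat (Suc n) (Suc n)" "?G \<in> carrier_mat (Suc n) (Suc n)"
    by (auto intro!: four_block_carrier_Suc)
  have one: "four_block_mat (1\<^sub>m n) (0\<^sub>m n 1) (0\<^sub>m 1 n) (1\<^sub>m 1) = (1\<^sub>m (Suc n) :: complex mat)"
    by (simp add: four_block_one_mat)
  have "?P * ?P' = four_block_mat (1\<^sub>m n * 1\<^sub>m n + colm n v * 0\<^sub>m 1 n) (1\<^sub>m n * colm n (\<lambda>i. - v i) + colm n v * 1\<^sub>m 1)
      (0\<^sub>m 1 n * 1\<^sub>m n + 1\<^sub>m 1 * 0\<^sub>m 1 n) (0\<^sub>m 1 n * colm n (\<lambda>i. - v i) + 1\<^sub>m 1 * 1\<^sub>m 1)"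
    by (rule mult_four_block_mat[of _ n n _ 1 _ 1]) auto
  also have "\<dots> = four_block_mat (1\<^sub>m n) (0\<^sub>m n 1) (0\<^sub>m 1 n) (1\<^sub>m 1)"
    by (intro cong_four_block_mat) (rule eq_matI; auto simp: scalar_prod_def)+
  finally have PP': "?P * ?P' = 1\<^sub>m (Suc n)" by (simp only: one)
  then have P'P: "?P' * ?P = 1\<^sub>m (Suc n)" by (rule mat_mult_left_right_inverse[OF c(1,2)])
  have "?G = ?G * 1\<^sub>m (Suc n)" using right_mult_one_mat[OF c(4)] by simp
  also have "\<dots> = ?G * (?P * ?P')" by (simp only: PP')
  also have "\<dots> = ?G * ?P * ?P'" using c by (simp only: assoc_mult_mat[OF c(4,1,2)])
  also have "\<dots> = ?P * ?T * ?P'" by (simp only: dfl_mult_shear)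
  finally have "similar_mat ?G ?T"
    using c PP' P'P by (intro similar_matI[of _ _ ?P ?P' "Suc n"]) auto
  from char_poly_similar[OF this] show ?thesis
    by (rule trans) (rule char_poly_eigencol, auto)
qed

text \<open>The Euclidean length of the eigenvector \<open>(v, 1)\<close>, whose last entry is
  normalized to 1.\<close>

definition vlen :: "nat \<Rightarrow> (nat \<Rightarrow> complex) \<Rightarrow> real" where
  "vlen n v = sqrt (1 + (\<Sum>i\<in>{0..<n}. (cmod (v i))\<^sup>2))"

text \<open>
  \<open>hhu\<close> is unitary with last column \<open>(v, 1) / vlen v\<close>; after the shear by \<open>v\<close> it becomes
  block triangular, with the rank-one perturbation \<open>hhb\<close> of the identity in the corner
  and inverse \<open>hhc\<close> of that corner.
\<close>

definition hhu :: "nat \<Rightarrow> (nat \<Rightarrow> complex) \<Rightarrow> complex mat" where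
  "hhu n v = (let s = complex_of_real (vlen n v) in mat (Suc n) (Suc n) (\<lambda>(i, j).
     if i < n then (if j < n then (if i = j then 1 else 0) - v i * cnj (v j) / (s * (s + 1)) else v i / s)
     else (if j < n then - cnj (v j) / s else 1 / s)))"

definition hhb :: "nat \<Rightarrow> (nat \<Rightarrow> complex) \<Rightarrow> complex mat" where
  "hhb n v = (let s = complex_of_real (vlen n v) in
     mat n n (\<lambda>(i, j). (if i = j then 1 else 0) + v i * cnj (v j) / (s + 1)))"

definition hhc :: "nat \<Rightarrow> (nat \<Rightarrow> complex) \<Rightarrow> complex mat" where
  "hhc n v = (let s = complex_of_real (vlen n v) in
     mat n n (\<lambda>(i, j). (if i = j then 1 else 0) - v i * cnj (v j) / (s * (s + 1))))"

lemma vlen_facts: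
  fixes n v
  defines "s \<equiv> complex_of_real (vlen n v)"
  shows "(\<Sum>k\<in>{0..<n}. cnj (v k) * v k) = s\<^sup>2 - 1" "(\<Sum>k\<in>{0..<n}. v k * cnj (v k)) = s\<^sup>2 - 1"
    "s \<noteq> 0" "s + 1 \<noteq> 0" "cnj s = s" "vlen n v > 0"
proof -
  have nn: "0 \<le> (\<Sum>i\<in>{0..<n}. (cmod (v i))\<^sup>2)" by (intro sum_nonneg) auto
  then show pos: "vlen n v > 0" by (simp add: vlen_def add_pos_nonneg)
  then show "s \<noteq> 0" by (simp add: s_def)
  have "s + 1 = complex_of_real (vlen n v + 1)" by (simp add: s_def)
  then show "s + 1 \<noteq> 0" using pos by (simp only: of_real_eq_0_iff)
  have sq: "(vlen n v)\<^sup>2 = 1 + (\<Sum>i\<in>{0..<n}. (cmod (v i))\<^sup>2)" using nn by (simp add: vlen_def)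
  have "s\<^sup>2 - 1 = complex_of_real ((vlen n v)\<^sup>2 - 1)" by (simp add: s_def)
  also have "\<dots> = (\<Sum>k\<in>{0..<n}. v k * cnj (v k))"
    unfolding sq by (simp only: of_real_add of_real_sum complex_norm_square of_real_1 add_diff_cancel_left')
  finally show 1: "(\<Sum>k\<in>{0..<n}. v k * cnj (v k)) = s\<^sup>2 - 1" ..
  then show "(\<Sum>k\<in>{0..<n}. cnj (v k) * v k) = s\<^sup>2 - 1" by (simp only: mult.commute)
  show "cnj s = s" by (simp add: s_def)
qed

text \<open>Both factors are rank-one perturbations of the identity; \<open>p\<close> and
  \<open>q\<close> take up the coefficients that depend on the row \<open>i\<close> or on the column
  \<open>j\<close> alone.\<close>

lemma sum_delta_rank_one:
  fixes a b v w :: "nat \<Rightarrow> complex"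
  assumes "i < n" "j < n"
  shows "(\<Sum>k\<in>{0..<n}. ((if i = k then 1 else 0) + p * v k) * ((if k = j then 1 else 0) + q * w k)) =
    (if i = j then 1 else 0) + q * w i + p * v j + p * q * (\<Sum>k\<in>{0..<n}. v k * w k)"
proof -
  have "(\<Sum>k\<in>{0..<n}. ((if i = k then 1 else 0) + p * v k) * ((if k = j then 1 else 0) + q * w k)) =
    (\<Sum>k\<in>{0..<n}. (if k = i then (if i = j then 1 else 0) + q * w i else 0) + (if k = j then p * v j else 0) + p * q * (v k * w k))"
    by (intro sum.cong) (auto simp: algebra_simps)
  also have "\<dots> = (if i = j then 1 else 0) + q * w i + p * v j + p * q * (\<Sum>k\<in>{0..<n}. v k * w k)"
    using assms by (simp add: sum.distrib sum_distrib_left)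
  finally show ?thesis .
qed

text \<open>As \<open>s\<^sup>2 - 1\<close> is the squared length of \<open>v\<close>, these scalar
  facts are what is left of the matrix identities for \<open>hhu\<close>, \<open>hhb\<close> and
  \<open>hhc\<close> once the rank-one terms are collected.\<close>

lemma reflector_identities:
  fixes s :: complex
  assumes "s \<noteq> 0" "s + 1 \<noteq> 0"
  defines "c \<equiv> 1 / (s * (s + 1))"
  shows "1 / (s + 1) * c * (s\<^sup>2 - 1) = 1 / (s + 1) - c"
    and "c\<^sup>2 * (s\<^sup>2 - 1) = 2 * c - (1 / s)\<^sup>2"
    and "c * (s\<^sup>2 - 1) = 1 - 1 / s"
    and "(1 / s)\<^sup>2 * (s\<^sup>2 - 1) = 1 - (1 / s)\<^sup>2"
    and "1 / (s + 1) - 1 / s = - c"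
proof -
  define k where "k = 1 / (s + 1)"
  define r where "r = 1 / s"
  have c: "c = r * k" and r: "r * s = 1" and k: "k * s = 1 - k"
    using assms by (simp_all add: c_def k_def r_def field_simps)
  have ks: "k * (s\<^sup>2 - 1) = s - 1"
    using assms(2) by (simp add: k_def field_simps power2_eq_square)
  show 3: "c * (s\<^sup>2 - 1) = 1 - 1 / s"
    using ks r by (simp add: c mult.assoc flip: r_def) (simp add: algebra_simps)
  show "1 / (s + 1) * c * (s\<^sup>2 - 1) = 1 / (s + 1) - c"
    using 3 by (simp only: mult.assoc flip: k_def r_def) (simp add: c algebra_simps)
  have "c * r = r * r - c"
  proof -
    have "r * r - c = r * r * (k * s + k) - c" using k by simp
    also have "\<dots> = r * (r * s) * k + r * r * k - c" by (simp add: algebra_simps)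
    finally show ?thesis using r by (simp add: c mult_ac)
  qed
  then show "c\<^sup>2 * (s\<^sup>2 - 1) = 2 * c - (1 / s)\<^sup>2"
    using 3 by (simp only: power2_eq_square mult.assoc flip: r_def) (simp add: algebra_simps)
  show "(1 / s)\<^sup>2 * (s\<^sup>2 - 1) = 1 - (1 / s)\<^sup>2"
    using assms(1) by (simp add: field_simps)
  have "r * (k * s + k) = r" using k by simp
  then have "r = k * (r * s) + c" by (simp add: c algebra_simps)
  then show "1 / (s + 1) - 1 / s = - c" using r by (simp flip: k_def r_def)
qed

text \<open>\<open>hhb\<close> is the positive square root of \<open>1 + v v^*\<close>: it
  multiplies \<open>v\<close> by its parameter \<open>s\<close> and fixes the orthogonal complement,
  while \<open>hhc\<close> multiplies \<open>v\<close> by \<open>1 / s\<close> and fixes the same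
  complement.\<close>

lemma hhb_hhc: "hhb n v * hhc n v = 1\<^sub>m n"
proof (rule eq_matI)
  define s where "s = complex_of_real (vlen n v)"
  note f = vlen_facts[where n = n and v = v, folded s_def]
  define c where "c = 1 / (s * (s + 1))"
  define k where "k = 1 / (s + 1)"
  note id = reflector_identities[OF f(3,4), folded c_def k_def]
  fix i j assume "i < dim_row (1\<^sub>m n)" "j < dim_col (1\<^sub>m n)"
  then have ij: "i < n" "j < n" by auto
  have "(hhb n v * hhc n v) $$ (i, j) = (\<Sum>l\<in>{0..<n}. ((if i = l then 1 else 0) + (k * v i) * cnj (v l)) *
      ((if l = j then 1 else 0) + (- c * cnj (v j)) * v l))"
    using ij by (simp add: hhb_def hhc_def Let_def scalar_prod_def k_def c_def s_def) (intro sum.cong, auto)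
  also have "\<dots> = (if i = j then 1 else 0) + (- c * cnj (v j)) * v i + (k * v i) * cnj (v j)
     + (k * v i) * (- c * cnj (v j)) * (s\<^sup>2 - 1)"
    by (subst sum_delta_rank_one[OF ij]) (simp only: f(1))
  also have "(k * v i) * (- c * cnj (v j)) * (s\<^sup>2 - 1) = - (v i * cnj (v j)) * (k * c * (s\<^sup>2 - 1))"
    by (simp only: mult_ac mult_minus_left mult_minus_right)
  also have "(if i = j then 1 else 0) + (- c * cnj (v j)) * v i + (k * v i) * cnj (v j) + - (v i * cnj (v j)) * (k * c * (s\<^sup>2 - 1))
     = (if i = j then 1 else 0)"
    unfolding id(1) by (simp add: algebra_simps)
  finally show "(hhb n v * hhc n v) $$ (i, j) = 1\<^sub>m n $$ (i, j)" using ij by simp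
qed (auto simp: hhb_def hhc_def Let_def)

lemma hhu_unitary: "mat_adjoint (hhu n v) * hhu n v = 1\<^sub>m (Suc n)"
proof (rule eq_matI)
  define s where "s = complex_of_real (vlen n v)"
  note f = vlen_facts[where n = n and v = v, folded s_def]
  define c where "c = 1 / (s * (s + 1))"
  define r where "r = 1 / s"
  note id = reflector_identities[OF f(3,4), folded c_def r_def]
  have c: "cnj c = c" "cnj r = r" using f(5) by (simp_all add: c_def r_def)
  fix i j assume "i < dim_row (1\<^sub>m (Suc n))" "j < dim_col (1\<^sub>m (Suc n))"
  then have ij: "i < Suc n" "j < Suc n" by auto
  have Q: "hhu n v = mat (Suc n) (Suc n) (\<lambda>(i, j).
     if i < n then (if j < n then (if i = j then 1 else 0) - c * (v i * cnj (v j)) else r * v i)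
     else (if j < n then - (r * cnj (v j)) else r))"
    by (rule eq_matI) (auto simp: hhu_def s_def Let_def c_def r_def)
  have e: "(mat_adjoint (hhu n v) * hhu n v) $$ (i, j) =
     (\<Sum>k\<in>{0..<n}. cnj (hhu n v $$ (k, i)) * hhu n v $$ (k, j)) + cnj (hhu n v $$ (n, i)) * hhu n v $$ (n, j)"
    using ij by (simp add: scalar_prod_def Q)
  consider "i < n" "j < n" | "i < n" "j = n" | "i = n" "j < n" | "i = n" "j = n" using ij by linarith
  then have "(mat_adjoint (hhu n v) * hhu n v) $$ (i, j) = (if i = j then 1 else 0)"
  proof cases
    case 1
    have "(\<Sum>k\<in>{0..<n}. cnj (hhu n v $$ (k, i)) * hhu n v $$ (k, j)) =
      (\<Sum>k\<in>{0..<n}. ((if i = k then 1 else 0) + (- c * v i) * cnj (v k)) * ((if k = j then 1 else 0) + (- c * cnj (v j)) * v k))"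
      using 1 c by (intro sum.cong) (auto simp: Q mult_ac)
    also have "\<dots> = (if i = j then 1 else 0) + (- c * cnj (v j)) * v i + (- c * v i) * cnj (v j)
        + (- c * v i) * (- c * cnj (v j)) * (s\<^sup>2 - 1)"
      by (subst sum_delta_rank_one[OF 1]) (simp only: f(1))
    also have "(- c * v i) * (- c * cnj (v j)) * (s\<^sup>2 - 1) = (v i * cnj (v j)) * (c\<^sup>2 * (s\<^sup>2 - 1))"
      by (simp only: mult_ac power2_eq_square mult_minus_left mult_minus_right minus_minus)
    finally show ?thesis
      unfolding e id(2) using 1 c by (simp add: Q algebra_simps power2_eq_square)
  next
    case 2
    have "(\<Sum>k\<in>{0..<n}. cnj (hhu n v $$ (k, i)) * hhu n v $$ (k, j)) =
      (\<Sum>k\<in>{0..<n}. (if k = i then r * v i else 0) + (- (r * v i) * c) * (cnj (v k) * v k))"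
      using 2 c by (intro sum.cong) (auto simp: Q algebra_simps)
    also have "\<dots> = r * v i + (- (r * v i)) * (c * (s\<^sup>2 - 1))"
      using 2 by (simp only: sum.distrib sum_distrib_left[symmetric] f(1)) simp
    finally show ?thesis
      unfolding e id(3) using 2 c by (simp add: Q algebra_simps)
  next
    case 3
    have "(\<Sum>k\<in>{0..<n}. cnj (hhu n v $$ (k, i)) * hhu n v $$ (k, j)) =
      (\<Sum>k\<in>{0..<n}. (if k = j then r * cnj (v j) else 0) + (- (r * cnj (v j)) * c) * (cnj (v k) * v k))"
      using 3 c by (intro sum.cong) (auto simp: Q algebra_simps)
    also have "\<dots> = r * cnj (v j) + (- (r * cnj (v j))) * (c * (s\<^sup>2 - 1))"
      using 3 by (simp only: sum.distrib sum_distrib_left[symmetric] f(1)) simp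
    finally show ?thesis
      unfolding e id(3) using 3 c by (simp add: Q algebra_simps)
  next
    case 4
    have "(\<Sum>k\<in>{0..<n}. cnj (hhu n v $$ (k, i)) * hhu n v $$ (k, j)) = (\<Sum>k\<in>{0..<n}. r\<^sup>2 * (cnj (v k) * v k))"
      using 4 c by (intro sum.cong) (auto simp: Q power2_eq_square)
    also have "\<dots> = r\<^sup>2 * (s\<^sup>2 - 1)"
      by (simp only: sum_distrib_left[symmetric] f(1))
    finally show ?thesis
      unfolding e id(4) using 4 c by (simp add: Q power2_eq_square)
  qed
  then show "(mat_adjoint (hhu n v) * hhu n v) $$ (i, j) = 1\<^sub>m (Suc n) $$ (i, j)" using ij by simp
qed (auto simp: hhu_def Let_def)

lemma hhu_carrier [simp]: "hhu n v \<in> carrier_mat (Suc n) (Suc n)"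
  and hhb_carrier [simp]: "hhb n v \<in> carrier_mat n n"
  and hhc_carrier [simp]: "hhc n v \<in> carrier_mat n n"
  by (simp_all add: hhu_def hhb_def hhc_def Let_def)

text \<open>With P the shear, T the block triangular form and K the block matrix containing
  \<open>hhb\<close>, the two hypotheses amount to T K = K S, where S is block triangular with
  entries \<open>h\<close>, \<open>t\<close> and \<open>z\<close>. As P K is the unitary
  \<open>hhu\<close>, the matrix is \<open>hhu S hhu^*\<close> and has the norm of S, a sum without
  mixed terms.\<close>

lemma fro_dfl:
  fixes n z v w g h t
  defines "s \<equiv> complex_of_real (vlen n v)" and "b \<equiv> rowm n (\<lambda>j. - cnj (v j) / complex_of_real (vlen n v))"
  assumes g: "mat n n g * hhb n v = hhb n v * mat n n h"
    and w: "rowm n w * hhb n v + scm z * b = b * mat n n h + scm (1 / s) * rowm n t"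
  shows "fro (mat (Suc n) (Suc n) (dfl n z v w g)) = fro (mat n n h) + (\<Sum>j\<in>{0..<n}. (cmod (t j))\<^sup>2) + (cmod z)\<^sup>2"
proof -
  note f = vlen_facts[where n = n and v = v, folded s_def]
  let ?B = "hhb n v" and ?Q = "hhu n v"
  let ?G = "mat (Suc n) (Suc n) (dfl n z v w g)"
  let ?P = "four_block_mat (1\<^sub>m n) (colm n v) (0\<^sub>m 1 n) (1\<^sub>m 1)"
  let ?T = "four_block_mat (mat n n g) (0\<^sub>m n 1) (rowm n w) (scm z)"
  let ?K = "four_block_mat ?B (0\<^sub>m n 1) b (scm (1 / s))"
  let ?S = "four_block_mat (mat n n h) (0\<^sub>m n 1) (rowm n t) (scm z)"
  have b: "b \<in> carrier_mat 1 n" by (simp add: b_def)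
  have c: "?P \<in> carrier_mat (Suc n) (Suc n)" "?T \<in> carrier_mat (Suc n) (Suc n)" "?K \<in> carrier_mat (Suc n) (Suc n)"
     "?S \<in> carrier_mat (Suc n) (Suc n)" "?G \<in> carrier_mat (Suc n) (Suc n)" "?Q \<in> carrier_mat (Suc n) (Suc n)"
     "mat_adjoint ?Q \<in> carrier_mat (Suc n) (Suc n)"
    by (auto intro!: four_block_carrier_Suc)
  \<comment> \<open>The upper left block of the product is \<open>hhb\<close> minus
    \<open>v v^* / s\<close>, which the last of the scalar identities turns into the corner of
    \<open>hhu\<close>.\<close>
  have PK: "?P * ?K = ?Q"
  proof -
    have "?P * ?K = four_block_mat (1\<^sub>m n * ?B + colm n v * b) (1\<^sub>m n * 0\<^sub>m n 1 + colm n v * scm (1 / s))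
        (0\<^sub>m 1 n * ?B + 1\<^sub>m 1 * b) (0\<^sub>m 1 n * 0\<^sub>m n 1 + 1\<^sub>m 1 * scm (1 / s))"
      using b by (intro mult_four_block_mat[of _ n n _ 1 _ 1]) auto
    also have "\<dots> = ?Q"
    proof (rule eq_matI, goal_cases)
      case (1 i j)
      then have ij: "i < Suc n" "j < Suc n" by (auto simp: hhu_def Let_def)
      have *: "x / (s + 1) - x / s = - (x / (s * (s + 1)))" for x
        using arg_cong[OF reflector_identities(5)[OF f(3,4)], of "(*) x"] by (simp add: right_diff_distrib)
      have 1: "(1\<^sub>m n * ?B + colm n v * b) $$ (i, j) = (if i = j then 1 else 0) - v i * cnj (v j) / (s * (s + 1))"
        if "i < n" "j < n"
        using that *[of "v i * cnj (v j)"] by (simp add: hhb_def Let_def b_def scalar_prod_def flip: s_def)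
      show ?case
        using ij 1 by (auto simp: less_Suc_eq hhu_def Let_def b_def scalar_prod_def s_def hhb_def)
    qed (use b in \<open>auto simp: hhu_def Let_def\<close>)
    finally show ?thesis .
  qed
  have TK: "?T * ?K = ?K * ?S"
  proof -
    have "?T * ?K = four_block_mat (mat n n g * ?B + 0\<^sub>m n 1 * b) (mat n n g * 0\<^sub>m n 1 + 0\<^sub>m n 1 * scm (1 / s))
        (rowm n w * ?B + scm z * b) (rowm n w * 0\<^sub>m n 1 + scm z * scm (1 / s))"
      using b by (intro mult_four_block_mat[of _ n n _ 1 _ 1]) auto
    also have "mat n n g * ?B + 0\<^sub>m n 1 * b = ?B * mat n n h + 0\<^sub>m n 1 * rowm n t"
      using b unfolding g by (intro arg_cong2[of _ _ _ _ "(+)"] refl) (auto intro!: eq_matI simp: scalar_prod_def)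
    also have "mat n n g * 0\<^sub>m n 1 + 0\<^sub>m n 1 * scm (1 / s) = ?B * 0\<^sub>m n 1 + 0\<^sub>m n 1 * scm z"
      by (rule eq_matI) (auto simp: scalar_prod_def hhb_def Let_def)
    also have "rowm n w * ?B + scm z * b = b * mat n n h + scm (1 / s) * rowm n t" by (rule w)
    also have "rowm n w * 0\<^sub>m n 1 + scm z * scm (1 / s) = b * 0\<^sub>m n 1 + scm (1 / s) * scm z"
      using b by (intro eq_matI) (auto simp: scalar_prod_def)
    also have "four_block_mat (?B * mat n n h + 0\<^sub>m n 1 * rowm n t) (?B * 0\<^sub>m n 1 + 0\<^sub>m n 1 * scm z)
       (b * mat n n h + scm (1 / s) * rowm n t) (b * 0\<^sub>m n 1 + scm (1 / s) * scm z) = ?K * ?S"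
      using b by (intro mult_four_block_mat[of _ n n _ 1 _ 1, symmetric]) auto
    finally show ?thesis .
  qed
  have QQ: "?Q * mat_adjoint ?Q = 1\<^sub>m (Suc n)"
    by (rule mat_mult_left_right_inverse[OF c(7,6) hhu_unitary])
  have "?G * ?Q = ?G * ?P * ?K" unfolding PK[symmetric] by (rule assoc_mult_mat[OF c(5,1,3), symmetric])
  also have "\<dots> = ?P * ?T * ?K" by (simp only: dfl_mult_shear)
  also have "\<dots> = ?P * (?T * ?K)" by (rule assoc_mult_mat[OF c(1,2,3)])
  also have "\<dots> = ?P * ?K * ?S" unfolding TK by (rule assoc_mult_mat[OF c(1,3,4), symmetric])
  finally have GQ: "?G * ?Q = ?Q * ?S" by (simp only: PK)
  have "?G = ?G * 1\<^sub>m (Suc n)" using right_mult_one_mat[OF c(5)] by simp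
  also have "\<dots> = ?G * (?Q * mat_adjoint ?Q)" by (simp only: QQ)
  also have "\<dots> = ?G * ?Q * mat_adjoint ?Q" by (rule assoc_mult_mat[OF c(5-7), symmetric])
  also have "\<dots> = ?Q * ?S * mat_adjoint ?Q" by (simp only: GQ)
  finally have "fro ?G = fro (?Q * ?S * mat_adjoint ?Q)" by (rule arg_cong)
  also have "\<dots> = fro ?S" by (rule fro_unitary_conj[OF c(6) hhu_unitary c(4)])
  also have "\<dots> = fro (mat n n h) + (\<Sum>j\<in>{0..<n}. (cmod (t j))\<^sup>2) + (cmod z)\<^sup>2"
    by (simp add: fro_def sum.distrib)
  finally show ?thesis .
qed

section \<open>Measurability of characteristic polynomials, norms and determinants\<close>

lemma coeff_cpf_measurable [measurable (raw)]:
  assumes "D \<in> measurable M (lb ({0..<n} \<times> {0..<n}))"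
  shows "(\<lambda>x. coeff (cpf n (D x)) k) \<in> borel_measurable M"
proof -
  have "(\<lambda>x. coeff (cpf n x) k) \<in> polyfun ({0..<n} \<times> {0..<n})"
    using polycoeff_char_poly[of n "{0..<n} \<times> {0..<n}"] by (simp add: polycoeff_def)
  from measurable_compose[OF assms polyfun_measurable[OF this]] show ?thesis .
qed

lemma poly_cpf_measurable [measurable (raw)]:
  assumes [measurable]: "D \<in> measurable M (lb ({0..<n} \<times> {0..<n}))" "z \<in> borel_measurable M"
  shows "(\<lambda>x. poly (cpf n (D x)) (z x)) \<in> borel_measurable M"
  unfolding poly_altdef degree_cpf by measurable

lemma poly_pderiv_cpf_measurable [measurable (raw)]:
  assumes [measurable]: "D \<in> measurable M (lb ({0..<n} \<times> {0..<n}))" "z \<in> borel_measurable M"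
  shows "(\<lambda>x. poly (pderiv (cpf n (D x))) (z x)) \<in> borel_measurable M"
  unfolding poly_altdef degree_pderiv degree_cpf coeff_pderiv by measurable

lemma fro_mat: "fro (mat n n x) = (\<Sum>i\<in>{0..<n}. \<Sum>j\<in>{0..<n}. (cmod (x (i, j)))\<^sup>2)"
  by (simp add: fro_def)

lemma component_measurable:
  assumes "D \<in> measurable M (lb I)" "i \<in> I"
  shows "(\<lambda>x. D x i) \<in> borel_measurable M"
  using measurable_compose[OF assms(1) measurable_component_singleton[OF assms(2), of "\<lambda>_. lborel"]] by simp

lemma fro_measurable [measurable (raw)]:
  assumes D: "D \<in> measurable M (lb ({0..<n} \<times> {0..<n}))"
  shows "(\<lambda>x. fro (mat n n (D x))) \<in> borel_measurable M"
  unfolding fro_mat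
proof (intro borel_measurable_sum borel_measurable_power)
  fix i j assume "i \<in> {0..<n}" "j \<in> {0..<n}"
  then have [measurable]: "(\<lambda>x. D x (i, j)) \<in> borel_measurable M"
    by (intro component_measurable[OF D]) auto
  show "(\<lambda>x. cmod (D x (i, j))) \<in> borel_measurable M" by measurable
qed

lemma restrict_measurable_lb:
  assumes "\<And>i. i \<in> I \<Longrightarrow> (\<lambda>x. f x i) \<in> borel_measurable M"
  shows "(\<lambda>x. \<lambda>i\<in>I. f x i) \<in> measurable M (lb I)"
  using assms by (intro measurable_restrict) simp

lemma dfl_measurable [measurable (raw)]:
  assumes g: "g \<in> measurable M (lb ({0..<n} \<times> {0..<n}))" and v: "v \<in> measurable M (lb {0..<n})"
    and w: "w \<in> measurable M (lb {0..<n})" and z: "z \<in> borel_measurable M"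
  shows "(\<lambda>x. dfl n (z x) (v x) (w x) (g x)) \<in> measurable M (lb ({0..<Suc n} \<times> {0..<Suc n}))"
proof -
  have gm: "(\<lambda>x. g x (i, j) + v x i * w x j) \<in> borel_measurable M" if "i < n" "j < n" for i j
    using component_measurable[OF g, of "(i, j)"] component_measurable[OF v, of i] component_measurable[OF w, of j] that
    by simp
  have D: "(\<lambda>x. \<lambda>ij\<in>{0..<n} \<times> {0..<n}. (case ij of (i, j) \<Rightarrow> g x (i, j) + v x i * w x j)) \<in> measurable M (lb ({0..<n} \<times> {0..<n}))"
    by (rule restrict_measurable_lb) (auto intro: gm)
  have U: "(\<lambda>x. \<lambda>i\<in>{0..<n}. z x * v x i - (\<Sum>j\<in>{0..<n}. (g x (i, j) + v x i * w x j) * v x j)) \<in> measurable M (lb {0..<n})"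
    by (intro restrict_measurable_lb borel_measurable_diff borel_measurable_times z borel_measurable_sum
          component_measurable[OF v] gm) auto
  have A: "(\<lambda>x. z x - (\<Sum>j\<in>{0..<n}. w x j * v x j)) \<in> borel_measurable M"
    by (intro borel_measurable_diff borel_measurable_times z borel_measurable_sum
          component_measurable[OF v] component_measurable[OF w]) auto
  have "(\<lambda>x. dfl n (z x) (v x) (w x) (g x)) = (\<lambda>x. blk n (\<lambda>ij\<in>{0..<n} \<times> {0..<n}. (case ij of (i, j) \<Rightarrow> g x (i, j) + v x i * w x j))
     (\<lambda>i\<in>{0..<n}. z x * v x i - (\<Sum>j\<in>{0..<n}. (g x (i, j) + v x i * w x j) * v x j)) (w x) (z x - (\<Sum>j\<in>{0..<n}. w x j * v x j)))"
    by (auto simp: dfl_def blk_def fun_eq_iff)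
  then show ?thesis using measurable_blk[OF D U w A] by simp
qed

lemma det_measurable:
  fixes A :: "'z \<Rightarrow> complex mat"
  assumes "\<And>x. A x \<in> carrier_mat n n" "\<And>i j. i < n \<Longrightarrow> j < n \<Longrightarrow> (\<lambda>x. A x $$ (i, j)) \<in> borel_measurable M"
  shows "(\<lambda>x. Determinant.det (A x)) \<in> borel_measurable M"
  unfolding det_def'[OF assms(1)]
proof (intro borel_measurable_sum borel_measurable_times borel_measurable_const borel_measurable_prod)
  fix p i assume "p \<in> {p. p permutes {0..<n}}" "i \<in> {0..<n}"
  then show "(\<lambda>x. A x $$ (i, p i)) \<in> borel_measurable M"
    using assms(2)[of i "p i"] permutes_in_image[of p "{0..<n}" i] by auto
qed

text \<open>The linear part of the substitution of the last row in the unitary change of basis.\<close>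

definition rowsub :: "nat \<Rightarrow> (nat \<Rightarrow> complex) \<Rightarrow> complex mat" where
  "rowsub n v = mat n n (\<lambda>(i, j). hhc n v $$ (j, i) / complex_of_real (vlen n v))"

lemma rowsub_carrier [simp]: "rowsub n v \<in> carrier_mat n n"
  by (simp add: rowsub_def)

lemma det_rowsub: "Determinant.det (rowsub n v) \<noteq> 0"
proof -
  have "rowsub n v = (1 / complex_of_real (vlen n v)) \<cdot>\<^sub>m transpose_mat (hhc n v)"
    by (rule eq_matI) (auto simp: rowsub_def hhc_def Let_def)
  then have "Determinant.det (rowsub n v) = (1 / complex_of_real (vlen n v)) ^ n * Determinant.det (hhc n v)"
    using hhc_carrier[of n v] carrier_matD[OF hhc_carrier[of n v]] by (simp add: det_transpose[of _ n])
  moreover have "Determinant.det (hhb n v) * Determinant.det (hhc n v) = 1"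
    using det_mult[OF hhb_carrier hhc_carrier, of n v v] by (simp add: hhb_hhc)
  ultimately show ?thesis using vlen_facts(3)[of n v] by auto
qed

text \<open>The Jacobian of the row substitution is later integrated over \<open>v\<close> into a
  constant without being evaluated, which calls for its measurability.\<close>

lemma det_rowsub_measurable [measurable]: "(\<lambda>v. Determinant.det (rowsub n v)) \<in> borel_measurable (lb {0..<n})"
proof (rule det_measurable[OF rowsub_carrier])
  fix i j assume ij: "i < n" "j < n"
  have v: "(\<lambda>v. v k) \<in> borel_measurable (lb {0..<n})" if "k < n" for k
    using that component_measurable[of "\<lambda>x. x" "lb {0..<n}" "{0..<n}" k] by simp
  have s: "(\<lambda>v. complex_of_real (vlen n v)) \<in> borel_measurable (lb {0..<n})"
    unfolding vlen_def using v by (intro measurable_compose[OF _ borel_measurable_of_real]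
      borel_measurable_sqrt borel_measurable_add borel_measurable_sum borel_measurable_power
      measurable_compose[OF _ borel_measurable_norm]) auto
  have c: "(\<lambda>v. cnj (v j)) \<in> borel_measurable (lb {0..<n})" if "j < n" for j
    by (rule measurable_compose[OF v[OF that]]) (intro borel_measurable_continuous_onI continuous_intros)
  have "(\<lambda>v. ((if j = i then 1 else 0) - v j * cnj (v i) / (complex_of_real (vlen n v) * (complex_of_real (vlen n v) + 1))) / complex_of_real (vlen n v))
     \<in> borel_measurable (lb {0..<n})"
    by (intro borel_measurable_divide borel_measurable_diff borel_measurable_times borel_measurable_add v c s borel_measurable_const ij)
  then show "(\<lambda>v. rowsub n v $$ (i, j)) \<in> borel_measurable (lb {0..<n})"
    by (simp only: rowsub_def hhc_def Let_def index_mat(1) ij prod.case)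
qed

section \<open>From the entries of a matrix to an eigenvalue, its eigenvector and the
  quotient\<close>

lemma nn_integral_swap:
  assumes "sigma_finite_measure A" "sigma_finite_measure B"
    and "(\<lambda>(a, b). f a b) \<in> borel_measurable (A \<Otimes>\<^sub>M B)"
  shows "(\<integral>\<^sup>+a. \<integral>\<^sup>+b. f a b \<partial>B \<partial>A) = (\<integral>\<^sup>+b. \<integral>\<^sup>+a. f a b \<partial>A \<partial>B)"
proof -
  interpret pair_sigma_finite A B using assms by (intro pair_sigma_finite.intro)
  show ?thesis by (rule Fubini'[OF assms(3), symmetric])
qed

text \<open>Write Q for \<open>cpf n D\<close> and p for \<open>cpf n g\<close>. Then
  \<open>P - a Q = (X - z) p\<close>, so at \<open>z\<close> one has \<open>P = a Q\<close> and, by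
  differentiation, \<open>P' - a Q' = p\<close>. Hence \<open>P' Q - P Q' = Q p\<close> there and
  the derivative of \<open>P / Q\<close> is \<open>p / Q\<close>; the Jacobian \<open>|Q|^2\<close>
  of the column substitution cancels the denominator and leaves \<open>|p|^2\<close>.\<close>

lemma deflate_scalar:
  fixes n D v w z
  assumes Q: "poly (cpf n D) z \<noteq> 0"
  defines "g \<equiv> (\<lambda>(i, j)\<in>{0..<n} \<times> {0..<n}. - (v i * w j) + D (i, j))"
    and "P \<equiv> cpf (Suc n) (blk n D (\<lambda>i\<in>{0..<n}. z * v i - (\<Sum>j\<in>{0..<n}. D (i, j) * v j)) w 0)"
  shows "blk n D (\<lambda>i\<in>{0..<n}. z * v i - (\<Sum>j\<in>{0..<n}. D (i, j) * v j)) w (poly P z / poly (cpf n D) z) = dfl n z v w g"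
    and "(cmod (poly (cpf n D) z))\<^sup>2 *
       (cmod (poly (pderiv P * cpf n D - P * pderiv (cpf n D)) z / (poly (cpf n D) z)\<^sup>2))\<^sup>2
       = (cmod (poly (cpf n g) z))\<^sup>2"
proof -
  define a where "a = z - (\<Sum>j\<in>{0..<n}. w j * v j)"
  let ?u = "\<lambda>i\<in>{0..<n}. z * v i - (\<Sum>j\<in>{0..<n}. D (i, j) * v j)"
  have d: "dfl n z v w g = blk n D ?u w a"
    unfolding dfl_def blk_def g_def a_def by (auto simp: fun_eq_iff intro!: sum.cong)
  have *: "P - Polynomial.smult a (cpf n D) = [:- z, 1:] * cpf n g"
    using cpf_dfl[of n z v w g] cpf_blk[of n D ?u w a] unfolding d P_def by simp
  from arg_cong[OF *, of "\<lambda>p. poly p z"] have Pz: "poly P z = a * poly (cpf n D) z" by simp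
  then have "poly P z / poly (cpf n D) z = a" using Q by simp
  then show "blk n D ?u w (poly P z / poly (cpf n D) z) = dfl n z v w g" by (simp add: d)
  have "poly (pderiv (P - Polynomial.smult a (cpf n D))) z = poly (cpf n g) z"
    unfolding * pderiv_mult by (simp add: pderiv_pCons)
  then have r: "poly (cpf n g) z = poly (pderiv P) z - a * poly (pderiv (cpf n D)) z"
    by (simp only: pderiv_diff pderiv_smult poly_diff poly_smult)
  have "poly (pderiv P * cpf n D - P * pderiv (cpf n D)) z = poly (cpf n D) z * poly (cpf n g) z"
    unfolding r poly_diff poly_mult Pz by (simp only: right_diff_distrib mult_ac)
  then have e: "poly (pderiv P * cpf n D - P * pderiv (cpf n D)) z / (poly (cpf n D) z)\<^sup>2 = poly (cpf n g) z / poly (cpf n D) z"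
    using Q by (simp add: power2_eq_square)
  show "(cmod (poly (cpf n D) z))\<^sup>2 *
       (cmod (poly (pderiv P * cpf n D - P * pderiv (cpf n D)) z / (poly (cpf n D) z)\<^sup>2))\<^sup>2
       = (cmod (poly (cpf n g) z))\<^sup>2"
    unfolding e norm_divide power_divide using Q by simp
qed

text \<open>The shift \<open>e\<close> solves the second hypothesis of \<open>fro_dfl\<close> for an
  arbitrary \<open>t\<close>: it cancels the mixed terms in \<open>h\<close> and \<open>z\<close>.
  Being a translation of \<open>t\<close>, it costs no Jacobian, so only the linear part
  \<open>rowsub\<close> does.\<close>

lemma fro_dfl_unitary:
  fixes n z v h t
  defines "s \<equiv> complex_of_real (vlen n v)"
  defines "e \<equiv> (\<lambda>i. (\<Sum>k\<in>{0..<n}. - cnj (v k) * h (k, i)) + z * cnj (v i))"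
  defines "g \<equiv> (\<lambda>ij\<in>{0..<n} \<times> {0..<n}. (hhb n v * mat n n h * hhc n v) $$ ij)"
  shows "fro (mat (Suc n) (Suc n) (dfl n z v (mvf n (rowsub n v) (\<lambda>i\<in>{0..<n}. e i + t i)) g)) =
      fro (mat n n h) + (\<Sum>j\<in>{0..<n}. (cmod (t j))\<^sup>2) + (cmod z)\<^sup>2"
    and "cpf n g = cpf n h"
proof -
  note f = vlen_facts[where n = n and v = v, folded s_def]
  let ?B = "hhb n v" and ?C = "hhc n v" and ?w = "mvf n (rowsub n v) (\<lambda>i\<in>{0..<n}. e i + t i)"
  let ?b = "rowm n (\<lambda>j. - cnj (v j) / complex_of_real (vlen n v))"
  have CB: "?C * ?B = 1\<^sub>m n" by (rule mat_mult_left_right_inverse[OF hhb_carrier hhc_carrier hhb_hhc])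
  have h: "mat n n h \<in> carrier_mat n n" by simp
  have BH: "?B * mat n n h \<in> carrier_mat n n" by (rule mult_carrier_mat[OF hhb_carrier h])
  have g: "mat n n g = ?B * mat n n h * ?C"
    unfolding g_def using BH by (intro eq_matI) (auto simp: hhb_def hhc_def Let_def)
  have 1: "mat n n g * ?B = ?B * mat n n h"
  proof -
    have "mat n n g * ?B = ?B * mat n n h * (?C * ?B)"
      unfolding g by (rule assoc_mult_mat[OF BH hhc_carrier hhb_carrier])
    then show ?thesis using BH by (simp add: CB)
  qed
  have 2: "rowm n ?w * ?B + scm z * ?b = ?b * mat n n h + scm (1 / s) * rowm n t"
  proof -
    have w: "rowm n ?w = rowm n (\<lambda>i. (e i + t i) / s) * ?C"
      by (rule eq_matI) (auto simp: mvf_def rowsub_def scalar_prod_def s_def hhc_def Let_def mult.commute intro!: sum.cong)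
    have "rowm n ?w * ?B = rowm n (\<lambda>i. (e i + t i) / s) * (?C * ?B)"
      unfolding w by (rule assoc_mult_mat[of _ 1 n _ n _ n]) auto
    then have wB: "rowm n ?w * ?B = rowm n (\<lambda>i. (e i + t i) / s)"
      unfolding CB using right_mult_one_mat[of "rowm n (\<lambda>i. (e i + t i) / s)" 1 n] by simp
    show ?thesis
      unfolding wB using f(3)
      by (intro eq_matI) (auto simp: scalar_prod_def e_def s_def add_divide_distrib sum_divide_distrib)
  qed
  show "fro (mat (Suc n) (Suc n) (dfl n z v ?w g)) = fro (mat n n h) + (\<Sum>j\<in>{0..<n}. (cmod (t j))\<^sup>2) + (cmod z)\<^sup>2"
    using fro_dfl[OF 1, of ?w z t] 2 unfolding s_def by blast
  have "similar_mat (mat n n g) (mat n n h)"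
    by (rule similar_matI[of _ _ ?B ?C n]) (auto simp: hhb_hhc CB g intro!: mult_carrier_mat[OF BH hhc_carrier])
  then show "cpf n g = cpf n h" by (rule char_poly_similar)
qed

text \<open>For fixed \<open>z\<close> outside the spectrum of the corner,
  \<open>u = (z - D) v\<close> is an invertible linear substitution, and its determinant is the
  denominator \<open>poly (cpf n D) z\<close> of the rational function.\<close>

lemma nn_integral_deflate_at:
  fixes F :: "(nat \<times> nat \<Rightarrow> complex) \<Rightarrow> ennreal"
  assumes F [measurable]: "F \<in> borel_measurable (lb ({0..<Suc n} \<times> {0..<Suc n}))"
    and D: "D \<in> space (lb ({0..<n} \<times> {0..<n}))" and w: "w \<in> space (lb {0..<n})" and Q: "poly (cpf n D) z \<noteq> 0"
  shows "(\<integral>\<^sup>+u. ennreal ((cmod (poly (pderiv (cpf (Suc n) (blk n D u w 0)) * cpf n D -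
            cpf (Suc n) (blk n D u w 0) * pderiv (cpf n D)) z / (poly (cpf n D) z)\<^sup>2))\<^sup>2) *
          F (blk n D u w (poly (cpf (Suc n) (blk n D u w 0)) z / poly (cpf n D) z)) \<partial>lb {0..<n}) =
     (\<integral>\<^sup>+v. (let g = \<lambda>(i, j)\<in>{0..<n} \<times> {0..<n}. - (v i * w j) + D (i, j) in
        ennreal ((cmod (poly (cpf n g) z))\<^sup>2) * F (dfl n z v w g)) \<partial>lb {0..<n})"
proof -
  define A where "A = mat n n (\<lambda>(i, j). (if i = j then z else 0) - D (i, j))"
  define J where "J = (\<lambda>u. ennreal ((cmod (poly (pderiv (cpf (Suc n) (blk n D u w 0)) * cpf n D -
            cpf (Suc n) (blk n D u w 0) * pderiv (cpf n D)) z / (poly (cpf n D) z)\<^sup>2))\<^sup>2) *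
          F (blk n D u w (poly (cpf (Suc n) (blk n D u w 0)) z / poly (cpf n D) z)))"
  have A: "A \<in> carrier_mat n n" by (simp add: A_def)
  have "A = - char_matrix (mat n n D) z"
    by (rule eq_matI) (auto simp: A_def char_matrix_def)
  then have detA: "Determinant.det A = poly (cpf n D) z"
    using char_poly_matrix[of "mat n n D" n z] by simp
  have [measurable]: "(\<lambda>_. D) \<in> measurable (lb {0..<n}) (lb ({0..<n} \<times> {0..<n}))" "(\<lambda>_. w) \<in> measurable (lb {0..<n}) (lb {0..<n})"
    using D w by simp_all
  have J: "J \<in> borel_measurable (lb {0..<n})"
    unfolding J_def poly_diff poly_mult by measurable
  have mvf: "mvf n A v = (\<lambda>i\<in>{0..<n}. z * v i - (\<Sum>j\<in>{0..<n}. D (i, j) * v j))" for v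
  proof
    fix i
    show "mvf n A v i = (\<lambda>i\<in>{0..<n}. z * v i - (\<Sum>j\<in>{0..<n}. D (i, j) * v j)) i"
    proof (cases "i < n")
      case True
      then have "(\<Sum>j\<in>{0..<n}. A $$ (i, j) * v j) = (\<Sum>j\<in>{0..<n}. (if j = i then z * v i else 0) - D (i, j) * v j)"
        by (intro sum.cong) (auto simp: A_def algebra_simps)
      also have "\<dots> = z * v i - (\<Sum>j\<in>{0..<n}. D (i, j) * v j)"
        using True by (simp add: sum_subtractf)
      finally show ?thesis using True by (simp add: mvf_def)
    qed (simp add: mvf_def)
  qed
  have "(\<integral>\<^sup>+u. J u \<partial>lb {0..<n}) = (\<integral>\<^sup>+v. ennreal ((cmod (Determinant.det A))\<^sup>2) * J (mvf n A v) \<partial>lb {0..<n})"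
    by (rule nn_integral_linear[OF A _ J, symmetric]) (simp add: detA Q)
  also have "\<dots> = (\<integral>\<^sup>+v. (let g = \<lambda>(i, j)\<in>{0..<n} \<times> {0..<n}. - (v i * w j) + D (i, j) in
        ennreal ((cmod (poly (cpf n g) z))\<^sup>2) * F (dfl n z v w g)) \<partial>lb {0..<n})"
  proof (rule nn_integral_cong)
    fix v
    define g where "g = (\<lambda>(i, j)\<in>{0..<n} \<times> {0..<n}. - (v i * w j) + D (i, j))"
    have "ennreal ((cmod (Determinant.det A))\<^sup>2) * J (mvf n A v) = ennreal ((cmod (poly (cpf n g) z))\<^sup>2) * F (dfl n z v w g)"
      unfolding J_def mvf detA deflate_scalar(1)[OF Q, of v w] g_def deflate_scalar(2)[OF Q, of v w, symmetric]
      by (simp add: ennreal_mult mult.assoc)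
    then show "ennreal ((cmod (Determinant.det A))\<^sup>2) * J (mvf n A v) =
      (let g = \<lambda>(i, j)\<in>{0..<n} \<times> {0..<n}. - (v i * w j) + D (i, j) in
        ennreal ((cmod (poly (cpf n g) z))\<^sup>2) * F (dfl n z v w g))"
      by (simp only: g_def Let_def)
  qed
  finally show ?thesis by (simp only: J_def)
qed

lemma nn_integral_rev3:
  assumes sf: "sigma_finite_measure A" "sigma_finite_measure B" "sigma_finite_measure C"
    and [measurable]: "(\<lambda>((a, b), c). f a b c) \<in> borel_measurable ((A \<Otimes>\<^sub>M B) \<Otimes>\<^sub>M C)"
  shows "(\<integral>\<^sup>+a. \<integral>\<^sup>+b. \<integral>\<^sup>+c. f a b c \<partial>C \<partial>B \<partial>A) = (\<integral>\<^sup>+c. \<integral>\<^sup>+b. \<integral>\<^sup>+a. f a b c \<partial>A \<partial>B \<partial>C)"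
proof -
  interpret A: sigma_finite_measure A by (rule sf)
  interpret B: sigma_finite_measure B by (rule sf)
  interpret C: sigma_finite_measure C by (rule sf)
  have [measurable (raw)]: "(\<lambda>x. f (p x) (q x) (r x)) \<in> borel_measurable M"
    if "p \<in> measurable M A" "q \<in> measurable M B" "r \<in> measurable M C" for p q r and M :: "'z measure"
    using measurable_compose[OF measurable_Pair[OF measurable_Pair[OF that(1,2)] that(3)] assms(4)] by simp
  have "(\<integral>\<^sup>+a. \<integral>\<^sup>+b. \<integral>\<^sup>+c. f a b c \<partial>C \<partial>B \<partial>A) = (\<integral>\<^sup>+b. \<integral>\<^sup>+a. \<integral>\<^sup>+c. f a b c \<partial>C \<partial>A \<partial>B)"
    by (rule nn_integral_swap[OF sf(1,2)]) measurable
  also have "\<dots> = (\<integral>\<^sup>+b. \<integral>\<^sup>+c. \<integral>\<^sup>+a. f a b c \<partial>A \<partial>C \<partial>B)"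
    by (intro nn_integral_cong nn_integral_swap[OF sf(1,3)]) measurable
  also have "\<dots> = (\<integral>\<^sup>+c. \<integral>\<^sup>+b. \<integral>\<^sup>+a. f a b c \<partial>A \<partial>B \<partial>C)"
    by (rule nn_integral_swap[OF sf(2,3)]) measurable
  finally show ?thesis .
qed

text \<open>The factor n + 1 counts a matrix once for every eigenvalue. The order of the
  substitutions matters: \<open>a\<close> is replaced by \<open>z\<close> while \<open>u\<close> is
  fixed, and only then \<open>u\<close> by \<open>v\<close> while \<open>z\<close> is fixed, since
  the second one depends on \<open>z\<close>. Finally \<open>D\<close> is translated by a rank-one
  matrix to give the quotient \<open>g\<close>.\<close>

lemma nn_integral_eigenvalue_sum:
  fixes F :: "(nat \<times> nat \<Rightarrow> complex) \<Rightarrow> ennreal"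
  assumes F [measurable]: "F \<in> borel_measurable (lb ({0..<Suc n} \<times> {0..<Suc n}))"
  shows "of_nat (Suc n) * (\<integral>\<^sup>+x. F x \<partial>lb ({0..<Suc n} \<times> {0..<Suc n})) =
    (\<integral>\<^sup>+z. \<integral>\<^sup>+v. \<integral>\<^sup>+w. \<integral>\<^sup>+g. ennreal ((cmod (poly (cpf n g) z))\<^sup>2) * F (dfl n z v w g)
        \<partial>lb ({0..<n} \<times> {0..<n}) \<partial>lb {0..<n} \<partial>lb {0..<n} \<partial>lborel)"
proof -
  let ?V = "lb {0..<n}" and ?M = "lb ({0..<n} \<times> {0..<n})"
  have sfV: "sigma_finite_measure ?V" and sfM: "sigma_finite_measure ?M" and sfL: "sigma_finite_measure (lborel :: complex measure)"
    by (auto intro!: sigma_finite_lb lborel.sigma_finite_measure_axioms)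
  interpret V: sigma_finite_measure ?V by (rule sfV)
  interpret M: sigma_finite_measure ?M by (rule sfM)
  define J where "J = (\<lambda>D u w z. ennreal ((cmod (poly (pderiv (cpf (Suc n) (blk n D u w 0)) * cpf n D -
            cpf (Suc n) (blk n D u w 0) * pderiv (cpf n D)) z / (poly (cpf n D) z)\<^sup>2))\<^sup>2) *
          F (blk n D u w (poly (cpf (Suc n) (blk n D u w 0)) z / poly (cpf n D) z)))"
  have J [measurable (raw)]: "(\<lambda>x. J (D x) (u x) (w x) (z x)) \<in> borel_measurable N"
    if [measurable]: "D \<in> measurable N ?M" "u \<in> measurable N ?V" "w \<in> measurable N ?V" "z \<in> borel_measurable N"
    for D u w z and N :: "'z measure"
    unfolding J_def poly_diff poly_mult by measurable
  define E where "E = (\<lambda>z v w g. ennreal ((cmod (poly (cpf n g) z))\<^sup>2) * F (dfl n z v w g))"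
  have E [measurable (raw)]: "(\<lambda>x. E (z x) (v x) (w x) (g x)) \<in> borel_measurable N"
    if [measurable]: "g \<in> measurable N ?M" "v \<in> measurable N ?V" "w \<in> measurable N ?V" "z \<in> borel_measurable N"
    for g v w z and N :: "'z measure"
    unfolding E_def by measurable
  define T where "T = (\<lambda>v w D. (\<lambda>(i, j)\<in>{0..<n} \<times> {0..<n}. - (v i * w j) + D (i, j) :: complex))"
  have T [measurable (raw)]: "(\<lambda>x. T (v x) (w x) (D x)) \<in> measurable N ?M"
    if "D \<in> measurable N ?M" "v \<in> measurable N ?V" "w \<in> measurable N ?V" for D v w and N :: "'z measure"
    unfolding T_def
  proof (rule restrict_measurable_lb)
    fix ij assume "ij \<in> {0..<n} \<times> {0..<n}"
    then obtain i j where ij: "ij = (i, j)" "i < n" "j < n" by auto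
    have [measurable]: "(\<lambda>x. D x (i, j)) \<in> borel_measurable N" "(\<lambda>x. v x i) \<in> borel_measurable N" "(\<lambda>x. w x j) \<in> borel_measurable N"
      using component_measurable[OF that(1), of "(i, j)"] component_measurable[OF that(2), of i]
        component_measurable[OF that(3), of j] ij by auto
    show "(\<lambda>x. case ij of (i, j) \<Rightarrow> - (v x i * w x j) + D x (i, j)) \<in> borel_measurable N"
      unfolding ij(1) prod.case by measurable
  qed
  have "of_nat (Suc n) * (\<integral>\<^sup>+x. F x \<partial>lb ({0..<Suc n} \<times> {0..<Suc n})) =
     of_nat (Suc n) * (\<integral>\<^sup>+D. \<integral>\<^sup>+u. \<integral>\<^sup>+w. \<integral>\<^sup>+a. F (blk n D u w a) \<partial>lborel \<partial>?V \<partial>?V \<partial>?M)"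
    by (subst nn_integral_blk[OF F]) rule
  also have "\<dots> = (\<integral>\<^sup>+D. of_nat (Suc n) * (\<integral>\<^sup>+u. \<integral>\<^sup>+w. \<integral>\<^sup>+a. F (blk n D u w a) \<partial>lborel \<partial>?V \<partial>?V) \<partial>?M)"
    by (rule nn_integral_cmult[symmetric]) measurable
  also have "\<dots> = (\<integral>\<^sup>+D. \<integral>\<^sup>+u. \<integral>\<^sup>+w. \<integral>\<^sup>+z. J D u w z \<partial>lborel \<partial>?V \<partial>?V \<partial>?M)"
  proof (rule nn_integral_cong_AE, rule AE_mp[OF AE_coprime_corner AE_I2], intro impI)
    fix D assume [measurable]: "D \<in> space ?M" and AED: "AE u in ?V. AE w in ?V. \<forall>z. poly (cpf n D) z = 0 \<longrightarrow> poly (cpf (Suc n) (blk n D u w 0)) z \<noteq> 0"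
    have "of_nat (Suc n) * (\<integral>\<^sup>+u. \<integral>\<^sup>+w. \<integral>\<^sup>+a. F (blk n D u w a) \<partial>lborel \<partial>?V \<partial>?V) =
       (\<integral>\<^sup>+u. of_nat (Suc n) * (\<integral>\<^sup>+w. \<integral>\<^sup>+a. F (blk n D u w a) \<partial>lborel \<partial>?V) \<partial>?V)"
      by (rule nn_integral_cmult[symmetric]) measurable
    also have "\<dots> = (\<integral>\<^sup>+u. \<integral>\<^sup>+w. \<integral>\<^sup>+z. J D u w z \<partial>lborel \<partial>?V \<partial>?V)"
    proof (rule nn_integral_cong_AE, rule AE_mp[OF AED AE_I2], intro impI)
      fix u assume [measurable]: "u \<in> space ?V" and AEu: "AE w in ?V. \<forall>z. poly (cpf n D) z = 0 \<longrightarrow> poly (cpf (Suc n) (blk n D u w 0)) z \<noteq> 0"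
      have "of_nat (Suc n) * (\<integral>\<^sup>+w. \<integral>\<^sup>+a. F (blk n D u w a) \<partial>lborel \<partial>?V) =
         (\<integral>\<^sup>+w. of_nat (Suc n) * (\<integral>\<^sup>+a. F (blk n D u w a) \<partial>lborel) \<partial>?V)"
        by (rule nn_integral_cmult[symmetric]) measurable
      also have "\<dots> = (\<integral>\<^sup>+w. \<integral>\<^sup>+z. J D u w z \<partial>lborel \<partial>?V)"
      proof (rule nn_integral_cong_AE, rule AE_mp[OF AEu AE_I2], intro impI)
        fix w assume [measurable]: "w \<in> space ?V" and cop: "\<forall>z. poly (cpf n D) z = 0 \<longrightarrow> poly (cpf (Suc n) (blk n D u w 0)) z \<noteq> 0"
        let ?P = "cpf (Suc n) (blk n D u w 0)" and ?Q = "cpf n D"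
        have "poly ?P z - a * poly ?Q z = poly (cpf (Suc n) (blk n D u w a)) z" for z a
          by (subst (2) cpf_blk) simp
        have "(\<integral>\<^sup>+z. J D u w z \<partial>lborel) = of_nat (Suc n) * (\<integral>\<^sup>+a. F (blk n D u w a) \<partial>lborel)"
          unfolding J_def
          by (rule nn_integral_rational_pushforward[where F = "\<lambda>a. F (blk n D u w a)"])
             (use lead_coeff_cpf degree_cpf cop in \<open>auto\<close>)
        then show "of_nat (Suc n) * (\<integral>\<^sup>+a. F (blk n D u w a) \<partial>lborel) = (\<integral>\<^sup>+z. J D u w z \<partial>lborel)" ..
      qed
      finally show "of_nat (Suc n) * (\<integral>\<^sup>+w. \<integral>\<^sup>+a. F (blk n D u w a) \<partial>lborel \<partial>?V) = (\<integral>\<^sup>+w. \<integral>\<^sup>+z. J D u w z \<partial>lborel \<partial>?V)" .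
    qed
    finally show "of_nat (Suc n) * (\<integral>\<^sup>+u. \<integral>\<^sup>+w. \<integral>\<^sup>+a. F (blk n D u w a) \<partial>lborel \<partial>?V \<partial>?V) = (\<integral>\<^sup>+u. \<integral>\<^sup>+w. \<integral>\<^sup>+z. J D u w z \<partial>lborel \<partial>?V \<partial>?V)" .
  qed
  also have "\<dots> = (\<integral>\<^sup>+D. \<integral>\<^sup>+z. \<integral>\<^sup>+w. \<integral>\<^sup>+v. E z v w (T v w D) \<partial>?V \<partial>?V \<partial>lborel \<partial>?M)"
  proof (rule nn_integral_cong)
    fix D assume D [measurable]: "D \<in> space ?M"
    have "(\<integral>\<^sup>+u. \<integral>\<^sup>+w. \<integral>\<^sup>+z. J D u w z \<partial>lborel \<partial>?V \<partial>?V) = (\<integral>\<^sup>+z. \<integral>\<^sup>+w. \<integral>\<^sup>+u. J D u w z \<partial>?V \<partial>?V \<partial>lborel)"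
      by (rule nn_integral_rev3[OF sfV sfV sfL]) (unfold case_prod_beta', measurable)
    also have "\<dots> = (\<integral>\<^sup>+z. \<integral>\<^sup>+w. \<integral>\<^sup>+v. E z v w (T v w D) \<partial>?V \<partial>?V \<partial>lborel)"
    proof (rule nn_integral_cong_AE)
      have "AE z in lborel. z \<notin> {z. poly (cpf n D) z = 0}"
        using finite_imp_null_set_lborel[OF poly_roots_finite[OF cpf_ne_0]] by (rule AE_not_in)
      then show "AE z in lborel. (\<integral>\<^sup>+w. \<integral>\<^sup>+u. J D u w z \<partial>?V \<partial>?V) = (\<integral>\<^sup>+w. \<integral>\<^sup>+v. E z v w (T v w D) \<partial>?V \<partial>?V)"
      proof eventually_elim
        case (elim z)
        show ?case
        proof (rule nn_integral_cong)
          fix w assume w: "w \<in> space ?V"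
          from elim have Q: "poly (cpf n D) z \<noteq> 0" by simp
          show "(\<integral>\<^sup>+u. J D u w z \<partial>?V) = (\<integral>\<^sup>+v. E z v w (T v w D) \<partial>?V)"
            using nn_integral_deflate_at[OF F D w Q] unfolding J_def E_def T_def Let_def .
        qed
      qed
    qed
    finally show "(\<integral>\<^sup>+u. \<integral>\<^sup>+w. \<integral>\<^sup>+z. J D u w z \<partial>lborel \<partial>?V \<partial>?V) = (\<integral>\<^sup>+z. \<integral>\<^sup>+w. \<integral>\<^sup>+v. E z v w (T v w D) \<partial>?V \<partial>?V \<partial>lborel)" .
  qed
  also have "\<dots> = (\<integral>\<^sup>+z. \<integral>\<^sup>+D. \<integral>\<^sup>+w. \<integral>\<^sup>+v. E z v w (T v w D) \<partial>?V \<partial>?V \<partial>?M \<partial>lborel)"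
    by (rule nn_integral_swap[OF sfM sfL]) (unfold case_prod_beta', measurable)
  also have "\<dots> = (\<integral>\<^sup>+z. \<integral>\<^sup>+v. \<integral>\<^sup>+w. \<integral>\<^sup>+D. E z v w (T v w D) \<partial>?M \<partial>?V \<partial>?V \<partial>lborel)"
    by (rule nn_integral_cong, rule nn_integral_rev3[OF sfM sfV sfV]) (unfold case_prod_beta', measurable)
  also have "\<dots> = (\<integral>\<^sup>+z. \<integral>\<^sup>+v. \<integral>\<^sup>+w. \<integral>\<^sup>+g. E z v w g \<partial>?M \<partial>?V \<partial>?V \<partial>lborel)"
  proof (rule nn_integral_cong, rule nn_integral_cong, rule nn_integral_cong)
    fix z v w assume [measurable]: "v \<in> space ?V" "w \<in> space ?V"
    have m: "E z v w \<in> borel_measurable ?M" by measurable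
    have "T v w D = (\<lambda>ij\<in>{0..<n} \<times> {0..<n}. (case ij of (i, j) \<Rightarrow> - (v i * w j)) + D ij)" for D
      by (auto simp: T_def fun_eq_iff)
    then show "(\<integral>\<^sup>+D. E z v w (T v w D) \<partial>?M) = (\<integral>\<^sup>+g. E z v w g \<partial>?M)"
      using nn_integral_lb_translate[OF _ m, of "\<lambda>(i, j). - (v i * w j)"] by simp
  qed
  finally show ?thesis unfolding E_def .
qed

section \<open>The Gaussian weight\<close>

definition gw :: "nat \<Rightarrow> (nat \<times> nat \<Rightarrow> complex) \<Rightarrow> ennreal" where
  "gw n x = ennreal (exp (- fro (mat n n x)))"

lemma gw_measurable [measurable]: "gw n \<in> borel_measurable (lb ({0..<n} \<times> {0..<n}))"
  unfolding gw_def by measurable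

text \<open>The first factor is the Jacobian of the row substitution integrated over the
  eigenvector, the second the Gaussian mass of the transformed row. Both are taken in
  \<open>ennreal\<close> as they stand, with no claim about their values.\<close>

definition deflation_const :: "nat \<Rightarrow> ennreal" where
  "deflation_const n = (\<integral>\<^sup>+v. ennreal ((cmod (Determinant.det (rowsub n v)))\<^sup>2) \<partial>lb {0..<n}) *
     (\<integral>\<^sup>+t. ennreal (exp (- (\<Sum>j\<in>{0..<n}. (cmod (t j))\<^sup>2))) \<partial>lb {0..<n})"

lemma component_lb_measurable: "j \<in> I \<Longrightarrow> (\<lambda>t. t j) \<in> borel_measurable (lb I)"
  using component_measurable[of "\<lambda>x. x" "lb I" I j] by simp

text \<open>\<open>\<Phi>\<close> sees only the characteristic polynomial, so it is invariant under
  the change of basis and splits off \<open>f z\<close> by \<open>cpf_dfl\<close>. The unitary form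
  separates the Gaussian into parts for \<open>h\<close>, \<open>t\<close> and \<open>z\<close>, and
  the Jacobian involves \<open>v\<close> alone; hence the integrals over \<open>v\<close> and
  \<open>t\<close> come out as constants.\<close>

lemma nn_integral_deflation:
  fixes \<Phi> :: "complex poly \<Rightarrow> ennreal"
  assumes \<Phi>: "\<And>z p. p \<noteq> 0 \<Longrightarrow> \<Phi> ([:- z, 1:] * p) = f z * \<Phi> p"
    and f [measurable]: "f \<in> borel_measurable borel"
    and m1 [measurable]: "(\<lambda>x. \<Phi> (cpf (Suc n) x)) \<in> borel_measurable (lb ({0..<Suc n} \<times> {0..<Suc n}))"
    and m0 [measurable]: "(\<lambda>x. \<Phi> (cpf n x)) \<in> borel_measurable (lb ({0..<n} \<times> {0..<n}))"
  shows "of_nat (Suc n) * (\<integral>\<^sup>+x. \<Phi> (cpf (Suc n) x) * gw (Suc n) x \<partial>lb ({0..<Suc n} \<times> {0..<Suc n})) =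
    deflation_const n * (\<integral>\<^sup>+z. ennreal (exp (- (cmod z)\<^sup>2)) * f z *
      (\<integral>\<^sup>+h. ennreal ((cmod (poly (cpf n h) z))\<^sup>2) * \<Phi> (cpf n h) * gw n h \<partial>lb ({0..<n} \<times> {0..<n})) \<partial>lborel)"
proof -
  let ?V = "lb {0..<n}" and ?M = "lb ({0..<n} \<times> {0..<n})"
  have sfV: "sigma_finite_measure ?V" and sfM: "sigma_finite_measure ?M"
    by (auto intro!: sigma_finite_lb)
  interpret V: sigma_finite_measure ?V by (rule sfV)
  interpret M: sigma_finite_measure ?M by (rule sfM)
  define F where "F = (\<lambda>x. \<Phi> (cpf (Suc n) x) * gw (Suc n) x)"
  have F [measurable]: "F \<in> borel_measurable (lb ({0..<Suc n} \<times> {0..<Suc n}))"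
    unfolding F_def by measurable
  define E where "E = (\<lambda>z v w g. ennreal ((cmod (poly (cpf n g) z))\<^sup>2) * F (dfl n z v w g))"
  have E [measurable (raw)]: "(\<lambda>x. E (z x) (v x) (w x) (g x)) \<in> borel_measurable N"
    if [measurable]: "g \<in> measurable N ?M" "v \<in> measurable N ?V" "w \<in> measurable N ?V" "z \<in> borel_measurable N"
    for g v w z and N :: "'z measure"
    unfolding E_def by measurable
  define k where "k = (\<lambda>v. ennreal ((cmod (Determinant.det (rowsub n v)))\<^sup>2))"
  have k [measurable]: "k \<in> borel_measurable ?V" unfolding k_def by measurable
  define G where "G = (\<lambda>z h. ennreal ((cmod (poly (cpf n h) z))\<^sup>2) * \<Phi> (cpf n h) * gw n h)"
  have G [measurable (raw)]: "(\<lambda>x. G (z x) (g x)) \<in> borel_measurable N"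
    if [measurable]: "g \<in> measurable N ?M" "z \<in> borel_measurable N"
    for g z and N :: "'z measure"
  proof -
    have [measurable]: "(\<lambda>x. \<Phi> (cpf n (g x))) \<in> borel_measurable N"
      using measurable_compose[OF that(1) m0] .
    show ?thesis unfolding G_def by measurable
  qed
  define T where "T = (\<lambda>t. ennreal (exp (- (\<Sum>j\<in>{0..<n}. (cmod (t j))\<^sup>2))))"
  have T [measurable]: "T \<in> borel_measurable ?V" unfolding T_def by measurable
  define X where "X = (\<lambda>z. ennreal (exp (- (cmod z)\<^sup>2)) * f z * (\<integral>\<^sup>+h. G z h \<partial>?M))"
  have X [measurable]: "X \<in> borel_measurable borel" unfolding X_def by measurable
  have "of_nat (Suc n) * (\<integral>\<^sup>+x. F x \<partial>lb ({0..<Suc n} \<times> {0..<Suc n})) =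
     (\<integral>\<^sup>+z. \<integral>\<^sup>+v. \<integral>\<^sup>+w. \<integral>\<^sup>+g. E z v w g \<partial>?M \<partial>?V \<partial>?V \<partial>lborel)"
    unfolding E_def by (rule nn_integral_eigenvalue_sum[OF F])
  also have "\<dots> = (\<integral>\<^sup>+z. \<integral>\<^sup>+v. k v * ((\<integral>\<^sup>+t. T t \<partial>?V) * X z) \<partial>?V \<partial>lborel)"
  proof (rule nn_integral_cong, rule nn_integral_cong)
    fix z v assume [measurable]: "v \<in> space ?V"
    define e where "e = (\<lambda>h i. (\<Sum>k\<in>{0..<n}. - cnj (v k) * h (k, i)) + z * cnj (v i))"
    define c where "c = (\<lambda>h. (\<lambda>ij\<in>{0..<n} \<times> {0..<n}. (hhb n v * mat n n h * hhc n v) $$ ij))"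
    have "(\<integral>\<^sup>+w. \<integral>\<^sup>+g. E z v w g \<partial>?M \<partial>?V) = (\<integral>\<^sup>+g. \<integral>\<^sup>+w. E z v w g \<partial>?V \<partial>?M)"
      by (rule nn_integral_swap[OF sfV sfM]) measurable
    \<comment> \<open>Conjugation by \<open>hhb\<close> preserves the measure on the entries, so the
      quotient \<open>g\<close> may be replaced by its conjugate \<open>c h\<close>.\<close>
    also have "\<dots> = (\<integral>\<^sup>+h. \<integral>\<^sup>+w. E z v w (c h) \<partial>?V \<partial>?M)"
      unfolding c_def
      by (rule nn_integral_conjugate[OF hhb_carrier hhc_carrier hhb_hhc, symmetric]) measurable
    also have "\<dots> = (\<integral>\<^sup>+h. k v * ((\<integral>\<^sup>+t. T t \<partial>?V) * (ennreal (exp (- (cmod z)\<^sup>2)) * f z * G z h)) \<partial>?M)"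
    proof (rule nn_integral_cong)
      fix h assume [measurable]: "h \<in> space ?M"
      have [measurable]: "c h \<in> space ?M" by (auto simp: c_def space_PiM)
      have m: "(\<lambda>w. E z v w (c h)) \<in> borel_measurable ?V" by measurable
      have m': "(\<lambda>t. E z v (mvf n (rowsub n v) t) (c h)) \<in> borel_measurable ?V" by measurable
      have "(\<integral>\<^sup>+w. E z v w (c h) \<partial>?V) = (\<integral>\<^sup>+t. k v * E z v (mvf n (rowsub n v) t) (c h) \<partial>?V)"
        unfolding k_def by (rule nn_integral_linear[OF rowsub_carrier det_rowsub m, symmetric])
      also have "\<dots> = k v * (\<integral>\<^sup>+t. E z v (mvf n (rowsub n v) t) (c h) \<partial>?V)"
        by (rule nn_integral_cmult[OF m'])
      also have "(\<integral>\<^sup>+t. E z v (mvf n (rowsub n v) t) (c h) \<partial>?V) =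
          (\<integral>\<^sup>+t. E z v (mvf n (rowsub n v) (\<lambda>i\<in>{0..<n}. e h i + t i)) (c h) \<partial>?V)"
        by (rule nn_integral_lb_translate[OF _ m', symmetric]) simp
      also have "\<dots> = (\<integral>\<^sup>+t. T t * (ennreal (exp (- (cmod z)\<^sup>2)) * f z * G z h) \<partial>?V)"
      proof (rule nn_integral_cong)
        fix t
        let ?w = "mvf n (rowsub n v) (\<lambda>i\<in>{0..<n}. e h i + t i)"
        have u: "cpf n (c h) = cpf n h" unfolding c_def by (rule fro_dfl_unitary(2))
        have "gw (Suc n) (dfl n z v ?w (c h)) = gw n h * T t * ennreal (exp (- (cmod z)\<^sup>2))"
          unfolding gw_def T_def c_def e_def fro_dfl_unitary(1) by (simp add: exp_add exp_diff ennreal_mult divide_inverse exp_minus)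
        then have "E z v ?w (c h) = ennreal ((cmod (poly (cpf n h) z))\<^sup>2) * (f z * \<Phi> (cpf n h) * (gw n h * T t * ennreal (exp (- (cmod z)\<^sup>2))))"
          unfolding E_def F_def cpf_dfl u by (simp only: \<Phi>[OF cpf_ne_0])
        then show "E z v ?w (c h) = T t * (ennreal (exp (- (cmod z)\<^sup>2)) * f z * G z h)"
          by (simp only: G_def mult_ac)
      qed
      also have "\<dots> = (\<integral>\<^sup>+t. T t \<partial>?V) * (ennreal (exp (- (cmod z)\<^sup>2)) * f z * G z h)"
        by (rule nn_integral_multc[OF T])
      finally show "(\<integral>\<^sup>+w. E z v w (c h) \<partial>?V) = k v * ((\<integral>\<^sup>+t. T t \<partial>?V) * (ennreal (exp (- (cmod z)\<^sup>2)) * f z * G z h))" .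
    qed
    also have "\<dots> = k v * ((\<integral>\<^sup>+t. T t \<partial>?V) * X z)"
      unfolding X_def by (simp add: nn_integral_cmult)
    finally show "(\<integral>\<^sup>+w. \<integral>\<^sup>+g. E z v w g \<partial>?M \<partial>?V) = k v * ((\<integral>\<^sup>+t. T t \<partial>?V) * X z)" .
  qed
  also have "\<dots> = (\<integral>\<^sup>+z. (\<integral>\<^sup>+v. k v \<partial>?V) * ((\<integral>\<^sup>+t. T t \<partial>?V) * X z) \<partial>lborel)"
    by (intro nn_integral_cong nn_integral_multc k)
  also have "\<dots> = (\<integral>\<^sup>+v. k v \<partial>?V) * ((\<integral>\<^sup>+t. T t \<partial>?V) * (\<integral>\<^sup>+z. X z \<partial>lborel))"
    by (simp add: nn_integral_cmult)
  also have "\<dots> = deflation_const n * (\<integral>\<^sup>+z. X z \<partial>lborel)"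
    by (simp only: deflation_const_def k_def T_def mult.assoc)
  finally show ?thesis unfolding F_def X_def G_def .
qed

text \<open>Multiplicativity over the roots, \<open>f\<close> being the contribution of one root.
  Measurability is demanded for every size because the induction passes through all smaller matrices
  with weights built from this one.\<close>

definition spectral_weight :: "(complex poly \<Rightarrow> ennreal) \<Rightarrow> (complex \<Rightarrow> ennreal) \<Rightarrow> bool" where
  "spectral_weight \<Phi> f \<longleftrightarrow> \<Phi> 1 = 1 \<and> (\<forall>z p. p \<noteq> 0 \<longrightarrow> \<Phi> ([:- z, 1:] * p) = f z * \<Phi> p) \<and>
     f \<in> borel_measurable borel \<and> (\<forall>n. (\<lambda>x. \<Phi> (cpf n x)) \<in> borel_measurable (lb ({0..<n} \<times> {0..<n})))"

text \<open>This closure property makes the induction run: the factor \<open>|p(z)|^2\<close> left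
  by a deflation is absorbed into the weight, where it becomes the interaction of each remaining
  root with \<open>z\<close>.\<close>

lemma spectral_weight_times_root:
  assumes "spectral_weight \<Phi> f"
  shows "spectral_weight (\<lambda>p. ennreal ((cmod (poly p z))\<^sup>2) * \<Phi> p) (\<lambda>x. ennreal ((cmod (x - z))\<^sup>2) * f x)"
  unfolding spectral_weight_def
proof (intro conjI allI impI)
  note s = assms[unfolded spectral_weight_def]
  show "ennreal ((cmod (poly 1 z))\<^sup>2) * \<Phi> 1 = 1" using s by simp
  have [measurable]: "f \<in> borel_measurable borel" using s by simp
  show "(\<lambda>x. ennreal ((cmod (x - z))\<^sup>2) * f x) \<in> borel_measurable borel" by measurable
  fix n
  have [measurable]: "(\<lambda>x. \<Phi> (cpf n x)) \<in> borel_measurable (lb ({0..<n} \<times> {0..<n}))" using s by simp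
  show "(\<lambda>x. ennreal ((cmod (poly (cpf n x) z))\<^sup>2) * \<Phi> (cpf n x)) \<in> borel_measurable (lb ({0..<n} \<times> {0..<n}))" by measurable
next
  note s = assms[unfolded spectral_weight_def]
  fix x :: complex and p :: "complex poly" assume "p \<noteq> 0"
  then have "\<Phi> ([:- x, 1:] * p) = f x * \<Phi> p" using s by blast
  moreover have "cmod (poly ([:- x, 1:] * p) z) = cmod (x - z) * cmod (poly p z)"
    by (simp add: norm_minus_commute algebra_simps flip: norm_mult)
  ultimately show "ennreal ((cmod (poly ([:- x, 1:] * p) z))\<^sup>2) * \<Phi> ([:- x, 1:] * p) =
      ennreal ((cmod (x - z))\<^sup>2) * f x * (ennreal ((cmod (poly p z))\<^sup>2) * \<Phi> p)"
    by (simp only: power_mult_distrib ennreal_mult zero_le_power2 mult_ac)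
qed

text \<open>The factor \<open>1 / real (Suc n)\<close> undoes the counting of a matrix once per
  eigenvalue.\<close>

primrec ginibre_const :: "nat \<Rightarrow> ennreal" where
  "ginibre_const 0 = 1"
| "ginibre_const (Suc n) = ennreal (1 / real (Suc n)) * (deflation_const n * ginibre_const n)"

text \<open>Every deflation contributes the squared distances from the root it splits off to all
  roots that remain. Over all steps these assemble to the squared modulus of the Vandermonde
  product, which is why the induction varies \<open>\<Phi>\<close> and \<open>f\<close>.\<close>

lemma ginibre_eigenvalues:
  assumes "spectral_weight \<Phi> f"
  shows "(\<integral>\<^sup>+x. \<Phi> (cpf n x) * gw n x \<partial>lb ({0..<n} \<times> {0..<n})) =
    ginibre_const n * (\<integral>\<^sup>+y. (\<Prod>i\<in>{0..<n}. f (y i) * ennreal (exp (- (cmod (y i))\<^sup>2))) *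
      (\<Prod>i\<in>{0..<n}. \<Prod>j\<in>{0..<i}. ennreal ((cmod (y i - y j))\<^sup>2)) \<partial>lb {0..<n})"
  using assms
proof (induction n arbitrary: \<Phi> f)
  case 0
  have "cpf 0 x = 1" for x :: "nat \<times> nat \<Rightarrow> complex"
    unfolding char_poly_def by (rule det_dim_zero) simp
  moreover have "gw 0 x = 1" for x by (simp add: gw_def fro_def)
  ultimately show ?case
    using 0 by (simp add: spectral_weight_def lb.nn_integral_empty space_PiM)
next
  case (Suc n)
  note s = Suc.prems[unfolded spectral_weight_def]
  have f [measurable]: "f \<in> borel_measurable borel" using s by simp
  have \<Phi>: "\<Phi> ([:- z, 1:] * p) = f z * \<Phi> p" if "p \<noteq> 0" for z p using s that by blast
  define V where "V = (\<lambda>n (y :: nat \<Rightarrow> complex). (\<Prod>i\<in>{0..<n}. f (y i) * ennreal (exp (- (cmod (y i))\<^sup>2))) *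
      (\<Prod>i\<in>{0..<n}. \<Prod>j\<in>{0..<i}. ennreal ((cmod (y i - y j))\<^sup>2)))"
  have V [measurable]: "V n \<in> borel_measurable (lb {0..<n})" for n
    unfolding V_def
  proof (intro borel_measurable_times_ennreal borel_measurable_prod_ennreal)
    fix i j assume ij: "i \<in> {0..<n}" "j \<in> {0..<i}"
    then have [measurable]: "(\<lambda>y. y i) \<in> borel_measurable (lb {0..<n})" "(\<lambda>y. y j) \<in> borel_measurable (lb {0..<n})"
      by (auto intro!: component_lb_measurable)
    show "(\<lambda>y. ennreal ((cmod (y i - y j))\<^sup>2)) \<in> borel_measurable (lb {0..<n})" by measurable
  qed auto
  \<comment> \<open>The root split off takes the index n; its interactions are distributed over the
    one-point weights of the others, in the form produced by
    \<open>spectral_weight_times_root\<close>.\<close>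
  have VSuc: "V (Suc n) (y(n := z)) = ennreal (exp (- (cmod z)\<^sup>2)) * f z *
     ((\<Prod>i\<in>{0..<n}. ennreal ((cmod (y i - z))\<^sup>2) * f (y i) * ennreal (exp (- (cmod (y i))\<^sup>2))) *
      (\<Prod>i\<in>{0..<n}. \<Prod>j\<in>{0..<i}. ennreal ((cmod (y i - y j))\<^sup>2)))" for y z
  proof -
    have "(\<Prod>i\<in>{0..<n}. \<Prod>j\<in>{0..<i}. ennreal ((cmod ((y(n := z)) i - (y(n := z)) j))\<^sup>2)) =
       (\<Prod>i\<in>{0..<n}. \<Prod>j\<in>{0..<i}. ennreal ((cmod (y i - y j))\<^sup>2))"
      by (intro prod.cong) auto
    moreover have "(\<Prod>j\<in>{0..<n}. ennreal ((cmod (z - (y(n := z)) j))\<^sup>2)) = (\<Prod>j\<in>{0..<n}. ennreal ((cmod (y j - z))\<^sup>2))"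
      by (intro prod.cong) (auto simp: norm_minus_commute)
    moreover have "(\<Prod>i\<in>{0..<n}. f ((y(n := z)) i) * ennreal (exp (- (cmod ((y(n := z)) i))\<^sup>2))) =
       (\<Prod>i\<in>{0..<n}. f (y i) * ennreal (exp (- (cmod (y i))\<^sup>2)))"
      by (intro prod.cong) auto
    ultimately show ?thesis
      unfolding V_def by (simp only: prod.atLeast0_lessThan_Suc fun_upd_same prod.distrib mult_ac)
  qed
  have "of_nat (Suc n) * (\<integral>\<^sup>+x. \<Phi> (cpf (Suc n) x) * gw (Suc n) x \<partial>lb ({0..<Suc n} \<times> {0..<Suc n})) =
    deflation_const n * (\<integral>\<^sup>+z. ennreal (exp (- (cmod z)\<^sup>2)) * f z *
      (\<integral>\<^sup>+h. ennreal ((cmod (poly (cpf n h) z))\<^sup>2) * \<Phi> (cpf n h) * gw n h \<partial>lb ({0..<n} \<times> {0..<n})) \<partial>lborel)"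
    using s by (intro nn_integral_deflation) auto
  also have "\<dots> = deflation_const n * (\<integral>\<^sup>+z. ginibre_const n * (\<integral>\<^sup>+y. V (Suc n) (y(n := z)) \<partial>lb {0..<n}) \<partial>lborel)"
  proof (intro arg_cong[of _ _ "(*) (deflation_const n)"] nn_integral_cong)
    fix z :: complex
    let ?g = "\<lambda>x. ennreal ((cmod (x - z))\<^sup>2) * f x"
    let ?R = "\<lambda>y. (\<Prod>i\<in>{0..<n}. ?g (y i) * ennreal (exp (- (cmod (y i))\<^sup>2))) *
          (\<Prod>i\<in>{0..<n}. \<Prod>j\<in>{0..<i}. ennreal ((cmod (y i - y j))\<^sup>2))"
    have R: "?R \<in> borel_measurable (lb {0..<n})"
    proof (intro borel_measurable_times_ennreal borel_measurable_prod_ennreal)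
      fix i j assume ij: "i \<in> {0..<n}" "j \<in> {0..<i}"
      then have [measurable]: "(\<lambda>y. y i) \<in> borel_measurable (lb {0..<n})" "(\<lambda>y. y j) \<in> borel_measurable (lb {0..<n})"
        by (auto intro!: component_lb_measurable)
      show "(\<lambda>y. ennreal ((cmod (y i - y j))\<^sup>2)) \<in> borel_measurable (lb {0..<n})" by measurable
    qed auto
    have "(\<integral>\<^sup>+h. ennreal ((cmod (poly (cpf n h) z))\<^sup>2) * \<Phi> (cpf n h) * gw n h \<partial>lb ({0..<n} \<times> {0..<n})) =
      ginibre_const n * (\<integral>\<^sup>+y. ?R y \<partial>lb {0..<n})"
      by (rule Suc.IH[OF spectral_weight_times_root[OF Suc.prems]])
    then have "ennreal (exp (- (cmod z)\<^sup>2)) * f z *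
      (\<integral>\<^sup>+h. ennreal ((cmod (poly (cpf n h) z))\<^sup>2) * \<Phi> (cpf n h) * gw n h \<partial>lb ({0..<n} \<times> {0..<n})) =
      ginibre_const n * (ennreal (exp (- (cmod z)\<^sup>2)) * f z * (\<integral>\<^sup>+y. ?R y \<partial>lb {0..<n}))"
      by (simp only: mult_ac)
    also have "ennreal (exp (- (cmod z)\<^sup>2)) * f z * (\<integral>\<^sup>+y. ?R y \<partial>lb {0..<n}) = (\<integral>\<^sup>+y. V (Suc n) (y(n := z)) \<partial>lb {0..<n})"
      unfolding VSuc by (rule nn_integral_cmult[OF R, symmetric])
    finally show "ennreal (exp (- (cmod z)\<^sup>2)) * f z *
      (\<integral>\<^sup>+h. ennreal ((cmod (poly (cpf n h) z))\<^sup>2) * \<Phi> (cpf n h) * gw n h \<partial>lb ({0..<n} \<times> {0..<n})) =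
      ginibre_const n * (\<integral>\<^sup>+y. V (Suc n) (y(n := z)) \<partial>lb {0..<n})" .
  qed
  also have "(\<integral>\<^sup>+z. ginibre_const n * (\<integral>\<^sup>+y. V (Suc n) (y(n := z)) \<partial>lb {0..<n}) \<partial>lborel) =
     ginibre_const n * (\<integral>\<^sup>+z. \<integral>\<^sup>+y. V (Suc n) (y(n := z)) \<partial>lb {0..<n} \<partial>lborel)"
  proof (rule nn_integral_cmult)
    interpret sigma_finite_measure "lb {0..<n}" by (rule sigma_finite_lb) simp
    show "(\<lambda>z. \<integral>\<^sup>+y. V (Suc n) (y(n := z)) \<partial>lb {0..<n}) \<in> borel_measurable lborel" by measurable
  qed
  also have "(\<integral>\<^sup>+z. \<integral>\<^sup>+y. V (Suc n) (y(n := z)) \<partial>lb {0..<n} \<partial>lborel) = (\<integral>\<^sup>+y. V (Suc n) y \<partial>lb {0..<Suc n})"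
    by (rule nn_integral_lb_Suc(2)[OF V, symmetric])
  finally have eq: "of_nat (Suc n) * (\<integral>\<^sup>+x. \<Phi> (cpf (Suc n) x) * gw (Suc n) x \<partial>lb ({0..<Suc n} \<times> {0..<Suc n})) =
     deflation_const n * (ginibre_const n * (\<integral>\<^sup>+y. V (Suc n) y \<partial>lb {0..<Suc n}))" .
  have one: "ennreal (1 / real (Suc n)) * of_nat (Suc n) = 1"
    by (simp add: ennreal_of_nat_eq_real_of_nat flip: ennreal_mult del: of_nat_Suc)
  from arg_cong[OF eq, of "(*) (ennreal (1 / real (Suc n)))"]
  show ?case
    unfolding V_def mult.assoc[symmetric] one ginibre_const.simps by (simp only: mult_1)
qed

section \<open>Vandermonde determinants with radial weights\<close>

text \<open>
  Passing from the powers \<open>1, x, x\<^sup>2, \<dots>\<close> to the Newton basis \<open>\<Prod>\<^sub>k\<^sub><\<^sub>j (x - y\<^sub>k)\<close> is a unitriangular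
  column operation that makes the Vandermonde matrix lower triangular.
\<close>

lemma det_vandermonde:
  fixes y :: "nat \<Rightarrow> complex"
  shows "Determinant.det (mat n n (\<lambda>(i, j). y i ^ j)) = (\<Prod>i\<in>{0..<n}. \<Prod>j\<in>{0..<i}. y i - y j)"
proof -
  define p where "p = (\<lambda>j. \<Prod>k\<in>{0..<j}. [:- y k, 1:])"
  have dp: "degree (p j) = j" and lp: "coeff (p j) j = 1" for j
  proof -
    have "degree (p j) = j \<and> lead_coeff (p j) = 1"
      unfolding p_def
    proof (induction j)
      case (Suc j)
      let ?q = "\<Prod>k\<in>{0..<j}. [:- y k, 1:]"
      have "?q \<noteq> 0" using Suc by auto
      then have d: "degree (?q * [:- y j, 1:]) = degree ?q + degree [:- y j, 1:]"
        by (intro degree_mult_eq) auto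
      have "lead_coeff (?q * [:- y j, 1:]) = lead_coeff ?q * lead_coeff [:- y j, 1:]"
        by (rule lead_coeff_mult)
      moreover have "degree (?q * [:- y j, 1:]) = Suc j" unfolding d using Suc by simp
      ultimately have "degree (?q * [:- y j, 1:]) = Suc j \<and> lead_coeff (?q * [:- y j, 1:]) = 1"
        using Suc by (auto simp del: mult_pCons_right mult_pCons_left)
      then show ?case unfolding prod.atLeast0_lessThan_Suc .
    qed auto
    then show "degree (p j) = j" "coeff (p j) j = 1" by auto
  qed
  have pp: "poly (p j) x = (\<Prod>k\<in>{0..<j}. x - y k)" for j x
    by (simp add: p_def poly_prod)
  define V where "V = mat n n (\<lambda>(i, j). y i ^ j)"
  define U where "U = mat n n (\<lambda>(k, j). coeff (p j) k)"
  define W where "W = mat n n (\<lambda>(i, j). poly (p j) (y i))"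
  have VU: "V * U = W"
  proof (rule eq_matI)
    fix i j assume "i < dim_row W" "j < dim_col W"
    then have ij: "i < n" "j < n" by (auto simp: W_def)
    have "(V * U) $$ (i, j) = (\<Sum>k\<in>{0..<n}. y i ^ k * coeff (p j) k)"
      using ij by (simp add: V_def U_def scalar_prod_def)
    also have "\<dots> = (\<Sum>k\<le>j. y i ^ k * coeff (p j) k)"
      using ij dp by (intro sum.mono_neutral_right) (auto simp: coeff_eq_0)
    also have "\<dots> = poly (p j) (y i)"
      by (simp add: poly_altdef dp mult.commute)
    finally show "(V * U) $$ (i, j) = W $$ (i, j)" using ij by (simp add: W_def)
  qed (auto simp: V_def U_def W_def)
  have "Determinant.det U = prod_list (diag_mat U)"
    using dp by (intro det_upper_triangular[of _ n]) (auto simp: U_def upper_triangular_def coeff_eq_0)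
  also have "diag_mat U = map (\<lambda>_. 1) [0..<n]"
    by (auto simp: diag_mat_def U_def lp)
  also have "prod_list \<dots> = 1" by (induction n) auto
  finally have detU: "Determinant.det U = 1" .
  have "Determinant.det W = prod_list (diag_mat W)"
  proof (rule det_lower_triangular[of n])
    fix i j assume "i < j" "j < n"
    then show "W $$ (i, j) = 0" by (auto simp: W_def pp intro!: prod_zero bexI[of _ i])
  qed (simp add: W_def)
  also have "diag_mat W = map (\<lambda>i. \<Prod>j\<in>{0..<i}. y i - y j) [0..<n]"
    by (auto simp: diag_mat_def W_def pp)
  also have "prod_list \<dots> = (\<Prod>i\<in>{0..<n}. \<Prod>j\<in>{0..<i}. y i - y j)"
    by (induction n) (auto simp: mult.commute)
  finally have "Determinant.det W = (\<Prod>i\<in>{0..<n}. \<Prod>j\<in>{0..<i}. y i - y j)" .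
  moreover have "Determinant.det W = Determinant.det V * Determinant.det U"
    unfolding VU[symmetric] by (rule det_mult[of _ n]) (auto simp: V_def U_def)
  ultimately show ?thesis by (simp add: detU V_def)
qed

lemma distr_lborel_rotate:
  assumes "cmod w = 1"
  shows "distr lborel borel ((*) w) = (lborel :: complex measure)"
proof (rule measure_eqI)
  fix X assume "X \<in> sets (distr lborel borel ((*) w))"
  then have X [measurable]: "X \<in> sets borel" by simp
  have w: "w \<noteq> 0" using assms by auto
  have "emeasure (distr lborel borel ((*) w)) X = (\<integral>\<^sup>+x. indicator X x \<partial>distr lborel borel ((*) w))"
    by simp
  also have "\<dots> = (\<integral>\<^sup>+x. indicator X (w * x) \<partial>lborel)"
    by (rule nn_integral_distr) auto
  also have "\<dots> = (\<integral>\<^sup>+x. ennreal ((cmod w)\<^sup>2) * indicator X (w * x) \<partial>lborel)" by (simp add: assms)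
  also have "\<dots> = (\<integral>\<^sup>+x. indicator X x \<partial>lborel)"
    by (rule nn_integral_complex_cmult[OF w]) simp
  finally show "emeasure (distr lborel borel ((*) w)) X = emeasure lborel X" by simp
qed simp

lemma integral_radial_monomial:
  fixes g :: "complex \<Rightarrow> real"
  assumes [measurable]: "g \<in> borel_measurable borel" and rad: "\<And>z w. cmod w = 1 \<Longrightarrow> g (w * z) = g z"
    and ab: "a \<noteq> b"
  shows "(\<integral>z. of_real (g z) * (z ^ a * cnj z ^ b) \<partial>lborel) = 0"
proof -
  \<comment> \<open>With this angle \<open>w ^ a * cnj w ^ b = cis pi = -1\<close>, so the rotation
    turns the integral into its own negative.\<close>
  define \<theta> where "\<theta> = pi / (real a - real b)"
  define w where "w = cis \<theta>"
  define f where "f = (\<lambda>z. of_real (g z) * (z ^ a * cnj z ^ b))"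
  have [measurable]: "cnj \<in> borel_measurable borel"
    by (intro borel_measurable_continuous_onI continuous_intros)
  have [measurable]: "f \<in> borel_measurable borel" unfolding f_def by measurable
  have w: "cmod w = 1" by (simp add: w_def)
  have "w ^ a * cnj w ^ b = cis (real a * \<theta> - real b * \<theta>)"
    by (simp add: w_def cis_cnj Complex.DeMoivre cis_mult)
  also have "real a * \<theta> - real b * \<theta> = (real a - real b) * \<theta>"
    by (rule left_diff_distrib[symmetric])
  also have "\<dots> = pi" using ab by (simp add: \<theta>_def)
  finally have wab: "w ^ a * cnj w ^ b = -1" by simp
  have "(\<integral>z. f z \<partial>lborel) = (\<integral>z. f z \<partial>distr lborel borel ((*) w))"
    by (simp add: distr_lborel_rotate[OF w])
  also have "\<dots> = (\<integral>z. f (w * z) \<partial>lborel)"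
    by (rule integral_distr) auto
  also have "(\<lambda>z. f (w * z)) = (\<lambda>z. (w ^ a * cnj w ^ b) * f z)"
    by (auto simp: f_def rad[OF w] power_mult_distrib)
  also have "(\<integral>z. (w ^ a * cnj w ^ b) * f z \<partial>lborel) = - (\<integral>z. f z \<partial>lborel)"
    by (simp add: wab)
  finally show ?thesis by (simp add: f_def)
qed

text \<open>The squared Vandermonde expands into a double sum over permutations
  \<open>\<sigma>\<close> and \<open>\<tau>\<close>. Each term is a product of one-variable
  integrals of \<open>z ^ \<sigma> i * cnj z ^ \<tau> i\<close>, and orthogonality leaves only
  \<open>\<sigma> = \<tau>\<close>. The n! diagonal terms have sign 1 and all equal the product of
  the radial moments.\<close>

lemma nn_integral_vandermonde_radial:
  fixes g :: "complex \<Rightarrow> real"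
  assumes [measurable]: "g \<in> borel_measurable borel" and rad: "\<And>z w. cmod w = 1 \<Longrightarrow> g (w * z) = g z"
    and nonneg: "\<And>z. g z \<ge> 0" and int: "\<And>k. integrable lborel (\<lambda>z. g z * cmod z ^ k)"
  shows "(\<integral>\<^sup>+y. (\<Prod>i\<in>{0..<n}. ennreal (g (y i))) * (\<Prod>i\<in>{0..<n}. \<Prod>j\<in>{0..<i}. ennreal ((cmod (y i - y j))\<^sup>2)) \<partial>lb {0..<n}) =
    ennreal (fact n * (\<Prod>k\<in>{0..<n}. \<integral>z. g z * cmod z ^ (2 * k) \<partial>lborel))"
proof -
  define h where "h = (\<lambda>k. \<integral>z. g z * cmod z ^ (2 * k) \<partial>lborel)"
  let ?S = "{\<sigma>. \<sigma> permutes {0..<n}}"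
  have finS: "finite ?S" by (simp add: finite_permutations)
  have [measurable]: "cnj \<in> borel_measurable borel"
    by (intro borel_measurable_continuous_onI continuous_intros)
  have int1: "integrable lborel (\<lambda>z. of_real (g z) * (z ^ a * cnj z ^ b))" for a b :: nat
    by (rule Bochner_Integration.integrable_bound[OF int[of "a + b"]])
       (auto simp: norm_mult norm_power power_add nonneg)
  have int2: "(\<integral>z. of_real (g z) * (z ^ a * cnj z ^ b) \<partial>lborel) = (if a = b then of_real (h a) else 0)" for a b :: nat
  proof (cases "a = b")
    case True
    have "(\<integral>z. of_real (g z) * (z ^ a * cnj z ^ a) \<partial>lborel) = (\<integral>z. complex_of_real (g z * cmod z ^ (2 * a)) \<partial>lborel)"
      by (intro Bochner_Integration.integral_cong refl)
         (simp add: power_mult flip: power_mult_distrib complex_norm_square)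
    also have "\<dots> = of_real (h a)" unfolding h_def by (rule integral_complex_of_real)
    finally show ?thesis using True by simp
  next
    case False
    then show ?thesis using integral_radial_monomial[of g a b] rad by simp
  qed
  define c where "c = (\<lambda>\<sigma> \<tau> (y :: nat \<Rightarrow> complex). \<Prod>i\<in>{0..<n}. of_real (g (y i)) * (y i ^ \<sigma> i * cnj (y i) ^ \<tau> i))"
  have intc: "integrable (lb {0..<n}) (c \<sigma> \<tau>)" for \<sigma> \<tau>
    unfolding c_def by (rule lb.product_integrable_prod) (auto intro: int1)
  have valc: "(\<integral>y. c \<sigma> \<tau> y \<partial>lb {0..<n}) = (if \<sigma> = \<tau> then of_real (\<Prod>k\<in>{0..<n}. h k) else 0)"
    if \<sigma>: "\<sigma> permutes {0..<n}" and \<tau>: "\<tau> permutes {0..<n}" for \<sigma> \<tau>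
  proof -
    have "(\<integral>y. c \<sigma> \<tau> y \<partial>lb {0..<n}) = (\<Prod>i\<in>{0..<n}. \<integral>z. of_real (g z) * (z ^ \<sigma> i * cnj z ^ \<tau> i) \<partial>lborel)"
      unfolding c_def by (rule lb.product_integral_prod) (auto intro: int1)
    also have "\<dots> = (\<Prod>i\<in>{0..<n}. if \<sigma> i = \<tau> i then of_real (h (\<sigma> i)) else 0)" by (simp only: int2)
    also have "\<dots> = (if \<sigma> = \<tau> then of_real (\<Prod>k\<in>{0..<n}. h k) else 0)"
    proof (cases "\<sigma> = \<tau>")
      case True
      have "(\<Prod>i\<in>{0..<n}. complex_of_real (h (\<sigma> i))) = (\<Prod>k\<in>{0..<n}. complex_of_real (h k))"
        using prod.permute[OF \<sigma>, of "\<lambda>k. complex_of_real (h k)"] by (simp add: o_def)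
      then show ?thesis using True by simp
    next
      case False
      then obtain i where "\<sigma> i \<noteq> \<tau> i" by auto
      moreover from this have "i \<in> {0..<n}"
        using \<sigma> \<tau> by (metis permutes_not_in)
      ultimately have "(\<Prod>i\<in>{0..<n}. if \<sigma> i = \<tau> i then complex_of_real (h (\<sigma> i)) else 0) = 0"
        by (intro prod_zero) auto
      then show ?thesis using False by simp
    qed
    finally show ?thesis .
  qed
  define R where "R = (\<lambda>y. (\<Prod>i\<in>{0..<n}. g (y i)) * (cmod (\<Prod>i\<in>{0..<n}. \<Prod>j\<in>{0..<i}. y i - y j))\<^sup>2)"
  have R: "complex_of_real (R y) = (\<Sum>\<sigma>\<in>?S. \<Sum>\<tau>\<in>?S. of_int (sign \<sigma>) * of_int (sign \<tau>) * c \<sigma> \<tau> y)" for y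
  proof -
    have V: "(\<Prod>i\<in>{0..<n}. \<Prod>j\<in>{0..<i}. y i - y j) = (\<Sum>\<sigma>\<in>?S. of_int (sign \<sigma>) * (\<Prod>i\<in>{0..<n}. y i ^ \<sigma> i))"
      unfolding det_vandermonde[symmetric] det_def'[OF mat_carrier]
    proof (intro sum.cong refl arg_cong2[of _ _ _ _ "(*)"] prod.cong)
      fix \<sigma> i assume "\<sigma> \<in> ?S" "i \<in> {0..<n}"
      then show "mat n n (\<lambda>(i, j). y i ^ j) $$ (i, \<sigma> i) = y i ^ \<sigma> i"
        using permutes_in_image[of \<sigma> "{0..<n}" i] by auto
    qed
    have "complex_of_real (R y) = (\<Prod>i\<in>{0..<n}. of_real (g (y i))) *
        ((\<Sum>\<sigma>\<in>?S. of_int (sign \<sigma>) * (\<Prod>i\<in>{0..<n}. y i ^ \<sigma> i)) * cnj (\<Sum>\<tau>\<in>?S. of_int (sign \<tau>) * (\<Prod>i\<in>{0..<n}. y i ^ \<tau> i)))"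
      unfolding R_def V of_real_mult complex_norm_square by simp
    also have "\<dots> = (\<Sum>\<sigma>\<in>?S. \<Sum>\<tau>\<in>?S. of_int (sign \<sigma>) * of_int (sign \<tau>) *
        ((\<Prod>i\<in>{0..<n}. of_real (g (y i))) * ((\<Prod>i\<in>{0..<n}. y i ^ \<sigma> i) * (\<Prod>i\<in>{0..<n}. cnj (y i) ^ \<tau> i))))"
      unfolding cnj_sum sum_product by (simp add: sum_distrib_left cnj_prod mult_ac)
    also have "\<dots> = (\<Sum>\<sigma>\<in>?S. \<Sum>\<tau>\<in>?S. of_int (sign \<sigma>) * of_int (sign \<tau>) * c \<sigma> \<tau> y)"
      by (simp only: c_def prod.distrib)
    finally show ?thesis .
  qed
  have intR: "integrable (lb {0..<n}) (\<lambda>y. complex_of_real (R y))"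
    unfolding R by (intro Bochner_Integration.integrable_sum integrable_mult_right intc)
  have "complex_of_real (\<integral>y. R y \<partial>lb {0..<n}) = (\<integral>y. complex_of_real (R y) \<partial>lb {0..<n})"
    by (rule integral_complex_of_real[symmetric])
  also have "\<dots> = (\<Sum>\<sigma>\<in>?S. \<Sum>\<tau>\<in>?S. of_int (sign \<sigma>) * of_int (sign \<tau>) * (\<integral>y. c \<sigma> \<tau> y \<partial>lb {0..<n}))"
    unfolding R by (simp add: Bochner_Integration.integral_sum intc)
  also have "\<dots> = (\<Sum>\<sigma>\<in>?S. \<Sum>\<tau>\<in>?S. if \<tau> = \<sigma> then of_real (\<Prod>k\<in>{0..<n}. h k) else 0)"
  proof (intro sum.cong refl)
    fix \<sigma> \<tau> assume "\<sigma> \<in> ?S" "\<tau> \<in> ?S"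
    then show "of_int (sign \<sigma>) * of_int (sign \<tau>) * (\<integral>y. c \<sigma> \<tau> y \<partial>lb {0..<n}) =
        (if \<tau> = \<sigma> then of_real (\<Prod>k\<in>{0..<n}. h k) else 0)"
      using valc[of \<sigma> \<tau>] by (auto simp: sign_def)
  qed
  also have "\<dots> = complex_of_real (fact n * (\<Prod>k\<in>{0..<n}. h k))"
    using finS by (simp add: card_permutations[of "{0..<n}" n])
  finally have val: "(\<integral>y. R y \<partial>lb {0..<n}) = fact n * (\<Prod>k\<in>{0..<n}. h k)"
    by (simp only: of_real_eq_iff)
  have "integrable (lb {0..<n}) R"
    using integrable_Re[OF intR] by simp
  moreover have "R y \<ge> 0" for y by (simp add: R_def nonneg prod_nonneg)
  ultimately have "(\<integral>\<^sup>+y. ennreal (R y) \<partial>lb {0..<n}) = ennreal (fact n * (\<Prod>k\<in>{0..<n}. h k))"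
    by (subst nn_integral_eq_integral) (auto simp: val)
  moreover have "ennreal (R y) = (\<Prod>i\<in>{0..<n}. ennreal (g (y i))) * (\<Prod>i\<in>{0..<n}. \<Prod>j\<in>{0..<i}. ennreal ((cmod (y i - y j))\<^sup>2))" for y
    unfolding R_def by (simp add: ennreal_mult prod_ennreal nonneg prod_nonneg prod_power_distrib flip: prod_norm)
  ultimately show ?thesis by (simp only: h_def)
qed

section \<open>Gamma laws\<close>

lemma emeasure_ball_complex: "r \<ge> 0 \<Longrightarrow> emeasure lborel (ball (0::complex) r) = ennreal (pi * r\<^sup>2)"
  by (simp add: emeasure_ball unit_ball_vol_2)

lemma emeasure_cball_complex: "r \<ge> 0 \<Longrightarrow> emeasure lborel (cball (0::complex) r) = ennreal (pi * r\<^sup>2)"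
  by (simp add: emeasure_cball unit_ball_vol_2)

text \<open>A disc of radius \<open>sqrt b\<close> has area \<open>pi * b\<close>, linear in
  \<open>b\<close>, so the squared modulus carries planar measure to a constant density on the half
  line.\<close>

lemma distr_cmod_square:
  "distr lborel borel (\<lambda>z::complex. (cmod z)\<^sup>2) = density lborel (\<lambda>t. ennreal (pi * indicator {0..} t))"
proof (rule measure_eqI_generator_eq)
  let ?E = "range (\<lambda>(a, b). box a b :: real set)"
  let ?D = "distr lborel borel (\<lambda>z::complex. (cmod z)\<^sup>2)"
  let ?A = "\<lambda>n::nat. box (- (real n *\<^sub>R One)) (real n *\<^sub>R One) :: real set"
  show "Int_stable ?E" by (auto simp: Int_stable_def box_Int_box)
  show "?E \<subseteq> Pow UNIV" "sets ?D = sigma_sets UNIV ?E" "sets (density lborel (\<lambda>t. ennreal (pi * indicator {0..} t))) = sigma_sets UNIV ?E"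
    by (simp_all add: borel_eq_box)
  show "range ?A \<subseteq> ?E" "(\<Union>i. ?A i) = UNIV" unfolding UN_box_eq_UNIV by auto
  have em: "emeasure ?D (box a b) = emeasure lborel {z::complex. a < (cmod z)\<^sup>2 \<and> (cmod z)\<^sup>2 < b}" for a b
    by (subst emeasure_distr) (auto simp: box_def intro!: arg_cong[of _ _ "emeasure lborel"])
  have bnd: "emeasure ?D (box a b) = (if b \<le> 0 \<or> b \<le> a then 0 else ennreal (pi * (b - max a 0)))" for a b :: real
  proof -
    consider "b \<le> 0 \<or> b \<le> a" | "b > 0" "b > a" "a < 0" | "b > a" "a \<ge> 0" by linarith
    then show ?thesis
    proof cases
      case 1
      then have e: "{z::complex. a < (cmod z)\<^sup>2 \<and> (cmod z)\<^sup>2 < b} = {}"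
        by (auto simp: not_less) (meson dual_order.strict_trans2 not_less zero_le_power2)
      show ?thesis unfolding em e using 1 by auto
    next
      case 2
      have e: "{z::complex. a < (cmod z)\<^sup>2 \<and> (cmod z)\<^sup>2 < b} = ball 0 (sqrt b)"
      proof -
        have "a < (cmod z)\<^sup>2" for z using 2 zero_le_power2[of "cmod z"] by linarith
        moreover have "(cmod z)\<^sup>2 < b \<longleftrightarrow> cmod z < sqrt b" for z
          using real_sqrt_less_iff[of "(cmod z)\<^sup>2" b] by simp
        ultimately show ?thesis by auto
      qed
      show ?thesis unfolding em e using 2 by (simp add: emeasure_ball_complex)
    next
      case 3
      have e: "{z::complex. a < (cmod z)\<^sup>2 \<and> (cmod z)\<^sup>2 < b} = ball 0 (sqrt b) - cball 0 (sqrt a)"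
      proof -
        have "a < (cmod z)\<^sup>2 \<longleftrightarrow> sqrt a < cmod z" for z
          using real_sqrt_less_iff[of a "(cmod z)\<^sup>2"] by simp
        moreover have "(cmod z)\<^sup>2 < b \<longleftrightarrow> cmod z < sqrt b" for z
          using real_sqrt_less_iff[of "(cmod z)\<^sup>2" b] by simp
        ultimately show ?thesis by auto
      qed
      have "emeasure lborel (ball (0::complex) (sqrt b) - cball 0 (sqrt a)) = ennreal (pi * b) - ennreal (pi * a)"
        using 3 real_sqrt_less_mono[OF 3(1)]
        by (subst emeasure_Diff) (auto simp: emeasure_ball_complex emeasure_cball_complex simp del: real_sqrt_less_iff)
      then show ?thesis unfolding em e using 3 by (simp add: ennreal_minus right_diff_distrib)
    qed
  qed
  show "emeasure ?D (?A i) \<noteq> \<infinity>" for i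
    unfolding bnd by auto
  fix X assume "X \<in> ?E"
  then obtain a b where X: "X = box a b" by auto
  have "emeasure (density lborel (\<lambda>t. ennreal (pi * indicator {0..} t))) (box a b) =
      (\<integral>\<^sup>+t. ennreal pi * indicator ({0..} \<inter> {a<..<b}) t \<partial>lborel)"
    by (subst emeasure_density) (auto intro!: nn_integral_cong simp: indicator_def)
  also have "\<dots> = ennreal pi * emeasure lborel ({0..} \<inter> {a<..<b})"
    by (simp add: nn_integral_cmult_indicator)
  also have "\<dots> = (if b \<le> 0 \<or> b \<le> a then 0 else ennreal (pi * (b - max a 0)))"
  proof -
    consider "b \<le> 0 \<or> b \<le> a" | "b > 0" "b > a" "a < 0" | "b > a" "a \<ge> 0" by linarith
    then show ?thesis
    proof cases
      case 1
      then have "{0..} \<inter> {a<..<b} = {}" by auto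
      then show ?thesis using 1 by auto
    next
      case 2
      then have "{0..} \<inter> {a<..<b} = {0..<b}" by auto
      then show ?thesis using 2 by (simp add: ennreal_mult)
    next
      case 3
      then have "{0..} \<inter> {a<..<b} = {a<..<b}" by auto
      then show ?thesis using 3 by (simp add: ennreal_mult)
    qed
  qed
  finally show "emeasure ?D X = emeasure (density lborel (\<lambda>t. ennreal (pi * indicator {0..} t))) X"
    unfolding X bnd ..
qed

lemma nn_integral_cmod_square:
  fixes \<phi> :: "real \<Rightarrow> ennreal"
  assumes [measurable]: "\<phi> \<in> borel_measurable borel"
  shows "(\<integral>\<^sup>+z. \<phi> ((cmod z)\<^sup>2) \<partial>lborel) = (\<integral>\<^sup>+t. ennreal (pi * indicator {0..} t) * \<phi> t \<partial>lborel)"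
proof -
  have "(\<integral>\<^sup>+z. \<phi> ((cmod z)\<^sup>2) \<partial>lborel) = (\<integral>\<^sup>+t. \<phi> t \<partial>distr lborel borel (\<lambda>z. (cmod z)\<^sup>2))"
    by (subst nn_integral_distr) auto
  also have "\<dots> = (\<integral>\<^sup>+t. ennreal (pi * indicator {0..} t) * \<phi> t \<partial>lborel)"
    unfolding distr_cmod_square by (subst nn_integral_density) auto
  finally show ?thesis .
qed

definition gamma_law :: "real \<Rightarrow> real measure" where
  "gamma_law a = density lborel (\<lambda>t. ennreal (indicator {0..} t * t powr (a - 1) / exp t / Gamma a))"

lemma sets_gamma_law [simp, measurable_cong]: "sets (gamma_law a) = sets borel"
  and space_gamma_law [simp]: "space (gamma_law a) = UNIV"
  by (simp_all add: gamma_law_def)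

lemma nn_integral_gamma_power:
  assumes a: "a > 0"
  shows "(\<integral>\<^sup>+t. ennreal (t ^ j) \<partial>gamma_law a) = ennreal (Gamma (a + real j) / Gamma a)"
proof -
  have G: "Gamma a > 0" "Gamma (a + real j) > 0" using a by simp_all
  have "(\<integral>\<^sup>+t. ennreal (t ^ j) \<partial>gamma_law a) =
     (\<integral>\<^sup>+t. ennreal (indicator {0..} t * t powr (a - 1) / exp t / Gamma a) * ennreal (t ^ j) \<partial>lborel)"
    unfolding gamma_law_def by (rule nn_integral_density) auto
  also have "\<dots> = (\<integral>\<^sup>+t. ennreal (1 / Gamma a) * ennreal (indicator {0..} t * t powr (a + real j - 1) / exp t) \<partial>lborel)"
  proof (rule nn_integral_cong)
    fix t :: real
    show "ennreal (indicator {0..} t * t powr (a - 1) / exp t / Gamma a) * ennreal (t ^ j) =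
        ennreal (1 / Gamma a) * ennreal (indicator {0..} t * t powr (a + real j - 1) / exp t)"
    proof (cases "t > 0")
      case True
      have "t powr (a - 1) * t ^ j = t powr (a + real j - 1)"
        using True by (simp add: powr_realpow[symmetric] powr_add[symmetric] algebra_simps)
      then show ?thesis
        using True G by (simp add: ennreal_mult'[symmetric] field_simps)
    next
      case False
      then show ?thesis by (cases "t = 0") (auto simp: indicator_def)
    qed
  qed
  also have "\<dots> = ennreal (1 / Gamma a) * ennreal (Gamma (a + real j))"
    using a by (subst nn_integral_cmult) (auto simp: Gamma_conv_nn_integral_real[of "a + real j"])
  also have "\<dots> = ennreal (Gamma (a + real j) / Gamma a)"
    using G by (simp add: ennreal_mult'[symmetric])
  finally show ?thesis .
qed

lemma prob_space_gamma_law: "a > 0 \<Longrightarrow> prob_space (gamma_law a)"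
  using nn_integral_gamma_power[of a 0] less_imp_neq[OF Gamma_real_pos[of a]] by (intro prob_spaceI) (auto split: if_splits)

lemma gamma_law_moment:
  assumes a: "a > 0"
  shows "has_bochner_integral (gamma_law a) (\<lambda>t. t ^ j) (Gamma (a + real j) / Gamma a)"
proof (rule has_bochner_integral_nn_integral)
  show "AE t in gamma_law a. 0 \<le> t ^ j"
    unfolding gamma_law_def by (subst AE_density) (auto simp: indicator_def)
  show "0 \<le> Gamma (a + real j) / Gamma a" using a by (simp add: less_imp_le)
qed (simp_all add: nn_integral_gamma_power[OF a])

text \<open>Scaling by \<open>1 / (1 - \<theta>)\<close> turns the exponentially tilted density back
  into a multiple of the gamma density.\<close>

lemma gamma_law_mgf:
  assumes a: "a > 0" and th: "\<theta> < 1"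
  shows "(\<integral>\<^sup>+t. ennreal (exp (\<theta> * t)) \<partial>gamma_law a) = ennreal ((1 - \<theta>) powr (- a))"
proof -
  define c where "c = 1 / (1 - \<theta>)"
  have c: "c > 0" using th by (simp add: c_def)
  have G: "Gamma a > 0" using a by simp
  have "(\<integral>\<^sup>+t. ennreal (exp (\<theta> * t)) \<partial>gamma_law a) =
     (\<integral>\<^sup>+t. ennreal (indicator {0..} t * t powr (a - 1) / exp t / Gamma a) * ennreal (exp (\<theta> * t)) \<partial>lborel)"
    unfolding gamma_law_def by (rule nn_integral_density) auto
  also have "\<dots> = ennreal \<bar>c\<bar> * (\<integral>\<^sup>+t. ennreal (indicator {0..} (0 + c * t) * (0 + c * t) powr (a - 1) / exp (0 + c * t) / Gamma a) * ennreal (exp (\<theta> * (0 + c * t))) \<partial>lborel)"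
    using c by (intro nn_integral_real_affine) auto
  also have "(\<integral>\<^sup>+t. ennreal (indicator {0..} (0 + c * t) * (0 + c * t) powr (a - 1) / exp (0 + c * t) / Gamma a) * ennreal (exp (\<theta> * (0 + c * t))) \<partial>lborel)
     = (\<integral>\<^sup>+t. ennreal (c powr (a - 1) / Gamma a) * ennreal (indicator {0..} t * t powr (a - 1) / exp t) \<partial>lborel)"
  proof (rule nn_integral_cong)
    fix t :: real
    have "exp (\<theta> * (c * t)) / exp (c * t) = exp (\<theta> * (c * t) - c * t)" by (simp add: exp_diff)
    also have "\<theta> * (c * t) - c * t = - (((1 - \<theta>) * c) * t)" by (simp add: algebra_simps)
    also have "(1 - \<theta>) * c = 1" using th by (simp add: c_def)
    finally have e: "exp (\<theta> * (c * t)) / exp (c * t) = 1 / exp t" by (simp add: exp_minus divide_inverse)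
    have i: "indicator {0..} (c * t) = (indicator {0..} t :: real)"
      using c by (auto simp: indicator_def zero_le_mult_iff)
    have p: "indicator {0..} t * (c * t) powr (a - 1) = c powr (a - 1) * (indicator {0..} t * t powr (a - 1))"
      using c by (auto simp: indicator_def powr_mult)
    have "ennreal (indicator {0..} (0 + c * t) * (0 + c * t) powr (a - 1) / exp (0 + c * t) / Gamma a) * ennreal (exp (\<theta> * (0 + c * t)))
       = ennreal (indicator {0..} t * (c * t) powr (a - 1) * (exp (\<theta> * (c * t)) / exp (c * t)) / Gamma a)"
      unfolding i add_0 using G by (subst ennreal_mult[symmetric]) (auto simp: mult_ac)
    also have "\<dots> = ennreal (c powr (a - 1) / Gamma a) * ennreal (indicator {0..} t * t powr (a - 1) / exp t)"
      unfolding e p using G by (subst ennreal_mult[symmetric]) auto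
    finally show "ennreal (indicator {0..} (0 + c * t) * (0 + c * t) powr (a - 1) / exp (0 + c * t) / Gamma a) * ennreal (exp (\<theta> * (0 + c * t)))
       = ennreal (c powr (a - 1) / Gamma a) * ennreal (indicator {0..} t * t powr (a - 1) / exp t)" .
  qed
  also have "\<dots> = ennreal (c powr (a - 1) / Gamma a) * ennreal (Gamma a)"
    using a by (subst nn_integral_cmult) (auto simp: Gamma_conv_nn_integral_real[of a])
  also have "ennreal \<bar>c\<bar> * \<dots> = ennreal (c * c powr (a - 1))"
    using c G by (simp add: ennreal_mult''[symmetric])
  also have "c * c powr (a - 1) = c powr a"
    using c by (simp add: powr_diff)
  also have "\<dots> = (1 - \<theta>) powr (- a)"
    using th by (simp add: c_def powr_minus_divide powr_divide)
  finally show ?thesis .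
qed

text \<open>Chernoff's bound with the optimal exponent \<open>\<theta> = 1 - 1 / y\<close>.\<close>

lemma gamma_law_tail:
  assumes a: "a > 0" and y: "y > 0" and T [measurable]: "T \<in> sets borel"
    and TA: "\<And>t. t \<in> T \<Longrightarrow> (y - 1) * (t - y * A) \<ge> 0"
  shows "measure (gamma_law a) T \<le> exp ((1 - y) * A) * y powr a"
proof -
  interpret prob_space "gamma_law a" by (rule prob_space_gamma_law[OF a])
  define \<theta> where "\<theta> = 1 - 1 / y"
  have th: "\<theta> < 1" using y by (simp add: \<theta>_def)
  \<comment> \<open>\<open>\<theta>\<close> has the sign of \<open>y - 1\<close>, so a single
    hypothesis on \<open>T\<close> covers the upper tail for \<open>y > 1\<close> and the lower tail
    for \<open>y < 1\<close>.\<close>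
  have pos: "\<theta> * (t - y * A) \<ge> 0" if "t \<in> T" for t
  proof -
    have "\<theta> * (t - y * A) = ((y - 1) * (t - y * A)) / y" using y by (simp add: \<theta>_def field_simps)
    then show ?thesis using TA[OF that] y by simp
  qed
  have "emeasure (gamma_law a) T = (\<integral>\<^sup>+t. indicator T t \<partial>gamma_law a)"
    by simp
  also have "\<dots> \<le> (\<integral>\<^sup>+t. ennreal (exp (- \<theta> * (y * A))) * ennreal (exp (\<theta> * t)) \<partial>gamma_law a)"
  proof (rule nn_integral_mono)
    fix t
    show "indicator T t \<le> ennreal (exp (- \<theta> * (y * A))) * ennreal (exp (\<theta> * t))"
    proof (cases "t \<in> T")
      case True
      have "1 \<le> exp (\<theta> * (t - y * A))" using pos[OF True] by simp
      also have "\<dots> = exp (- \<theta> * (y * A)) * exp (\<theta> * t)" by (simp add: exp_add[symmetric] algebra_simps)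
      finally show ?thesis using True by (simp add: ennreal_mult[symmetric])
    qed simp
  qed
  also have "\<dots> = ennreal (exp (- \<theta> * (y * A))) * ennreal ((1 - \<theta>) powr (- a))"
    by (subst nn_integral_cmult) (auto simp: gamma_law_mgf[OF a th])
  also have "\<dots> = ennreal (exp ((1 - y) * A) * y powr a)"
  proof -
    have "- \<theta> * (y * A) = (1 - y) * A" using y by (simp add: \<theta>_def field_simps)
    moreover have "(1 - \<theta>) powr (- a) = y powr a" using y by (simp add: \<theta>_def powr_minus powr_divide)
    ultimately show ?thesis by (simp add: ennreal_mult)
  qed
  finally show ?thesis by (simp add: emeasure_eq_measure)
qed

text \<open>Takes the place of a central limit theorem at the edge. A quartic that is at most 36 on
  the positive axis and at most 0 elsewhere bounds the mass on one side of \<open>A\<close> from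
  below by four moments. The lower bound here is the expectation of that quartic at the normalized
  variable, divided by 36; the sign \<open>s\<close> selects the side.\<close>

lemma gamma_law_quartic:
  assumes a: "a > 0" and s: "s = 1 \<or> s = -1" and A: "A > 0"
  defines "d \<equiv> a - A"
  shows "(- (3 * a\<^sup>2 + 6 * a + 8 * a * d + 6 * a * d\<^sup>2 + d ^ 4) / A\<^sup>2 + s * (2 * a + 3 * a * d + d ^ 3) / (A * sqrt A)
      + 5 * (a + d\<^sup>2) / A + 3 * s * d / sqrt A) / 36 \<le> measure (gamma_law a) {t. s * (t - A) > 0}"
proof -
  interpret prob_space "gamma_law a" by (rule prob_space_gamma_law[OF a])
  define r where "r = sqrt A"
  have r: "r > 0" "r\<^sup>2 = A" using A by (simp_all add: r_def)
  define Y where "Y = (\<lambda>t. s * (t - A) / r)"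
  \<comment> \<open>\<open>p y = y * (3 - y) * (y + 1)\<^sup>2\<close> is positive only for
    \<open>0 < y < 3\<close>, where the bounds 9/4 and 16 of its two parts give 36. Its expectation
    under the standard normal law is -3 + 0 + 5 + 0 = 2, which is positive.\<close>
  define p where "p = (\<lambda>y::real. - (y ^ 4) + y ^ 3 + 5 * y\<^sup>2 + 3 * y)"
  have ss: "s * s = 1" "s ^ 2 = 1" "s ^ 3 = s" "s ^ 4 = 1" using s by auto
  have na: "a \<notin> \<int>\<^sub>\<le>\<^sub>0" "a + 1 \<notin> \<int>\<^sub>\<le>\<^sub>0" "a + 2 \<notin> \<int>\<^sub>\<le>\<^sub>0" "a + 3 \<notin> \<int>\<^sub>\<le>\<^sub>0"
    using a by (auto dest: nonpos_Ints_nonpos)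
  have G: "Gamma a \<noteq> 0" using Gamma_real_pos[OF a] by simp
  have g1: "Gamma (a + 1) = a * Gamma a" by (rule Gamma_plus1[OF na(1)])
  have g2: "Gamma (a + 2) = (a + 1) * (a * Gamma a)"
    using Gamma_plus1[OF na(2)] by (simp add: g1 add.assoc)
  have g3: "Gamma (a + 3) = (a + 2) * ((a + 1) * (a * Gamma a))"
    using Gamma_plus1[OF na(3)] by (simp add: g2 add.assoc)
  have g4: "Gamma (a + 4) = (a + 3) * ((a + 2) * ((a + 1) * (a * Gamma a)))"
    using Gamma_plus1[OF na(4)] by (simp add: g3 add.assoc)
  have m0: "has_bochner_integral (gamma_law a) (\<lambda>t. t ^ 0) 1"
    using gamma_law_moment[OF a, of 0] G by simp
  have m1: "has_bochner_integral (gamma_law a) (\<lambda>t. t ^ 1) a"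
    using gamma_law_moment[OF a, of 1] G by (simp add: g1)
  have m2: "has_bochner_integral (gamma_law a) (\<lambda>t. t ^ 2) ((a + 1) * a)"
    using gamma_law_moment[OF a, of 2] G by (simp add: g2)
  have m3: "has_bochner_integral (gamma_law a) (\<lambda>t. t ^ 3) ((a + 2) * ((a + 1) * a))"
    using gamma_law_moment[OF a, of 3] G by (simp add: g3)
  have m4: "has_bochner_integral (gamma_law a) (\<lambda>t. t ^ 4) ((a + 3) * ((a + 2) * ((a + 1) * a)))"
    using gamma_law_moment[OF a, of 4] G by (simp add: g4)
  define q0 q1 q2 q3 q4 where "q0 = - (A ^ 4) / r ^ 4 - s * A ^ 3 / r ^ 3 + 5 * A\<^sup>2 / r\<^sup>2 - 3 * s * A / r"
    and "q1 = 4 * A ^ 3 / r ^ 4 + 3 * s * A\<^sup>2 / r ^ 3 - 10 * A / r\<^sup>2 + 3 * s / r"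
    and "q2 = - 6 * A\<^sup>2 / r ^ 4 - 3 * s * A / r ^ 3 + 5 / r\<^sup>2"
    and "q3 = 4 * A / r ^ 4 + s / r ^ 3"
    and "q4 = - 1 / r ^ 4"
  have exp: "p (Y t) = q0 * t ^ 0 + q1 * t ^ 1 + q2 * t ^ 2 + q3 * t ^ 3 + q4 * t ^ 4" for t
  proof -
    have "p (Y t) = - ((t - A) ^ 4 / r ^ 4) + s * ((t - A) ^ 3 / r ^ 3) + 5 * ((t - A)\<^sup>2 / r\<^sup>2) + 3 * (s * (t - A) / r)"
      by (simp add: p_def Y_def power_mult_distrib power_divide ss)
    also have "(t - A) ^ 4 = t ^ 4 - 4 * A * t ^ 3 + 6 * A\<^sup>2 * t\<^sup>2 - 4 * A ^ 3 * t + A ^ 4" by (simp add: power4_eq_xxxx power3_eq_cube power2_eq_square algebra_simps)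
    also have "(t - A) ^ 3 = t ^ 3 - 3 * A * t\<^sup>2 + 3 * A\<^sup>2 * t - A ^ 3" by (simp add: power4_eq_xxxx power3_eq_cube power2_eq_square algebra_simps)
    also have "(t - A)\<^sup>2 = t\<^sup>2 - 2 * A * t + A\<^sup>2" by (simp add: power4_eq_xxxx power3_eq_cube power2_eq_square algebra_simps)
    finally show ?thesis
      by (simp add: q0_def q1_def q2_def q3_def q4_def diff_divide_distrib add_divide_distrib algebra_simps)
  qed
  define e where "e = q0 * 1 + q1 * a + q2 * ((a + 1) * a) + q3 * ((a + 2) * ((a + 1) * a)) + q4 * ((a + 3) * ((a + 2) * ((a + 1) * a)))"
  have hb: "has_bochner_integral (gamma_law a) (\<lambda>t. p (Y t)) e"
    unfolding exp e_def
    by (intro has_bochner_integral_add has_bochner_integral_mult_right m0 m1 m2 m3 m4)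
  have pb: "p y \<le> 36 * indicator {0<..} y" for y
  proof -
    have f: "p y = (y * (3 - y)) * (y + 1)\<^sup>2" by (simp add: p_def power2_eq_square power3_eq_cube power4_eq_xxxx algebra_simps)
    consider "y \<le> 0" | "y > 3" | "0 < y" "y \<le> 3" by linarith
    then show ?thesis
    proof cases
      case 1
      then have "y * (3 - y) \<le> 0" by (simp add: mult_le_0_iff)
      then show ?thesis unfolding f using 1 by (simp add: mult_le_0_iff)
    next
      case 2
      then have "y * (3 - y) \<le> 0" by (simp add: mult_le_0_iff)
      then have "p y \<le> 0" unfolding f by (simp add: mult_le_0_iff)
      then show ?thesis using 2 by simp
    next
      case 3
      have "0 \<le> (y - 3 / 2)\<^sup>2" by simp
      then have "y * (3 - y) \<le> 9 / 4" by (simp add: power2_eq_square algebra_simps)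
      moreover have "(y + 1)\<^sup>2 \<le> 4\<^sup>2" using 3 by (intro power_mono) auto
      ultimately have "p y \<le> 9 / 4 * 4\<^sup>2" unfolding f using 3 by (intro mult_mono) auto
      then show ?thesis using 3 by simp
    qed
  qed
  have "e = (\<integral>t. p (Y t) \<partial>gamma_law a)" using hb by (simp add: has_bochner_integral_integral_eq)
  also have "\<dots> \<le> (\<integral>t. 36 * indicator {t. s * (t - A) > 0} t \<partial>gamma_law a)"
  proof (rule integral_mono)
    show "integrable (gamma_law a) (\<lambda>t. p (Y t))" using hb by (rule integrable.intros)
    show "integrable (gamma_law a) (\<lambda>t. 36 * indicator {t. s * (t - A) > 0} t :: real)"
      by (intro integrable_mult_right integrable_real_indicator) (auto simp: emeasure_eq_measure)
    fix t
    show "p (Y t) \<le> 36 * indicator {t. s * (t - A) > 0} t"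
      using pb[of "Y t"] r by (simp add: Y_def indicator_def zero_less_divide_iff)
  qed
  also have "\<dots> = 36 * measure (gamma_law a) {t. s * (t - A) > 0}" by simp
  finally have le: "e / 36 \<le> measure (gamma_law a) {t. s * (t - A) > 0}" by simp
  have "e = - (3 * a\<^sup>2 + 6 * a + 8 * a * d + 6 * a * d\<^sup>2 + d ^ 4) / r ^ 4 + s * (2 * a + 3 * a * d + d ^ 3) / r ^ 3
      + 5 * (a + d\<^sup>2) / r\<^sup>2 + 3 * s * d / r"
  proof -
    have "e = (- (A ^ 4) + 4 * A ^ 3 * a - 6 * A\<^sup>2 * ((a + 1) * a) + 4 * A * ((a + 2) * ((a + 1) * a)) - (a + 3) * ((a + 2) * ((a + 1) * a))) / r ^ 4
       + s * (- (A ^ 3) + 3 * A\<^sup>2 * a - 3 * A * ((a + 1) * a) + (a + 2) * ((a + 1) * a)) / r ^ 3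
       + 5 * (A\<^sup>2 - 2 * A * a + (a + 1) * a) / r\<^sup>2 + 3 * s * (a - A) / r"
      unfolding e_def q0_def q1_def q2_def q3_def q4_def
      by (simp add: diff_divide_distrib add_divide_distrib algebra_simps)
    also have "- (A ^ 4) + 4 * A ^ 3 * a - 6 * A\<^sup>2 * ((a + 1) * a) + 4 * A * ((a + 2) * ((a + 1) * a)) - (a + 3) * ((a + 2) * ((a + 1) * a))
      = - (3 * a\<^sup>2 + 6 * a + 8 * a * d + 6 * a * d\<^sup>2 + d ^ 4)" unfolding d_def by (simp add: power4_eq_xxxx power3_eq_cube power2_eq_square algebra_simps)
    also have "- (A ^ 3) + 3 * A\<^sup>2 * a - 3 * A * ((a + 1) * a) + (a + 2) * ((a + 1) * a) = 2 * a + 3 * a * d + d ^ 3"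
      unfolding d_def by (simp add: power4_eq_xxxx power3_eq_cube power2_eq_square algebra_simps)
    also have "A\<^sup>2 - 2 * A * a + (a + 1) * a = a + d\<^sup>2" unfolding d_def by (simp add: power4_eq_xxxx power3_eq_cube power2_eq_square algebra_simps)
    finally show ?thesis by (simp only: d_def)
  qed
  moreover have "r ^ 4 = A\<^sup>2" "r ^ 3 = A * sqrt A" "r\<^sup>2 = A" "r = sqrt A"
  proof -
    have "r ^ 4 = (r\<^sup>2)\<^sup>2" by simp
    then show "r ^ 4 = A\<^sup>2" by (simp only: r(2))
    have "r ^ 3 = r\<^sup>2 * r" by (simp add: power2_eq_square power3_eq_cube)
    then show "r ^ 3 = A * sqrt A" unfolding r(2) by (simp add: r_def)
  qed (use A in \<open>simp_all add: r_def\<close>)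
  ultimately show ?thesis using le by simp
qed

text \<open>A fixed shift \<open>d\<close> is negligible against \<open>sqrt A\<close>, so the
  quartic bound tends to the value 2/36 of a normal variable; half of it holds eventually.\<close>

lemma gamma_law_not_concentrated:
  assumes s: "s = 1 \<or> s = -1"
  shows "\<forall>\<^sub>F A in at_top. 1 / 36 \<le> measure (gamma_law (A + d)) {t. s * (t - A) > 0}"
proof -
  define e where "e = (\<lambda>A::real. - (3 * (A + d)\<^sup>2 + 6 * (A + d) + 8 * (A + d) * d + 6 * (A + d) * d\<^sup>2 + d ^ 4) / A\<^sup>2
      + s * (2 * (A + d) + 3 * (A + d) * d + d ^ 3) / (A * sqrt A) + 5 * ((A + d) + d\<^sup>2) / A + 3 * s * d / sqrt A)"
  have "(e \<longlongrightarrow> 2) at_top" unfolding e_def by real_asymp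
  then have "\<forall>\<^sub>F A in at_top. e A > 1" by (rule order_tendstoD) simp
  moreover have "\<forall>\<^sub>F A in at_top. A > max 0 (- d)" by (rule eventually_gt_at_top)
  ultimately show ?thesis
  proof eventually_elim
    case (elim A)
    then have "1 / 36 \<le> e A / 36" by simp
    also have "\<dots> \<le> measure (gamma_law (A + d)) {t. s * (t - A) > 0}"
      using gamma_law_quartic[of "A + d" s A] s elim unfolding e_def by simp
    finally show ?case .
  qed
qed

section \<open>The moduli of the eigenvalues\<close>

text \<open>Replaces an uncountable existential by conditions on a set that may be chosen countable:
  the modulus attains its minimum on a compact set, so a root exists exactly when arbitrarily small
  values occur on a dense subset.\<close>

lemma root_in_compact_iff:
  fixes p :: "complex poly"
  assumes K: "compact K" and D: "D \<subseteq> K" "K \<subseteq> closure D"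
  shows "(\<exists>y\<in>K. poly p y = 0) \<longleftrightarrow> (\<forall>j. \<exists>y\<in>D. cmod (poly p y) < inverse (real (Suc j)))"
proof
  assume "\<exists>y\<in>K. poly p y = 0"
  then obtain y where y: "y \<in> K" "poly p y = 0" by auto
  show "\<forall>j. \<exists>y\<in>D. cmod (poly p y) < inverse (real (Suc j))"
  proof
    fix j
    have "isCont (poly p) y" by simp
    then obtain d where d: "d > 0" "\<And>x. dist x y < d \<Longrightarrow> dist (poly p x) (poly p y) < inverse (real (Suc j))"
      unfolding continuous_at_eps_delta by (metis inverse_positive_iff_positive of_nat_0_less_iff zero_less_Suc)
    obtain x where "x \<in> D" "dist x y < d"
      using y D(2) d(1) closure_approachable[of y D] by blast
    then show "\<exists>y\<in>D. cmod (poly p y) < inverse (real (Suc j))"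
      using d(2)[of x] y(2) by (auto simp: dist_norm)
  qed
next
  assume *: "\<forall>j. \<exists>y\<in>D. cmod (poly p y) < inverse (real (Suc j))"
  then have "K \<noteq> {}" using D(1) by auto
  moreover have "continuous_on K (\<lambda>y. cmod (poly p y))" by (intro continuous_intros)
  ultimately obtain y where y: "y \<in> K" "\<And>x. x \<in> K \<Longrightarrow> cmod (poly p y) \<le> cmod (poly p x)"
    using continuous_attains_inf[OF K] by meson
  have "cmod (poly p y) \<le> 0"
  proof (rule ccontr)
    assume "\<not> cmod (poly p y) \<le> 0"
    then obtain j where "inverse (real (Suc j)) < cmod (poly p y)"
      using reals_Archimedean[of "cmod (poly p y)"] by auto
    moreover from * obtain x where "x \<in> D" "cmod (poly p x) < inverse (real (Suc j))" by blast
    ultimately show False using y(2)[of x] D(1) by auto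
  qed
  with y(1) show "\<exists>y\<in>K. poly p y = 0" by auto
qed

text \<open>The complement of \<open>S\<close> is a countable union of compact sets, and having a
  root in one of these is measurable by the countable criterion.\<close>

lemma sets_roots_in_closed:
  assumes "closed S"
  shows "{x \<in> space (lb ({0..<n} \<times> {0..<n})). \<forall>y. poly (cpf n x) y = 0 \<longrightarrow> y \<in> S} \<in> sets (lb ({0..<n} \<times> {0..<n}))"
proof -
  let ?M = "lb ({0..<n} \<times> {0..<n})"
  have "open (- S)" using assms by (simp add: open_Compl)
  then obtain C where C: "\<And>k::nat. compact (C k)" "\<Union> (range C) = - S"
    by (rule open_Union_compact_subsets) blast
  have meas: "{x \<in> space ?M. \<exists>y\<in>C k. poly (cpf n x) y = 0} \<in> sets ?M" for k
  proof -
    obtain D where D: "countable D" "D \<subseteq> C k" "C k \<subseteq> closure D" by (rule separable)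
    have "{x \<in> space ?M. \<exists>y\<in>C k. poly (cpf n x) y = 0} =
        (\<Inter>j. \<Union>y\<in>D. {x \<in> space ?M. cmod (poly (cpf n x) y) < inverse (real (Suc j))}) \<inter> space ?M"
      unfolding root_in_compact_iff[OF C(1) D(2,3)] by auto
    also have "\<dots> \<in> sets ?M"
      using D(1) by (intro sets.Int sets.countable_INT' sets.countable_UN') auto
    finally show ?thesis .
  qed
  have "{x \<in> space ?M. \<forall>y. poly (cpf n x) y = 0 \<longrightarrow> y \<in> S} =
     space ?M - (\<Union>k. {x \<in> space ?M. \<exists>y\<in>C k. poly (cpf n x) y = 0})"
    using C(2) by auto
  also have "\<dots> \<in> sets ?M" using meas by blast
  finally show ?thesis .
qed

text \<open>On a characteristic polynomial, \<open>cmod (poly p 0)\<close> is the modulus of the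
  determinant. The determinant factor of the density and the event on the spectrum thus form one
  weight that is multiplicative over the roots.\<close>

definition confined_det :: "complex set \<Rightarrow> real \<Rightarrow> complex poly \<Rightarrow> ennreal" where
  "confined_det S L p = (if \<forall>y. poly p y = 0 \<longrightarrow> y \<in> S then ennreal ((cmod (poly p 0))\<^sup>2 powr L) else 0)"

lemma spectral_weight_confined_det:
  assumes S: "closed S"
  shows "spectral_weight (confined_det S L) (\<lambda>z. if z \<in> S then ennreal ((cmod z)\<^sup>2 powr L) else 0)"
  unfolding spectral_weight_def
proof (intro conjI allI impI)
  show "confined_det S L 1 = 1" by (simp add: confined_det_def)
  have [measurable]: "S \<in> sets borel" using S by simp
  show "(\<lambda>z. if z \<in> S then ennreal ((cmod z)\<^sup>2 powr L) else 0) \<in> borel_measurable borel" by measurable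
  fix n
  have [measurable]: "Measurable.pred (lb ({0..<n} \<times> {0..<n})) (\<lambda>x. \<forall>y. poly (cpf n x) y = 0 \<longrightarrow> y \<in> S)"
    using sets_roots_in_closed[OF S] by (simp add: pred_def)
  show "(\<lambda>x. confined_det S L (cpf n x)) \<in> borel_measurable (lb ({0..<n} \<times> {0..<n}))"
    unfolding confined_det_def by measurable
next
  fix z :: complex and p :: "complex poly" assume "p \<noteq> 0"
  have r: "poly ([:- z, 1:] * p) y = 0 \<longleftrightarrow> y = z \<or> poly p y = 0" for y
    by (simp only: poly_mult mult_eq_0_iff) auto
  have "cmod (poly ([:- z, 1:] * p) 0) = cmod z * cmod (poly p 0)"
    by (simp add: norm_mult)
  then have "(cmod (poly ([:- z, 1:] * p) 0))\<^sup>2 powr L = (cmod z)\<^sup>2 powr L * (cmod (poly p 0))\<^sup>2 powr L"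
    by (simp add: power_mult_distrib powr_mult)
  then show "confined_det S L ([:- z, 1:] * p) = (if z \<in> S then ennreal ((cmod z)\<^sup>2 powr L) else 0) * confined_det S L p"
    unfolding confined_det_def r by (auto simp: ennreal_mult)
qed

text \<open>In the variable \<open>t = (cmod z)\<^sup>2\<close> planar measure has constant density
  \<open>pi\<close>, and the integrand becomes an unnormalized gamma density of shape
  \<open>b + 1\<close>.\<close>

lemma nn_integral_planar_gamma:
  assumes a: "b > -1" and [measurable]: "T \<in> sets borel"
  shows "(\<integral>\<^sup>+z. ennreal (indicator T ((cmod z)\<^sup>2) * (cmod z)\<^sup>2 powr b * exp (- (cmod z)\<^sup>2)) \<partial>lborel) =
    ennreal (pi * Gamma (b + 1) * measure (gamma_law (b + 1)) T)"
proof -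
  interpret prob_space "gamma_law (b + 1)" using a by (intro prob_space_gamma_law) simp
  have G: "Gamma (b + 1) > 0" using a by simp
  have "(\<integral>\<^sup>+z. ennreal (indicator T ((cmod z)\<^sup>2) * (cmod z)\<^sup>2 powr b * exp (- (cmod z)\<^sup>2)) \<partial>lborel) =
    (\<integral>\<^sup>+t. ennreal (pi * indicator {0..} t) * ennreal (indicator T t * t powr b * exp (- t)) \<partial>lborel)"
    by (rule nn_integral_cmod_square) measurable
  also have "\<dots> = (\<integral>\<^sup>+t. ennreal (pi * Gamma (b + 1)) *
      (ennreal (indicator {0..} t * t powr (b + 1 - 1) / exp t / Gamma (b + 1)) * indicator T t) \<partial>lborel)"
  proof (rule nn_integral_cong)
    fix t
    show "ennreal (pi * indicator {0..} t) * ennreal (indicator T t * t powr b * exp (- t)) = ennreal (pi * Gamma (b + 1)) *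
      (ennreal (indicator {0..} t * t powr (b + 1 - 1) / exp t / Gamma (b + 1)) * indicator T t)"
      using G by (cases "t \<in> T"; cases "t \<ge> 0") (auto simp: ennreal_mult[symmetric] exp_minus divide_inverse)
  qed
  also have "\<dots> = ennreal (pi * Gamma (b + 1)) * (\<integral>\<^sup>+t. ennreal (indicator {0..} t * t powr (b + 1 - 1) / exp t / Gamma (b + 1)) * indicator T t \<partial>lborel)"
    by (rule nn_integral_cmult) measurable
  also have "(\<integral>\<^sup>+t. ennreal (indicator {0..} t * t powr (b + 1 - 1) / exp t / Gamma (b + 1)) * indicator T t \<partial>lborel) = emeasure (gamma_law (b + 1)) T"
    unfolding gamma_law_def by (subst emeasure_density) auto
  finally show ?thesis using G by (simp add: emeasure_eq_measure ennreal_mult)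
qed

lemma cmod_det_cpf: "cmod (poly (cpf n x) 0) = cmod (Determinant.det (mat n n x))"
proof -
  have "- char_matrix (mat n n x) 0 = (-1) \<cdot>\<^sub>m mat n n x"
    by (rule eq_matI) (auto simp: char_matrix_def)
  then have "poly (cpf n x) 0 = Determinant.det ((-1) \<cdot>\<^sub>m mat n n x)"
    using char_poly_matrix[of "mat n n x" n 0] by simp
  then show ?thesis by (simp add: norm_mult norm_power)
qed

lemma det_mat_adjoint:
  fixes A :: "complex mat"
  assumes A: "A \<in> carrier_mat n n"
  shows "Determinant.det (mat_adjoint A) = cnj (Determinant.det A)"
proof -
  have "Determinant.det (mat_adjoint A) = Determinant.det (transpose_mat (mat_adjoint A))"
    using A by (intro det_transpose[symmetric, of _ n]) simp
  also have "\<dots> = cnj (Determinant.det A)"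
    using A by (subst (1 2) det_def'[of _ n]) (auto simp: cnj_sum cnj_prod permutes_def intro!: sum.cong prod.cong)
  finally show ?thesis .
qed

lemma induced_ginibre_weight_eq:
  "induced_ginibre_weight L (mat n n x) = (cmod (poly (cpf n x) 0))\<^sup>2 powr L * exp (- fro (mat n n x))"
proof -
  let ?A = "mat n n x"
  have "Determinant.det (mat_adjoint ?A * ?A) = cnj (Determinant.det ?A) * Determinant.det ?A"
    by (subst det_mult[of _ n]) (auto simp: det_mat_adjoint[of _ n])
  also have "\<dots> = of_real ((cmod (Determinant.det ?A))\<^sup>2)"
    by (simp only: complex_norm_square mult.commute)
  finally show ?thesis
    by (simp add: induced_ginibre_weight_def trace_adjoint_mult cmod_det_cpf)
qed

lemma inj_on_mat: "inj_on (mat n n) (space (lb ({0..<n} \<times> {0..<n})))"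
proof (rule inj_onI)
  fix x y :: "nat \<times> nat \<Rightarrow> complex"
  assume x: "x \<in> space (lb ({0..<n} \<times> {0..<n}))" and y: "y \<in> space (lb ({0..<n} \<times> {0..<n}))"
    and eq: "mat n n x = mat n n y"
  show "x = y"
  proof
    fix ij
    show "x ij = y ij"
    proof (cases "ij \<in> {0..<n} \<times> {0..<n}")
      case True
      then obtain i j where "ij = (i, j)" "i < n" "j < n" by auto
      then show ?thesis using arg_cong[OF eq, of "\<lambda>A. A $$ (i, j)"] by simp
    next
      case False
      then show ?thesis using x y unfolding space_PiM by (metis PiE_arb)
    qed
  qed
qed

text \<open>
  Kostlan's theorem for this ensemble: the squared moduli of the eigenvalues behave like independent
  gamma variables. The normalising constants cancel against the case \<open>T = UNIV\<close>.
\<close>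

theorem induced_ginibre_moduli:
  fixes M :: "'w measure"
  assumes gin: "induced_ginibre N L M G" and L: "L > 0" and T: "closed T"
  shows "{\<omega> \<in> space M. \<forall>x\<in>spectrum (G \<omega>). (cmod x)\<^sup>2 \<in> T} \<in> sets M"
    and "measure M {\<omega> \<in> space M. \<forall>x\<in>spectrum (G \<omega>). (cmod x)\<^sup>2 \<in> T} =
      (\<Prod>k\<in>{0..<N}. measure (gamma_law (L + real k + 1)) T)"
proof -
  obtain c where c: "c > 0" and dist: "distributed M (lborel_mat N) G (\<lambda>A. ennreal (c * induced_ginibre_weight L A))"
    and "prob_space M"
    using gin unfolding induced_ginibre_def by auto
  interpret prob_space M by fact
  let ?L = "lb ({0..<N} \<times> {0..<N})"
  define E where "E = (\<lambda>T. {\<omega> \<in> space M. \<forall>x\<in>spectrum (G \<omega>). (cmod x)\<^sup>2 \<in> T})"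
  define w where "w = (\<Prod>k\<in>{0..<N}. pi * Gamma (L + real k + 1))"
  \<comment> \<open>Gathers every factor that does not involve \<open>T\<close>. A priori it may be
    infinite; total mass 1 forces it to be 1.\<close>
  define X where "X = ennreal c * ginibre_const N * ennreal (fact N * w)"
  define q where "q = (\<lambda>T. \<Prod>k\<in>{0..<N}. measure (gamma_law (L + real k + 1)) T)"
  have w: "w \<ge> 0" unfolding w_def using L by (intro prod_nonneg) (auto intro!: mult_nonneg_nonneg less_imp_le[OF Gamma_real_pos])
  have Gm: "G \<in> measurable M (lborel_mat N)" and dm: "(\<lambda>A. ennreal (c * induced_ginibre_weight L A)) \<in> borel_measurable (lborel_mat N)"
    using dist by (auto simp: distributed_def)
  have main: "E T \<in> sets M \<and> emeasure M (E T) = X * ennreal (q T)" if T: "closed T" for T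
  proof -
    define S where "S = {z::complex. (cmod z)\<^sup>2 \<in> T}"
    have [measurable]: "T \<in> sets borel" using T by simp
    have "S = (\<lambda>z. (cmod z)\<^sup>2) -` T" by (auto simp: S_def)
    then have S: "closed S" using T by (auto intro!: closed_vimage continuous_intros)
    define Y where "Y = {x \<in> space ?L. \<forall>y. poly (cpf N x) y = 0 \<longrightarrow> y \<in> S}"
    have Y: "Y \<in> sets ?L" unfolding Y_def by (rule sets_roots_in_closed[OF S])
    define B where "B = mat N N ` Y"
    have B: "B \<in> sets (lborel_mat N)"
      unfolding B_def lborel_mat_def by (rule in_sets_embed_measure[OF Y])
    have spec: "spectrum (mat N N x) = {y. poly (cpf N x) y = 0}" for x :: "nat \<times> nat \<Rightarrow> complex"
      by (rule spectrum_root_char_poly[of _ N]) simp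
    have mB: "mat N N x \<in> B \<longleftrightarrow> x \<in> Y" if "x \<in> space ?L" for x
      using that inj_onD[OF inj_on_mat, of N x] unfolding B_def Y_def by auto
    have "G -` B \<inter> space M = E T"
    proof (rule Set.set_eqI)
      fix \<omega>
      show "\<omega> \<in> G -` B \<inter> space M \<longleftrightarrow> \<omega> \<in> E T"
      proof (cases "\<omega> \<in> space M")
        case True
        then have "G \<omega> \<in> mat N N ` space ?L"
          using measurable_space[OF Gm] by (simp add: lborel_mat_def space_embed_measure)
        then obtain x where x: "x \<in> space ?L" "G \<omega> = mat N N x" by auto
        then show ?thesis
          using True mB[OF x(1)] by (auto simp: E_def Y_def S_def spec)
      qed (simp add: E_def)
    qed
    then have ES: "E T \<in> sets M" and em: "emeasure M (E T) = (\<integral>\<^sup>+A. ennreal (c * induced_ginibre_weight L A) * indicator B A \<partial>lborel_mat N)"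
      using measurable_sets[OF Gm B] distributed_emeasure[OF dist B] by simp_all
    note em
    also have "\<dots> = (\<integral>\<^sup>+x. ennreal (c * induced_ginibre_weight L (mat N N x)) * indicator B (mat N N x) \<partial>?L)"
      unfolding lborel_mat_def
      by (rule nn_integral_embed_measure'[OF inj_on_mat])
         (use dm B in \<open>auto simp: lborel_mat_def intro!: borel_measurable_times_ennreal borel_measurable_indicator\<close>)
    also have "\<dots> = (\<integral>\<^sup>+x. ennreal c * (confined_det S L (cpf N x) * gw N x) \<partial>?L)"
    proof (rule nn_integral_cong)
      fix x assume x: "x \<in> space ?L"
      then show "ennreal (c * induced_ginibre_weight L (mat N N x)) * indicator B (mat N N x) =
          ennreal c * (confined_det S L (cpf N x) * gw N x)"
        using c mB[OF x] by (auto simp: confined_det_def induced_ginibre_weight_eq gw_def Y_def indicator_def ennreal_mult)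
    qed
    also have "\<dots> = ennreal c * (\<integral>\<^sup>+x. confined_det S L (cpf N x) * gw N x \<partial>?L)"
      using spectral_weight_confined_det[OF S, of L] unfolding spectral_weight_def
      by (intro nn_integral_cmult borel_measurable_times_ennreal gw_measurable) auto
    also have "(\<integral>\<^sup>+x. confined_det S L (cpf N x) * gw N x \<partial>?L) =
      ginibre_const N * (\<integral>\<^sup>+y. (\<Prod>i\<in>{0..<N}. (if y i \<in> S then ennreal ((cmod (y i))\<^sup>2 powr L) else 0) * ennreal (exp (- (cmod (y i))\<^sup>2))) *
      (\<Prod>i\<in>{0..<N}. \<Prod>j\<in>{0..<i}. ennreal ((cmod (y i - y j))\<^sup>2)) \<partial>lb {0..<N})"
      by (rule ginibre_eigenvalues[OF spectral_weight_confined_det[OF S]])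
    also have "(\<integral>\<^sup>+y. (\<Prod>i\<in>{0..<N}. (if y i \<in> S then ennreal ((cmod (y i))\<^sup>2 powr L) else 0) * ennreal (exp (- (cmod (y i))\<^sup>2))) *
      (\<Prod>i\<in>{0..<N}. \<Prod>j\<in>{0..<i}. ennreal ((cmod (y i - y j))\<^sup>2)) \<partial>lb {0..<N}) = ennreal (fact N * (w * q T))"
    proof -
      define g where "g = (\<lambda>z. indicator T ((cmod z)\<^sup>2) * (cmod z)\<^sup>2 powr L * exp (- (cmod z)\<^sup>2) :: real)"
      have gm [measurable]: "g \<in> borel_measurable borel" unfolding g_def by measurable
      \<comment> \<open>At \<open>z = 0\<close> both sides vanish, for \<open>k = 0\<close> too,
        because \<open>powr\<close> with base 0 is 0. Odd \<open>k\<close> is included since the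
        Vandermonde integral asks for integrability against every power of the modulus.\<close>
      have gz: "g z * cmod z ^ k = indicator T ((cmod z)\<^sup>2) * (cmod z)\<^sup>2 powr (L + real k / 2) * exp (- (cmod z)\<^sup>2)" for z k
      proof (cases "z = 0")
        case False
        have "cmod z ^ k = cmod z powr real k" using False by (simp add: powr_realpow)
        also have "\<dots> = (cmod z powr 2) powr (real k / 2)" by (subst powr_powr) simp
        also have "cmod z powr 2 = (cmod z)\<^sup>2" using False by simp
        finally show ?thesis by (simp add: g_def powr_add)
      qed (simp add: g_def)
      have nn: "(\<integral>\<^sup>+z. ennreal (g z * cmod z ^ k) \<partial>lborel) =
          ennreal (pi * Gamma (L + real k / 2 + 1) * measure (gamma_law (L + real k / 2 + 1)) T)" for k
        unfolding gz using L by (intro nn_integral_planar_gamma) (auto intro: less_le_trans[of _ 0])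
      have pos: "0 \<le> pi * Gamma (L + real k / 2 + 1) * measure (gamma_law (L + real k / 2 + 1)) T" for k
        using L by (intro mult_nonneg_nonneg) (auto intro!: less_imp_le[OF Gamma_real_pos])
      have hb: "has_bochner_integral lborel (\<lambda>z. g z * cmod z ^ k) (pi * Gamma (L + real k / 2 + 1) * measure (gamma_law (L + real k / 2 + 1)) T)" for k
        by (rule has_bochner_integral_nn_integral[OF _ _ pos nn]) (auto simp: g_def)
      have "(\<integral>\<^sup>+y. (\<Prod>i\<in>{0..<N}. ennreal (g (y i))) * (\<Prod>i\<in>{0..<N}. \<Prod>j\<in>{0..<i}. ennreal ((cmod (y i - y j))\<^sup>2)) \<partial>lb {0..<N}) =
        ennreal (fact N * (\<Prod>k\<in>{0..<N}. \<integral>z. g z * cmod z ^ (2 * k) \<partial>lborel))"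
        by (rule nn_integral_vandermonde_radial[OF gm])
           (auto simp: g_def norm_mult intro: integrable.intros[OF hb, unfolded g_def])
      also have "(\<Prod>k\<in>{0..<N}. \<integral>z. g z * cmod z ^ (2 * k) \<partial>lborel) = w * q T"
        unfolding w_def q_def prod.distrib[symmetric]
        by (intro prod.cong refl) (simp add: has_bochner_integral_integral_eq[OF hb])
      also have "(\<lambda>y. \<Prod>i\<in>{0..<N}. ennreal (g (y i))) = (\<lambda>y. \<Prod>i\<in>{0..<N}. (if y i \<in> S then ennreal ((cmod (y i))\<^sup>2 powr L) else 0) * ennreal (exp (- (cmod (y i))\<^sup>2)))"
        by (intro ext prod.cong refl) (auto simp: g_def S_def ennreal_mult indicator_def)
      finally show ?thesis .
    qed
    also have "ennreal c * (ginibre_const N * ennreal (fact N * (w * q T))) = X * ennreal (q T)"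
      using w by (simp add: X_def ennreal_mult q_def prod_nonneg mult_ac)
    finally show ?thesis using ES by blast
  qed
  have "q UNIV = 1"
  proof -
    have "measure (gamma_law (L + real k + 1)) UNIV = 1" for k
      using prob_space.prob_space[OF prob_space_gamma_law[of "L + real k + 1"]] L by simp
    then show ?thesis by (simp add: q_def)
  qed
  moreover have "E UNIV = space M" by (simp add: E_def)
  ultimately have "X = 1" using main[of UNIV] emeasure_space_1 by simp
  then have "emeasure M (E T) = ennreal (q T)" and "E T \<in> sets M" using main[OF T] by simp_all
  moreover have "q T \<ge> 0" by (simp add: q_def prod_nonneg)
  ultimately show "{\<omega> \<in> space M. \<forall>x\<in>spectrum (G \<omega>). (cmod x)\<^sup>2 \<in> T} \<in> sets M"
    and "measure M {\<omega> \<in> space M. \<forall>x\<in>spectrum (G \<omega>). (cmod x)\<^sup>2 \<in> T} =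
      (\<Prod>k\<in>{0..<N}. measure (gamma_law (L + real k + 1)) T)"
    unfolding E_def q_def by (simp_all add: measure_def)
qed

section \<open>Limits\<close>

text \<open>
  Far from the edge \<open>y = 1\<close> each gamma law charges \<open>T\<close> up to an exponentially small mass, which beats
  the number \<open>N\<close> of factors.
\<close>

lemma moduli_prod_tendsto_1:
  fixes a :: "nat \<Rightarrow> nat \<Rightarrow> real" and A :: "nat \<Rightarrow> real" and T :: "nat \<Rightarrow> real set"
  assumes y: "y > 0" "y \<noteq> 1" and \<beta>: "\<beta> > 0" "\<And>N. A N = \<beta> * real N"
    and a: "\<And>N k. k < N \<Longrightarrow> a N k > 0" "\<And>N k. k < N \<Longrightarrow> (y - 1) * (A N - a N k) \<ge> 0"
    and T: "\<And>N. T N \<in> sets borel" "\<And>N t. t \<notin> T N \<Longrightarrow> (y - 1) * (t - y * A N) \<ge> 0"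
  shows "(\<lambda>N. \<Prod>k\<in>{0..<N}. measure (gamma_law (a N k)) (T N)) \<longlonglongrightarrow> 1"
proof -
  \<comment> \<open>For shape \<open>A N\<close> Chernoff's bound decays at the rate
    \<open>y - 1 - ln y\<close> per unit of \<open>A N\<close>, which is positive for every
    \<open>y \<noteq> 1\<close>.\<close>
  define \<kappa> where "\<kappa> = (y - 1 - ln y) * \<beta>"
  have "\<kappa> > 0"
    using y \<beta>(1) ln_le_minus_one[of y] ln_eq_minus_one[of y]
    unfolding \<kappa>_def by (intro mult_pos_pos) force+
  have tail: "measure (gamma_law (a N k)) (T N) \<ge> 1 - exp (- \<kappa> * real N)" if k: "k < N" for N k
  proof -
    interpret prob_space "gamma_law (a N k)" by (rule prob_space_gamma_law[OF a(1)[OF k]])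
    have "1 - measure (gamma_law (a N k)) (T N) = measure (gamma_law (a N k)) (- T N)"
      using prob_compl[of "T N"] T(1) by (simp add: Compl_eq_Diff_UNIV)
    also have "\<dots> \<le> exp ((1 - y) * A N) * y powr a N k"
      using T(1)[of N] by (intro gamma_law_tail[OF a(1)[OF k] y(1)] T(2)) (auto simp: Compl_eq_Diff_UNIV)
    also have "y powr a N k = exp (a N k * ln y)" using y by (simp add: powr_def)
    \<comment> \<open>The shapes lie on the favourable side of \<open>A N\<close>, so replacing each
      of them by \<open>A N\<close> only weakens the bound.\<close>
    also have "\<dots> \<le> exp (A N * ln y)"
    proof -
      have "0 \<le> (A N - a N k) * ln y"
      proof (cases "y > 1")
        case True
        then show ?thesis using a(2)[OF k] by (simp add: zero_le_mult_iff)
      next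
        case False
        then have "y < 1" using y by simp
        then show ?thesis using a(2)[OF k] y by (simp add: zero_le_mult_iff)
      qed
      then show ?thesis by (simp add: algebra_simps)
    qed
    also have "exp ((1 - y) * A N) * exp (A N * ln y) = exp (- \<kappa> * real N)"
      by (simp add: exp_add[symmetric] \<kappa>_def \<beta>(2) algebra_simps)
    finally show ?thesis by simp
  qed
  have lower: "1 - real N * exp (- \<kappa> * real N) \<le> (\<Prod>k\<in>{0..<N}. measure (gamma_law (a N k)) (T N))" for N
  proof -
    have "exp (- \<kappa> * real N) \<le> 1" using \<open>\<kappa> > 0\<close> by simp
    \<comment> \<open>Bernoulli's inequality: N factors together lose at most N times the tail of
      one.\<close>
    then have "1 + real N * (- exp (- \<kappa> * real N)) \<le> (1 + (- exp (- \<kappa> * real N))) ^ N"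
      by (intro Bernoulli_inequality) simp
    also have "\<dots> = (\<Prod>k\<in>{0..<N}. 1 - exp (- \<kappa> * real N))" by simp
    also have "\<dots> \<le> (\<Prod>k\<in>{0..<N}. measure (gamma_law (a N k)) (T N))"
      using tail \<open>exp (- \<kappa> * real N) \<le> 1\<close> by (intro prod_mono) auto
    finally show ?thesis by simp
  qed
  have upper: "(\<Prod>k\<in>{0..<N}. measure (gamma_law (a N k)) (T N)) \<le> 1" for N
    by (intro prod_le_1) (auto intro!: prob_space.prob_le_1 prob_space_gamma_law a(1))
  have "(\<lambda>N. 1 - real N * exp (- \<kappa> * real N)) \<longlonglongrightarrow> 1"
    using \<open>\<kappa> > 0\<close> by real_asymp
  then show ?thesis
    by (rule tendsto_sandwich[OF always_eventually always_eventually _ tendsto_const, rotated 2])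
       (use lower upper in auto)
qed

text \<open>
  At the edge an unbounded number of the factors (those with index \<open>i N m\<close>, \<open>m\<close> fixed) stay below \<open>35/36\<close>.
\<close>

lemma moduli_prod_tendsto_0:
  fixes a :: "nat \<Rightarrow> nat \<Rightarrow> real" and A :: "nat \<Rightarrow> real" and T :: "nat \<Rightarrow> real set" and i :: "nat \<Rightarrow> nat \<Rightarrow> nat"
  assumes A: "filterlim A at_top sequentially" and s: "s = 1 \<or> s = -1"
    and pos: "\<And>N k. k < N \<Longrightarrow> a N k > 0"
    and i: "\<And>N m. m < N \<Longrightarrow> i N m < N" "\<And>N m m'. m < N \<Longrightarrow> m' < N \<Longrightarrow> i N m = i N m' \<Longrightarrow> m = m'"
    and d: "\<And>N m. m < N \<Longrightarrow> a N (i N m) = A N + d m"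
    and T: "\<And>N. T N \<in> sets borel" "\<And>N t. t \<in> T N \<Longrightarrow> \<not> s * (t - A N) > 0"
  shows "(\<lambda>N. \<Prod>k\<in>{0..<N}. measure (gamma_law (a N k)) (T N)) \<longlonglongrightarrow> 0"
proof (rule LIMSEQ_I)
  fix e :: real assume "e > 0"
  \<comment> \<open>35/36 is one minus the mass 1/36 that eventually lies on the wrong side of
    \<open>A N\<close>; \<open>K\<close> such factors push the product below \<open>e\<close>, the
    others being at most 1.\<close>
  obtain K where K: "(35 / 36 :: real) ^ K < e" using real_arch_pow_inv[OF \<open>e > 0\<close>, of "35 / 36"] by auto
  have "\<forall>\<^sub>F N in sequentially. \<forall>m\<in>{0..<K}. 1 / 36 \<le> measure (gamma_law (A N + d m)) {t. s * (t - A N) > 0}"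
    using gamma_law_not_concentrated[OF s] by (intro eventually_ball_finite ballI eventually_compose_filterlim[OF _ A]) auto
  then have ev: "\<forall>\<^sub>F N in sequentially. N \<ge> K \<and> (\<forall>m\<in>{0..<K}. 1 / 36 \<le> measure (gamma_law (A N + d m)) {t. s * (t - A N) > 0})"
    using eventually_ge_at_top[of K] by eventually_elim blast
  obtain N0 where N0: "\<And>N. N \<ge> N0 \<Longrightarrow> N \<ge> K \<and> (\<forall>m\<in>{0..<K}. 1 / 36 \<le> measure (gamma_law (A N + d m)) {t. s * (t - A N) > 0})"
    using ev unfolding eventually_sequentially by blast
  show "\<exists>no. \<forall>N\<ge>no. norm ((\<Prod>k\<in>{0..<N}. measure (gamma_law (a N k)) (T N)) - 0) < e"
  proof (intro exI allI impI)
    fix N assume "N \<ge> N0"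
    note N = N0[OF this]
    define f where "f = (\<lambda>k. measure (gamma_law (a N k)) (T N))"
    have f: "0 \<le> f k" "k < N \<Longrightarrow> f k \<le> 1" for k
      unfolding f_def by (auto intro!: prob_space.prob_le_1 prob_space_gamma_law pos)
    have inj: "inj_on (i N) {0..<K}"
      by (rule inj_onI, rule i(2)[of _ N]) (use N in auto)
    have sub: "i N ` {0..<K} \<subseteq> {0..<N}" using i(1) N by auto
    have "(\<Prod>k\<in>{0..<N}. f k) = (\<Prod>k\<in>{0..<N} - i N ` {0..<K}. f k) * (\<Prod>k\<in>i N ` {0..<K}. f k)"
      using sub by (intro prod.subset_diff) auto
    also have "\<dots> \<le> 1 * (\<Prod>k\<in>i N ` {0..<K}. f k)"
      using f by (intro mult_right_mono prod_le_1 prod_nonneg) auto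
    also have "\<dots> = (\<Prod>m\<in>{0..<K}. f (i N m))" using prod.reindex[OF inj, of f] by simp
    also have "\<dots> \<le> (\<Prod>m\<in>{0..<K}. 35 / 36)"
    proof (intro prod_mono conjI f)
      fix m assume m: "m \<in> {0..<K}"
      then have mN: "m < N" using N by simp
      have a: "a N (i N m) = A N + d m" by (rule d[OF mN])
      have "A N + d m > 0" using pos[OF i(1)[OF mN]] by (simp add: a)
      then interpret prob_space "gamma_law (A N + d m)" by (rule prob_space_gamma_law)
      have "f (i N m) \<le> measure (gamma_law (A N + d m)) (- {t. s * (t - A N) > 0})"
        unfolding f_def a using T(2) by (intro finite_measure_mono) (auto simp: Compl_eq_Diff_UNIV)
      also have "\<dots> = 1 - measure (gamma_law (A N + d m)) {t. s * (t - A N) > 0}"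
        using prob_compl[of "{t. s * (t - A N) > 0}"] by (simp add: Compl_eq_Diff_UNIV)
      finally show "f (i N m) \<le> 35 / 36" using N m by force
    qed
    also have "\<dots> < e" using K by simp
    finally have "(\<Prod>k\<in>{0..<N}. f k) < e" .
    moreover have "(\<Prod>k\<in>{0..<N}. f k) \<ge> 0" by (intro prod_nonneg) (auto simp: f)
    ultimately show "norm ((\<Prod>k\<in>{0..<N}. measure (gamma_law (a N k)) (T N)) - 0) < e"
      by (simp add: f_def)
  qed
qed

text \<open>\<open>N > 0\<close> makes the spectrum nonempty, so that its moduli really have a
  maximum and a minimum.\<close>

lemma spectral_radius_le_iff:
  assumes "A \<in> carrier_mat N N" "N > 0"
  shows "spectral_radius A \<le> x \<longleftrightarrow> (\<forall>z\<in>spectrum A. cmod z \<le> x)"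
    and "x \<le> min_modulus A \<longleftrightarrow> (\<forall>z\<in>spectrum A. x \<le> cmod z)"
  using card_finite_spectrum(1)[OF assms(1)] spectrum_non_empty[OF assms]
  unfolding spectral_radius_def min_modulus_def by auto

text \<open>The edges are \<open>r\<^sup>2 * (\<alpha> + 1) = \<alpha>\<close> and
  \<open>R = 1\<close>, set by the smallest shape, \<open>L + 1\<close>, and the largest,
  \<open>L + N\<close>. The joint probability is squeezed between bounds in the two marginals, which
  is enough since their limits are 0 or 1. As \<open>lim\<close> is a total function, convergence is
  part of the claim.\<close>

theorem theorem9:
  fixes \<alpha> :: real
    and M :: "nat \<Rightarrow> 'w measure"
    and G :: "nat \<Rightarrow> 'w \<Rightarrow> complex mat"
    and L :: "nat \<Rightarrow> real"
  defines "L \<equiv> (\<lambda>N. \<alpha> * real N)"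
  assumes "\<alpha> > 0"
    and "\<And>N. N \<ge> 1 \<Longrightarrow> induced_ginibre N (L N) (M N) (G N)"
  shows "\<forall>r R :: real. r > 0 \<longrightarrow> R > 0 \<longrightarrow>
    (let p_joint = (\<lambda>N. \<P>(\<omega> in M N. min_modulus (G N \<omega>) / sqrt (L N + real N) \<ge> r
                                   \<and> spectral_radius (G N \<omega>) / sqrt (L N + real N) \<le> R));
         p_min = (\<lambda>N. \<P>(\<omega> in M N. min_modulus (G N \<omega>) / sqrt (L N + real N) \<ge> r));
         p_max = (\<lambda>N. \<P>(\<omega> in M N. spectral_radius (G N \<omega>) / sqrt (L N + real N) \<le> R))
     in convergent p_joint \<and> convergent p_min \<and> convergent p_max \<and>
        lim p_joint = lim p_min * lim p_max)"
proof (intro allI impI)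
  fix r R :: real assume r: "r > 0" and R: "R > 0"
  note gin = assms(3)
  define A where "A = (\<lambda>N. L N + real N)"
  define Tmin Tmax where "Tmin = (\<lambda>N. {r\<^sup>2 * A N..})" and "Tmax = (\<lambda>N. {..R\<^sup>2 * A N})"
  define a where "a = (\<lambda>N k. L N + real k + 1)"
  define pj where "pj = (\<lambda>N. \<P>(\<omega> in M N. min_modulus (G N \<omega>) / sqrt (L N + real N) \<ge> r
                                   \<and> spectral_radius (G N \<omega>) / sqrt (L N + real N) \<le> R))"
  define pm where "pm = (\<lambda>N. \<P>(\<omega> in M N. min_modulus (G N \<omega>) / sqrt (L N + real N) \<ge> r))"
  define px where "px = (\<lambda>N. \<P>(\<omega> in M N. spectral_radius (G N \<omega>) / sqrt (L N + real N) \<le> R))"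
  have Aeq: "A N = (\<alpha> + 1) * real N" for N by (simp add: A_def L_def algebra_simps)
  have \<alpha>1: "\<alpha> + 1 > 0" using \<open>\<alpha> > 0\<close> by simp
  have Ltop: "filterlim L at_top sequentially" and Atop: "filterlim A at_top sequentially"
    using \<open>\<alpha> > 0\<close> \<alpha>1 unfolding L_def Aeq[abs_def] by real_asymp+
  have apos: "a N k > 0" for N k using \<open>\<alpha> > 0\<close> by (simp add: a_def L_def add_nonneg_pos)
  have key: "pm N = (\<Prod>k\<in>{0..<N}. measure (gamma_law (a N k)) (Tmin N)) \<and>
      px N = (\<Prod>k\<in>{0..<N}. measure (gamma_law (a N k)) (Tmax N)) \<and>
      pj N \<le> pm N \<and> pj N \<le> px N \<and> pm N + px N - 1 \<le> pj N \<and> pm N \<le> 1 \<and> px N \<le> 1 \<and> pj N \<ge> 0" if N: "N \<ge> 1" for N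
  proof -
    have "prob_space (M N)" using gin[OF N] by (simp add: induced_ginibre_def)
    interpret prob_space "M N" by fact
    have LN: "L N > 0" using N \<open>\<alpha> > 0\<close> by (simp add: L_def)
    have AN: "A N > 0" using LN by (simp add: A_def)
    have Gc: "G N \<omega> \<in> carrier_mat N N" if "\<omega> \<in> space (M N)" for \<omega>
    proof -
      have "G N \<in> measurable (M N) (lborel_mat N)"
        using gin[OF N] by (auto simp: induced_ginibre_def distributed_def)
      from measurable_space[OF this that] show ?thesis
        by (auto simp: lborel_mat_def space_embed_measure)
    qed
    have min_iff: "min_modulus (G N \<omega>) / sqrt (L N + real N) \<ge> r \<longleftrightarrow> (\<forall>z\<in>spectrum (G N \<omega>). (cmod z)\<^sup>2 \<in> Tmin N)"
      if "\<omega> \<in> space (M N)" for \<omega>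
    proof -
      have "min_modulus (G N \<omega>) / sqrt (L N + real N) \<ge> r \<longleftrightarrow> r * sqrt (A N) \<le> min_modulus (G N \<omega>)"
        using AN by (simp add: A_def pos_le_divide_eq)
      also have "\<dots> \<longleftrightarrow> (\<forall>z\<in>spectrum (G N \<omega>). r * sqrt (A N) \<le> cmod z)"
        using N by (intro spectral_radius_le_iff(2)[OF Gc[OF that]]) simp
      also have "\<dots> \<longleftrightarrow> (\<forall>z\<in>spectrum (G N \<omega>). (cmod z)\<^sup>2 \<in> Tmin N)"
      proof (rule ball_cong[OF refl])
        fix z
        have "r * sqrt (A N) \<le> cmod z \<longleftrightarrow> (r * sqrt (A N))\<^sup>2 \<le> (cmod z)\<^sup>2"
          using r AN by (subst power_mono_iff) auto
        then show "(r * sqrt (A N) \<le> cmod z) = ((cmod z)\<^sup>2 \<in> Tmin N)"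
          using AN by (simp add: Tmin_def power_mult_distrib)
      qed
      finally show ?thesis .
    qed
    have max_iff: "spectral_radius (G N \<omega>) / sqrt (L N + real N) \<le> R \<longleftrightarrow> (\<forall>z\<in>spectrum (G N \<omega>). (cmod z)\<^sup>2 \<in> Tmax N)"
      if "\<omega> \<in> space (M N)" for \<omega>
    proof -
      have "spectral_radius (G N \<omega>) / sqrt (L N + real N) \<le> R \<longleftrightarrow> spectral_radius (G N \<omega>) \<le> R * sqrt (A N)"
        using AN by (simp add: A_def pos_divide_le_eq)
      also have "\<dots> \<longleftrightarrow> (\<forall>z\<in>spectrum (G N \<omega>). cmod z \<le> R * sqrt (A N))"
        using N by (intro spectral_radius_le_iff(1)[OF Gc[OF that]]) simp
      also have "\<dots> \<longleftrightarrow> (\<forall>z\<in>spectrum (G N \<omega>). (cmod z)\<^sup>2 \<in> Tmax N)"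
      proof (rule ball_cong[OF refl])
        fix z
        have "cmod z \<le> R * sqrt (A N) \<longleftrightarrow> (cmod z)\<^sup>2 \<le> (R * sqrt (A N))\<^sup>2"
          using R AN by (subst power_mono_iff) auto
        then show "(cmod z \<le> R * sqrt (A N)) = ((cmod z)\<^sup>2 \<in> Tmax N)"
          using AN by (simp add: Tmax_def power_mult_distrib)
      qed
      finally show ?thesis .
    qed
    define Em where "Em = {\<omega> \<in> space (M N). \<forall>z\<in>spectrum (G N \<omega>). (cmod z)\<^sup>2 \<in> Tmin N}"
    define Ex where "Ex = {\<omega> \<in> space (M N). \<forall>z\<in>spectrum (G N \<omega>). (cmod z)\<^sup>2 \<in> Tmax N}"
    have pmE: "pm N = prob Em" and pxE: "px N = prob Ex" and pjE: "pj N = prob (Em \<inter> Ex)"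
      unfolding pm_def px_def pj_def Em_def Ex_def
      by (auto intro!: arg_cong[of _ _ prob] simp: min_iff max_iff)
    have cl: "closed (Tmin N)" "closed (Tmax N)" by (simp_all add: Tmin_def Tmax_def)
    note mm = induced_ginibre_moduli[OF gin[OF N] LN cl(1), folded Em_def a_def]
    note mx = induced_ginibre_moduli[OF gin[OF N] LN cl(2), folded Ex_def a_def]
    \<comment> \<open>Inclusion and exclusion with the union bounded by 1 gives the lower bound for
      the joint probability.\<close>
    have "prob (Em \<union> Ex) = prob Em + prob Ex - prob (Em \<inter> Ex)"
      using mm(1) mx(1) by (intro finite_measure_Union' [THEN trans]) (auto simp: finite_measure_Diff' Int_commute)
    then have "prob Em + prob Ex - 1 \<le> prob (Em \<inter> Ex)" using prob_le_1[of "Em \<union> Ex"] by linarith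
    moreover have "prob (Em \<inter> Ex) \<le> prob Em" "prob (Em \<inter> Ex) \<le> prob Ex"
      using mm(1) mx(1) by (auto intro!: finite_measure_mono)
    moreover have "prob Em = (\<Prod>k\<in>{0..<N}. measure (gamma_law (a N k)) (Tmin N))"
        "prob Ex = (\<Prod>k\<in>{0..<N}. measure (gamma_law (a N k)) (Tmax N))"
      using mm(2) mx(2) by (simp_all only: a_def)
    ultimately show ?thesis
      using prob_le_1[of Em] prob_le_1[of Ex] unfolding pmE pxE pjE by (simp only: measure_nonneg simp_thms)
  qed
  have ev: "\<forall>\<^sub>F N in sequentially. N \<ge> (1::nat)" by (rule eventually_ge_at_top)
  have pm1: "pm \<longlonglongrightarrow> 1" if "r\<^sup>2 * (\<alpha> + 1) < \<alpha>"
  proof -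
    \<comment> \<open>All shapes exceed \<open>L N\<close>, which therefore is the centre. This
      \<open>y\<close> makes \<open>y * L N\<close> the threshold of \<open>Tmin N\<close>, and
      \<open>y < 1\<close> says exactly that \<open>r\<close> is below the inner edge.\<close>
    define y where "y = r\<^sup>2 * (\<alpha> + 1) / \<alpha>"
    have y: "y > 0" "y < 1" using that r \<open>\<alpha> > 0\<close> by (simp_all add: y_def)
    have yA: "y * L N = r\<^sup>2 * A N" for N using \<open>\<alpha> > 0\<close> by (simp add: y_def Aeq L_def)
    have "(\<lambda>N. \<Prod>k\<in>{0..<N}. measure (gamma_law (a N k)) (Tmin N)) \<longlonglongrightarrow> 1"
    proof (rule moduli_prod_tendsto_1[where y = y and \<beta> = \<alpha> and A = L])
      show "0 \<le> (y - 1) * (L N - a N k)" for N k using y by (intro mult_nonpos_nonpos) (auto simp: a_def)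
      show "0 \<le> (y - 1) * (t - y * L N)" if "t \<notin> Tmin N" for N t
        using that y by (intro mult_nonpos_nonpos) (auto simp: Tmin_def yA)
    qed (use y \<open>\<alpha> > 0\<close> apos in \<open>auto simp: L_def Tmin_def\<close>)
    moreover have "\<forall>\<^sub>F N in sequentially. (\<Prod>k\<in>{0..<N}. measure (gamma_law (a N k)) (Tmin N)) = pm N"
      using ev by eventually_elim (simp add: key)
    ultimately show ?thesis by (rule Lim_transform_eventually)
  qed
  have pm0: "pm \<longlonglongrightarrow> 0" if "\<not> r\<^sup>2 * (\<alpha> + 1) < \<alpha>"
  proof -
    have le: "L N \<le> r\<^sup>2 * A N" for N
    proof -
      have "\<alpha> * real N \<le> (r\<^sup>2 * (\<alpha> + 1)) * real N" using that by (intro mult_right_mono) auto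
      then show ?thesis by (simp add: L_def Aeq mult.assoc)
    qed
    have "(\<lambda>N. \<Prod>k\<in>{0..<N}. measure (gamma_law (a N k)) (Tmin N)) \<longlonglongrightarrow> 0"
    \<comment> \<open>The smallest shapes are \<open>L N + m + 1\<close>, at a distance from
      \<open>L N\<close> that does not grow with N. With \<open>s = -1\<close> the relevant mass
      lies below \<open>L N\<close>, hence below the threshold of \<open>Tmin N\<close>.\<close>
    proof (rule moduli_prod_tendsto_0[where s = "-1" and A = L and i = "\<lambda>N m. m" and d = "\<lambda>m. real m + 1"])
      show "\<not> 0 < - 1 * (t - L N)" if "t \<in> Tmin N" for N t using that le[of N] by (simp add: Tmin_def)
    qed (use Ltop apos in \<open>auto simp: a_def Tmin_def\<close>)
    moreover have "\<forall>\<^sub>F N in sequentially. (\<Prod>k\<in>{0..<N}. measure (gamma_law (a N k)) (Tmin N)) = pm N"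
      using ev by eventually_elim (simp add: key)
    ultimately show ?thesis by (rule Lim_transform_eventually)
  qed
  have px1: "px \<longlonglongrightarrow> 1" if "R > 1"
  proof -
    have y: "R\<^sup>2 > 1" using that by (simp add: one_less_power)
    have "(\<lambda>N. \<Prod>k\<in>{0..<N}. measure (gamma_law (a N k)) (Tmax N)) \<longlonglongrightarrow> 1"
    \<comment> \<open>The largest shape, at index N - 1, is \<open>A N\<close> itself, so the
      threshold is \<open>R\<^sup>2\<close> times the centre.\<close>
    proof (rule moduli_prod_tendsto_1[where y = "R\<^sup>2" and \<beta> = "\<alpha> + 1" and A = A])
      show "0 \<le> (R\<^sup>2 - 1) * (A N - a N k)" if "k < N" for N k
        using y that by (intro mult_nonneg_nonneg) (auto simp: a_def A_def)
      show "0 \<le> (R\<^sup>2 - 1) * (t - R\<^sup>2 * A N)" if "t \<notin> Tmax N" for N t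
        using that y by (intro mult_nonneg_nonneg) (auto simp: Tmax_def)
    qed (use y \<alpha>1 R apos in \<open>auto simp: Aeq Tmax_def\<close>)
    moreover have "\<forall>\<^sub>F N in sequentially. (\<Prod>k\<in>{0..<N}. measure (gamma_law (a N k)) (Tmax N)) = px N"
      using ev by eventually_elim (simp add: key)
    ultimately show ?thesis by (rule Lim_transform_eventually)
  qed
  have px0: "px \<longlonglongrightarrow> 0" if "\<not> R > 1"
  proof -
    have le: "R\<^sup>2 * A N \<le> A N" for N
      using that R \<alpha>1 by (intro mult_left_le_one_le) (auto simp: Aeq power_le_one)
    have "(\<lambda>N. \<Prod>k\<in>{0..<N}. measure (gamma_law (a N k)) (Tmax N)) \<longlonglongrightarrow> 0"
    \<comment> \<open>Counting down from the last index gives the shapes \<open>A N - m\<close>;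
      \<open>m < N\<close> keeps the natural subtraction exact.\<close>
    proof (rule moduli_prod_tendsto_0[where s = 1 and A = A and i = "\<lambda>N m. N - 1 - m" and d = "\<lambda>m. - real m"])
      show "\<not> 0 < 1 * (t - A N)" if "t \<in> Tmax N" for N t using that le[of N] by (simp add: Tmax_def)
    qed (use Atop apos in \<open>auto simp: a_def A_def Tmax_def\<close>)
    moreover have "\<forall>\<^sub>F N in sequentially. (\<Prod>k\<in>{0..<N}. measure (gamma_law (a N k)) (Tmax N)) = px N"
      using ev by eventually_elim (simp add: key)
    ultimately show ?thesis by (rule Lim_transform_eventually)
  qed
  have pj_le: "pj N \<le> pm N" "pj N \<le> px N" and pj_ge: "pm N + px N - 1 \<le> pj N" and pj_le_1: "pj N \<le> 1"
    if "N \<ge> 1" for N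
    using key[OF that] by linarith+
  have "\<exists>l m. pm \<longlonglongrightarrow> l \<and> px \<longlonglongrightarrow> m \<and> pj \<longlonglongrightarrow> l * m"
  proof -
    have small: "pj \<longlonglongrightarrow> 0" if "q \<longlonglongrightarrow> 0" "\<And>N. N \<ge> 1 \<Longrightarrow> pj N \<le> q N" for q
    proof (rule tendsto_sandwich[OF _ _ tendsto_const that(1)])
      show "\<forall>\<^sub>F N in sequentially. 0 \<le> pj N" using ev by eventually_elim (simp add: key)
      show "\<forall>\<^sub>F N in sequentially. pj N \<le> q N" using ev by eventually_elim (simp add: that(2))
    qed
    \<comment> \<open>If one marginal tends to 0, so does the joint probability, and the other
      marginal merely has to converge. If both tend to 1, the lower bound forces the joint
      probability to 1.\<close>
    consider "\<not> r\<^sup>2 * (\<alpha> + 1) < \<alpha>" | "\<not> R > 1" | "r\<^sup>2 * (\<alpha> + 1) < \<alpha>" "R > 1" by blast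
    then show ?thesis
    proof cases
      case 1
      have "\<exists>m. px \<longlonglongrightarrow> m" using px0 px1 by blast
      moreover have "pj \<longlonglongrightarrow> 0" by (rule small[OF pm0[OF 1] pj_le(1)])
      ultimately show ?thesis using pm0[OF 1] by (metis mult_zero_left)
    next
      case 2
      have "\<exists>m. pm \<longlonglongrightarrow> m" using pm0 pm1 by blast
      moreover have "pj \<longlonglongrightarrow> 0" by (rule small[OF px0[OF 2] pj_le(2)])
      ultimately show ?thesis using px0[OF 2] by (metis mult_zero_right)
    next
      case 3
      have "(\<lambda>N. pm N + px N - 1) \<longlonglongrightarrow> 1 + 1 - 1"
        by (intro tendsto_intros pm1 px1 3)
      then have l: "(\<lambda>N. pm N + px N - 1) \<longlonglongrightarrow> 1" by simp
      have "pj \<longlonglongrightarrow> 1"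
      proof (rule tendsto_sandwich[OF _ _ l tendsto_const])
        show "\<forall>\<^sub>F N in sequentially. pm N + px N - 1 \<le> pj N" using ev by eventually_elim (rule pj_ge)
        show "\<forall>\<^sub>F N in sequentially. pj N \<le> 1" using ev by eventually_elim (rule pj_le_1)
      qed
      then show ?thesis using pm1[OF 3(1)] px1[OF 3(2)] by (intro exI[of _ 1]) simp
    qed
  qed
  then have "convergent pj \<and> convergent pm \<and> convergent px \<and> lim pj = lim pm * lim px"
    by (auto simp: convergent_def limI)
  then show "let p_joint = (\<lambda>N. \<P>(\<omega> in M N. min_modulus (G N \<omega>) / sqrt (L N + real N) \<ge> r
                                   \<and> spectral_radius (G N \<omega>) / sqrt (L N + real N) \<le> R));
         p_min = (\<lambda>N. \<P>(\<omega> in M N. min_modulus (G N \<omega>) / sqrt (L N + real N) \<ge> r));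
         p_max = (\<lambda>N. \<P>(\<omega> in M N. spectral_radius (G N \<omega>) / sqrt (L N + real N) \<le> R))
     in convergent p_joint \<and> convergent p_min \<and> convergent p_max \<and>
        lim p_joint = lim p_min * lim p_max"
    unfolding Let_def pj_def pm_def px_def .
qed

end
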